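(* Let $M$ be an oriented (connected) non-maximal space-like surface in $\mathbb E^4_1$ with space-like or time-like mean curvature vector. Then $M$ has pointwise 1-type Gauss map of the first kind if and only if $M$ is, up to isometries of $\mathbb E^4_1$, a CMC surface lying in the light cone $\mathcal{LC}\subset\mathbb E^4_1$, a Euclidean hyperplane $\mathbb E^3\subset\mathbb E^4_1$, a Lorentzian hyperplane $\mathbb E^3_1\subset\mathbb E^4_1$, the de Sitter space-time $\mathbb S^3_1(c^2)\subset\mathbb E^4_1$, or the hyperbolic space $\mathbb H^3(-c^2)\subset\mathbb E^4_1$ (for some $c>0$).
   Context: $\mathbb E^4_1$ is $\mathbb R^4$ with the metric $-dx_1^2+dx_2^2+dx_3^2+dx_4^2$; $\mathcal{LC}=\{x\in\mathbb E^4_1:\langle x,x\rangle=0\}$, $\mathbb S^3_1(c^2)=\{x\in\mathbb E^4_1:\langle x,x\rangle=c^{-2}\}$, $\mathbb H^3(-c^2)=\{x\in\mathbb E^4_1:\langle x,x\rangle=-c^{-2},\ x_1>0\}$. A surface $M$ is space-like if every nonzero tangent vector $v$ satisfies $\langle v,v\rangle>0$. The second fundamental form $h$ is defined by $\widetilde\nabla_XY=\nabla_XY+h(X,Y)$, and the mean curvature vector is $H=\frac12(h(e_1,e_1)+h(e_2,e_2))$ for an orthonormal tangent frame. $M$ is maximal if $H=0$ identically, non-maximal otherwise. $H$ is space-like (resp. time-like) if $\langle H,H\rangle>0$ (resp. $<0$) at every point. CMC means constant mean curvature, i.e. $\langle H,H\rangle$ is constant. The Gauss map is $\nu=e_3\wedge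 e_4:M\to\bigwedge^2\mathbb E^4_1$, where $\{e_1,e_2,e_3,e_4\}$ is an oriented local orthonormal frame with $e_1,e_2$ tangent and $e_3,e_4$ normal to $M$; $\bigwedge^2\mathbb E^4_1$ is identified with a pseudo-Euclidean space via $\langle f_1\wedge f_2,g_1\wedge g_2\rangle=\det(\langle f_i,g_j\rangle)$. The Laplacian $\Delta=\sum_{i=1}^2(\nabla_{e_i}e_i-e_ie_i)$ of $M$ acts componentwise on $\nu$. $M$ has pointwise 1-type Gauss map of the first kind if $\Delta\nu=f\nu$ for some smooth function $f$ on $M$. *)

theory Defs
  imports "HOL-Analysis.Analysis"
begin

section \<open>Smooth maps\<close>

text \<open>
  Meant for open \<open>U\<close>.  In finite dimension, continuity of all directional derivatives
  \<open>f' v\<close> with \<open>v\<close> fixed is continuity of the derivative, so this is the usual class \<open>C^k\<close>.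
\<close>

primrec Ck_on ::
    "nat \<Rightarrow> 'a::real_normed_vector set \<Rightarrow> ('a \<Rightarrow> 'b::real_normed_vector) \<Rightarrow> bool" where
  "Ck_on 0 U f \<longleftrightarrow> continuous_on U f"
| "Ck_on (Suc k) U f \<longleftrightarrow>
     (\<forall>u\<in>U. f differentiable (at u)) \<and>
     (\<forall>v. Ck_on k U (\<lambda>u. frechet_derivative f (at u) v))"

definition smooth_on ::
    "'a::real_normed_vector set \<Rightarrow> ('a \<Rightarrow> 'b::real_normed_vector) \<Rightarrow> bool" where
  "smooth_on U f \<longleftrightarrow> (\<forall>k. Ck_on k U f)"

section \<open>Minkowski space\<close>

definition mink :: "real^4 \<Rightarrow> real^4 \<Rightarrow> real" where
  "mink x y = - (x$1 * y$1) + x$2 * y$2 + x$3 * y$3 + x$4 * y$4"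

text \<open>All isometries: Lorentz transformations, not necessarily proper or orthochronous,
  followed by translations.\<close>

definition mink_isometry :: "(real^4 \<Rightarrow> real^4) \<Rightarrow> bool" where
  "mink_isometry T \<longleftrightarrow>
     (\<exists>L b. linear L \<and> (\<forall>v w. mink (L v) (L w) = mink v w) \<and> T = (\<lambda>x. L x + b))"

definition light_cone :: "(real^4) set" where
  "light_cone = {x. mink x x = 0}"

definition euclidean_hyperplane :: "(real^4) set" where
  "euclidean_hyperplane = {x. x$1 = 0}"

definition lorentzian_hyperplane :: "(real^4) set" where
  "lorentzian_hyperplane = {x. x$4 = 0}"

definition de_sitter :: "real \<Rightarrow> (real^4) set" where
  "de_sitter c = {x. mink x x = 1 / c\<^sup>2}"

definition hyperbolic_space :: "real \<Rightarrow> (real^4) set" where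
  "hyperbolic_space c = {x. mink x x = - (1 / c\<^sup>2) \<and> x$1 > 0}"

text \<open>
  The bivector \<open>v \<and> w\<close> is represented by the skew-symmetric matrix of its components with
  respect to the standard basis; its entries above the diagonal are the coordinates of
  \<open>v \<and> w\<close> in the basis \<open>\<epsilon>\<^sub>i \<and> \<epsilon>\<^sub>j\<close> (\<open>i < j\<close>) of the second exterior power of \<open>\<real>\<^sup>4\<close>.
\<close>

definition wedge :: "real^4 \<Rightarrow> real^4 \<Rightarrow> real^4^4" where
  "wedge v w = (\<chi> i j. v$i * w$j - v$j * w$i)"

section \<open>Geometry of a local parametrization\<close>

text \<open>
  \<open>X\<close> is a space-like immersion of an open subset of the plane into Minkowski space.  Tangent
  vectors and tangent vector fields of the surface are given by their coordinates in \<open>real^2\<close>;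
  the coordinate vector \<open>a\<close> at \<open>u\<close> stands for the vector \<open>push X u a\<close> of Minkowski space.
  All notions below depend only on the germs of \<open>X\<close> and of the fields at \<open>u\<close>.
\<close>

abbreviation push :: "(real^2 \<Rightarrow> 'b::real_normed_vector) \<Rightarrow> real^2 \<Rightarrow> real^2 \<Rightarrow> 'b" where
  "push X u \<equiv> frechet_derivative X (at u)"

definition tangent_plane :: "(real^2 \<Rightarrow> real^4) \<Rightarrow> real^2 \<Rightarrow> (real^4) set" where
  "tangent_plane X u = range (push X u)"

definition tangential_part :: "(real^2 \<Rightarrow> real^4) \<Rightarrow> real^2 \<Rightarrow> real^4 \<Rightarrow> real^4" where
  "tangential_part X u w =
     (THE t. t \<in> tangent_plane X u \<and> (\<forall>s\<in>tangent_plane X u. mink (w - t) s = 0))"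

definition flat_conn ::
    "(real^2 \<Rightarrow> real^4) \<Rightarrow> (real^2 \<Rightarrow> real^2) \<Rightarrow> (real^2 \<Rightarrow> real^2) \<Rightarrow> real^2 \<Rightarrow> real^4" where
  "flat_conn X V W u = frechet_derivative (\<lambda>z. push X z (W z)) (at u) (V u)"

definition conn ::
    "(real^2 \<Rightarrow> real^4) \<Rightarrow> (real^2 \<Rightarrow> real^2) \<Rightarrow> (real^2 \<Rightarrow> real^2) \<Rightarrow> real^2 \<Rightarrow> real^2" where
  "conn X V W u = (THE a. push X u a = tangential_part X u (flat_conn X V W u))"

definition second_ff ::
    "(real^2 \<Rightarrow> real^4) \<Rightarrow> (real^2 \<Rightarrow> real^2) \<Rightarrow> (real^2 \<Rightarrow> real^2) \<Rightarrow> real^2 \<Rightarrow> real^4" where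
  "second_ff X V W u = flat_conn X V W u - push X u (conn X V W u)"

definition tangent_frame_on ::
    "(real^2 \<Rightarrow> real^4) \<Rightarrow> (real^2) set \<Rightarrow> (2 \<Rightarrow> real^2 \<Rightarrow> real^2) \<Rightarrow> bool" where
  "tangent_frame_on X N E \<longleftrightarrow>
     (\<forall>i. smooth_on N (E i)) \<and>
     (\<forall>u\<in>N. \<forall>i j. mink (push X u (E i u)) (push X u (E j u)) = (if i = j then 1 else 0))"

text \<open>The mean curvature vector and the Laplacian do not depend on the local orthonormal
  frame, and such frames exist near every point of a space-like surface.\<close>

definition mean_curvature :: "(real^2 \<Rightarrow> real^4) \<Rightarrow> real^2 \<Rightarrow> real^4" where
  "mean_curvature X u =
     (THE H. \<exists>N E. open N \<and> u \<in> N \<and> tangent_frame_on X N E \<and>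
        H = (1/2) *\<^sub>R (\<Sum>i\<in>UNIV. second_ff X (E i) (E i) u))"

definition laplacian ::
    "(real^2 \<Rightarrow> real^4) \<Rightarrow> (real^2 \<Rightarrow> 'b::real_normed_vector) \<Rightarrow> real^2 \<Rightarrow> 'b" where
  "laplacian X F u =
     (THE l. \<exists>N E. open N \<and> u \<in> N \<and> tangent_frame_on X N E \<and>
        l = (\<Sum>i\<in>UNIV. push F u (conn X (E i) (E i) u)
                     - push (\<lambda>z. push F z (E i z)) u (E i u)))"

text \<open>
  \<open>e 1, e 2\<close> is a positively oriented basis of the tangent plane (oriented by the coordinates)
  and \<open>e 1, \<dots>, e 4\<close> one of \<open>\<real>\<^sup>4\<close>.  Orthogonality to \<open>e 1, e 2\<close> makes \<open>e 3, e 4\<close> normal; exactly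
  one of them is time-like, in either position.  The bivector \<open>e 3 \<and> e 4\<close> is the same for all
  such frames.
\<close>

definition adapted_frame_at ::
    "(real^2 \<Rightarrow> real^4) \<Rightarrow> real^2 \<Rightarrow> (4 \<Rightarrow> real^4) \<Rightarrow> bool" where
  "adapted_frame_at X u e \<longleftrightarrow>
     (\<forall>i j. i \<noteq> j \<longrightarrow> mink (e i) (e j) = 0) \<and> (\<forall>i. \<bar>mink (e i) (e i)\<bar> = 1) \<and>
     (\<exists>a b. e 1 = push X u a \<and> e 2 = push X u b \<and> det (vector [a, b] :: real^2^2) > 0) \<and>
     det (\<chi> i. e i) > 0"

definition gauss_map :: "(real^2 \<Rightarrow> real^4) \<Rightarrow> real^2 \<Rightarrow> real^4^4" where
  "gauss_map X u = (THE w. \<exists>e. adapted_frame_at X u e \<and> w = wedge (e 3) (e 4))"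

section \<open>Oriented surfaces\<close>

text \<open>
  A surface is an abstract two-dimensional manifold \<open>M\<close> immersed by a map \<open>x\<close> (not necessarily
  injective).  An atlas consists of pairs \<open>(U, \<phi>)\<close> of an open \<open>U\<close> in the plane and a
  parametrization \<open>\<phi>\<close> of an open subset of \<open>M\<close>, i.e. an inverse chart.  Values of \<open>\<phi>\<close> outside
  \<open>U\<close> are irrelevant.  Positivity of the Jacobians of the transition maps encodes the orientation.
\<close>

type_synonym 'm atlas = "((real^2) set \<times> (real^2 \<Rightarrow> 'm)) set"

definition oriented_surface :: "'m topology \<Rightarrow> 'm atlas \<Rightarrow> bool" where
  "oriented_surface M A \<longleftrightarrow>
     Hausdorff_space M \<and>
     (\<exists>B. countable B \<and> (\<forall>V\<in>B. openin M V) \<and>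
          (\<forall>W p. openin M W \<and> p \<in> W \<longrightarrow> (\<exists>V\<in>B. p \<in> V \<and> V \<subseteq> W))) \<and>
     (\<forall>(U, \<phi>)\<in>A. open U \<and> openin M (\<phi> ` U) \<and>
          homeomorphic_map (top_of_set U) (subtopology M (\<phi> ` U)) \<phi>) \<and>
     (\<Union>(U, \<phi>)\<in>A. \<phi> ` U) = topspace M \<and>
     (\<forall>(U, \<phi>)\<in>A. \<forall>(V, \<psi>)\<in>A.
          let D = {u \<in> U. \<phi> u \<in> \<psi> ` V}; \<tau> = (\<lambda>u. the_inv_into V \<psi> (\<phi> u))
          in smooth_on D \<tau> \<and> (\<forall>u\<in>D. det (matrix (frechet_derivative \<tau> (at u))) > 0))"

definition smooth_function :: "'m atlas \<Rightarrow> ('m \<Rightarrow> 'b::real_normed_vector) \<Rightarrow> bool" where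
  "smooth_function A f \<longleftrightarrow> (\<forall>(U, \<phi>)\<in>A. smooth_on U (f \<circ> \<phi>))"

definition immersion :: "'m atlas \<Rightarrow> ('m \<Rightarrow> real^4) \<Rightarrow> bool" where
  "immersion A x \<longleftrightarrow>
     smooth_function A x \<and> (\<forall>(U, \<phi>)\<in>A. \<forall>u\<in>U. inj (push (x \<circ> \<phi>) u))"

definition space_like :: "'m atlas \<Rightarrow> ('m \<Rightarrow> real^4) \<Rightarrow> bool" where
  "space_like A x \<longleftrightarrow>
     (\<forall>(U, \<phi>)\<in>A. \<forall>u\<in>U. \<forall>v\<in>tangent_plane (x \<circ> \<phi>) u. v \<noteq> 0 \<longrightarrow> mink v v > 0)"

definition maximal :: "'m atlas \<Rightarrow> ('m \<Rightarrow> real^4) \<Rightarrow> bool" where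
  "maximal A x \<longleftrightarrow> (\<forall>(U, \<phi>)\<in>A. \<forall>u\<in>U. mean_curvature (x \<circ> \<phi>) u = 0)"

definition space_like_mean_curvature :: "'m atlas \<Rightarrow> ('m \<Rightarrow> real^4) \<Rightarrow> bool" where
  "space_like_mean_curvature A x \<longleftrightarrow>
     (\<forall>(U, \<phi>)\<in>A. \<forall>u\<in>U. mink (mean_curvature (x \<circ> \<phi>) u) (mean_curvature (x \<circ> \<phi>) u) > 0)"

definition time_like_mean_curvature :: "'m atlas \<Rightarrow> ('m \<Rightarrow> real^4) \<Rightarrow> bool" where
  "time_like_mean_curvature A x \<longleftrightarrow>
     (\<forall>(U, \<phi>)\<in>A. \<forall>u\<in>U. mink (mean_curvature (x \<circ> \<phi>) u) (mean_curvature (x \<circ> \<phi>) u) < 0)"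

definition CMC :: "'m atlas \<Rightarrow> ('m \<Rightarrow> real^4) \<Rightarrow> bool" where
  "CMC A x \<longleftrightarrow>
     (\<exists>k. \<forall>(U, \<phi>)\<in>A. \<forall>u\<in>U.
        mink (mean_curvature (x \<circ> \<phi>) u) (mean_curvature (x \<circ> \<phi>) u) = k)"

definition pointwise_1_type_first_kind :: "'m atlas \<Rightarrow> ('m \<Rightarrow> real^4) \<Rightarrow> bool" where
  "pointwise_1_type_first_kind A x \<longleftrightarrow>
     (\<exists>f :: 'm \<Rightarrow> real. smooth_function A f \<and>
        (\<forall>(U, \<phi>)\<in>A. \<forall>u\<in>U.
           laplacian (x \<circ> \<phi>) (gauss_map (x \<circ> \<phi>)) u = f (\<phi> u) *\<^sub>R gauss_map (x \<circ> \<phi>) u))"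

end

theory Submission
  imports Defs
begin

text \<open>
  In a frame \<open>e1, e2, l, n\<close> with \<open>l, n\<close> null normals, \<open>\<langle>l, n\<rangle> = 1\<close> and \<open>H = l + P n\<close>, the
  Codazzi equations show that the Laplacian of \<open>\<nu>\<close> is a multiple of \<open>\<nu>\<close> iff \<open>H\<close> is parallel,
  i.e. \<open>l\<close>, \<open>n\<close> are parallel and \<open>P\<close> is constant.  In that case the trace-free shape operators
  of \<open>l\<close> and \<open>n\<close> are commuting Codazzi tensors, so locally some parallel normal field
  \<open>\<xi> = \<alpha> l + \<beta> n\<close> with constant \<open>\<alpha>, \<beta>\<close> is umbilic; then \<open>\<xi> - 2 s x\<close> is a constant vector
  \<open>\<eta>\<close> and \<open>s \<langle>x, x\<rangle> + \<langle>x, \<eta>\<rangle>\<close> is constant, which is the equation of a hyperplane or of a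
  pseudo-sphere.  A trace-free Codazzi tensor solves a Cauchy--Riemann type system, and unique
  continuation for it extends the equation from an open set to the whole connected surface.
  Conversely the gradient of such an equation is an umbilic normal field, and constancy of
  \<open>\<langle>H, H\<rangle>\<close> makes \<open>H\<close> parallel.
\<close>

section \<open>Smooth maps and derivations\<close>

text \<open>Null normals make space-like and time-like \<open>H\<close> a single case: a non-null
  \<open>H\<close> has non-zero product with every null normal, so \<open>n\<close> can be scaled to
  \<open>\<langle>H, n\<rangle> = 1\<close>, and then \<open>\<langle>H, H\<rangle> = 2 P\<close>.
  In the Laplacian of \<nu> the Codazzi equations turn divergences of the shape operators into
  gradients of their traces \<open>2 P\<close> and 2, the \<open>e1 \<and> e2\<close> coefficient is
  the commutator of the shape operators, and the \<nu> coefficient is the squared length of the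
  second fundamental form, which becomes \<open>f\<close>. The obstacle: the ratio of the trace-free
  shape operators makes sense only off the zeros of one of them, and for merely smooth data the
  constants \<alpha>, \<beta> found near one point could change across such zeros. So one equation
  is found on one ball and propagated, by a maximum principle for the logarithm of a modulus. A
  quadratic equation with parameters \<open>s\<close>, \<open>\<eta>\<close>, \<open>r\<close>
  covers all five model spaces at once; the one unwanted case, a hyperplane with null normal, is
  ruled out by \<open>\<langle>H, H\<rangle> \<noteq> 0\<close>.\<close>

lemma Ck_on_cong:
  assumes "open U" "\<And>u. u \<in> U \<Longrightarrow> f u = g u" "Ck_on k U f"
  shows "Ck_on k U g"
  using assms
proof (induction k arbitrary: f g)
  case 0
  then show ?case by (metis Ck_on.simps(1) continuous_on_cong)
next
  case (Suc k)
  have D: "(g has_derivative push' ) (at u)" if "u \<in> U" "push' = frechet_derivative f (at u)" for u push'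
    using that Suc.prems frechet_derivative_works has_derivative_transform_within_open[of f _ u UNIV U g]
    by (metis Ck_on.simps(2))
  then have "g differentiable (at u)" if "u \<in> U" for u
    using that differentiable_def by blast
  moreover have "frechet_derivative g (at u) = frechet_derivative f (at u)" if "u \<in> U" for u
    using D[OF that refl] frechet_derivative_at by metis
  then have "Ck_on k U (\<lambda>u. frechet_derivative g (at u) v)" for v
    using Suc.IH[of "\<lambda>u. frechet_derivative f (at u) v" "\<lambda>u. frechet_derivative g (at u) v"] Suc.prems
    by auto
  ultimately show ?case by simp
qed

lemma smooth_on_cong:
  assumes "open U" "\<And>u. u \<in> U \<Longrightarrow> f u = g u" "smooth_on U f"
  shows "smooth_on U g"
  using assms Ck_on_cong unfolding smooth_on_def by blast

lemma Ck_on_subset: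
  assumes "V \<subseteq> U" "Ck_on k U f"
  shows "Ck_on k V f"
  using assms(2)
proof (induction k arbitrary: f)
  case 0
  then show ?case using assms(1) continuous_on_subset by auto
qed (use assms(1) in auto)

lemma smooth_on_subset: "smooth_on U f \<Longrightarrow> V \<subseteq> U \<Longrightarrow> smooth_on V f"
  using Ck_on_subset unfolding smooth_on_def by blast

lemma Ck_on_Suc_imp: "Ck_on (Suc k) U f \<Longrightarrow> Ck_on k U f"
proof (induction k arbitrary: f)
  case 0
  then have "\<forall>u\<in>U. isCont f u"
    by (simp add: differentiable_imp_continuous_within)
  then show ?case by (simp add: continuous_at_imp_continuous_on)
next
  case (Suc k)
  then show ?case by (metis Ck_on.simps(2))
qed

lemma smooth_on_imp_differentiable:
  "smooth_on U f \<Longrightarrow> u \<in> U \<Longrightarrow> f differentiable (at u)"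
  unfolding smooth_on_def by (metis Ck_on.simps(2))

lemma smooth_on_imp_has_derivative:
  "smooth_on U f \<Longrightarrow> u \<in> U \<Longrightarrow> (f has_derivative frechet_derivative f (at u)) (at u)"
  using smooth_on_imp_differentiable frechet_derivative_works by blast

lemma smooth_on_imp_continuous_on: "smooth_on U f \<Longrightarrow> continuous_on U f"
  unfolding smooth_on_def by (metis Ck_on.simps(1))

lemma smooth_on_imp_isCont: "smooth_on U f \<Longrightarrow> u \<in> U \<Longrightarrow> isCont f u"
  by (simp add: smooth_on_imp_differentiable differentiable_imp_continuous_within)

lemma smooth_on_frechet_derivative:
  "smooth_on U f \<Longrightarrow> smooth_on U (\<lambda>u. frechet_derivative f (at u) v)"
  unfolding smooth_on_def by (metis Ck_on.simps(2))

lemma Ck_on_const: "Ck_on k U (\<lambda>u. c)"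
  by (induction k arbitrary: c) auto

lemma smooth_on_const [simp]: "smooth_on U (\<lambda>u. c)"
  by (simp add: smooth_on_def Ck_on_const)

lemma smooth_on_ident: "smooth_on U (\<lambda>u. u)"
proof -
  have "Ck_on k U (\<lambda>u. u)" for k
    by (cases k) (auto simp: Ck_on_const)
  then show ?thesis by (simp add: smooth_on_def)
qed

lemma frechet_derivativeI: "(f has_derivative f') (at u) \<Longrightarrow> frechet_derivative f (at u) = f'"
  using frechet_derivative_at by metis

lemma Ck_on_add:
  assumes "open U" "Ck_on k U f" "Ck_on k U g"
  shows "Ck_on k U (\<lambda>u. f u + g u)"
  using assms(2,3)
proof (induction k arbitrary: f g)
  case 0
  then show ?case by (simp add: continuous_on_add)
next
  case (Suc k)
  have eq: "frechet_derivative (\<lambda>u. f u + g u) (at u) v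
      = frechet_derivative f (at u) v + frechet_derivative g (at u) v" if "u \<in> U" for u v
    using that Suc.prems frechet_derivative_works
    by (subst frechet_derivativeI[OF has_derivative_add]) auto
  have "Ck_on k U (\<lambda>u. frechet_derivative (\<lambda>u. f u + g u) (at u) v)" for v
    using Ck_on_cong[OF assms(1) eq[symmetric] Suc.IH] Suc.prems by auto
  with Suc.prems show ?case by auto
qed

lemma smooth_on_add:
  "open U \<Longrightarrow> smooth_on U f \<Longrightarrow> smooth_on U g \<Longrightarrow> smooth_on U (\<lambda>u. f u + g u)"
  using Ck_on_add unfolding smooth_on_def by blast

lemma (in bounded_linear) Ck_on:
  assumes "open U" "Ck_on k U g"
  shows "Ck_on k U (\<lambda>u. f (g u))"
  using assms(2)
proof (induction k arbitrary: g)
  case 0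
  then show ?case by (simp add: continuous_on)
next
  case (Suc k)
  have D: "((\<lambda>u. f (g u)) has_derivative (\<lambda>v. f (frechet_derivative g (at u) v))) (at u)" if "u \<in> U" for u
    using that Suc.prems frechet_derivative_works has_derivative by (metis Ck_on.simps(2))
  have eq: "frechet_derivative (\<lambda>u. f (g u)) (at u) v = f (frechet_derivative g (at u) v)"
    if "u \<in> U" for u v
    using frechet_derivativeI[OF D[OF that]] by simp
  have "Ck_on k U (\<lambda>u. frechet_derivative (\<lambda>u. f (g u)) (at u) v)" for v
    by (rule Ck_on_cong[OF assms(1) eq[symmetric] Suc.IH]) (use Suc.prems in auto)
  with D show ?case by (auto simp: differentiable_def)
qed

lemma (in bounded_linear) smooth_on:
  "open U \<Longrightarrow> smooth_on U g \<Longrightarrow> smooth_on U (\<lambda>u. f (g u))"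
  using Ck_on unfolding smooth_on_def by blast

lemma (in bounded_bilinear) Ck_on:
  assumes "open U" "Ck_on k U f" "Ck_on k U g"
  shows "Ck_on k U (\<lambda>u. prod (f u) (g u))"
  using assms(2,3)
proof (induction k arbitrary: f g)
  case 0
  then show ?case by (simp add: continuous_on)
next
  case (Suc k)
  have D: "((\<lambda>u. prod (f u) (g u)) has_derivative
      (\<lambda>v. prod (f u) (frechet_derivative g (at u) v) + prod (frechet_derivative f (at u) v) (g u))) (at u)"
    if "u \<in> U" for u
    using that Suc.prems by (intro FDERIV) (auto simp flip: frechet_derivative_works)
  have eq: "frechet_derivative (\<lambda>u. prod (f u) (g u)) (at u) v
      = prod (f u) (frechet_derivative g (at u) v) + prod (frechet_derivative f (at u) v) (g u)"
    if "u \<in> U" for u v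
    using frechet_derivativeI[OF D[OF that]] by simp
  have "Ck_on k U f" "Ck_on k U g"
    using Suc.prems Ck_on_Suc_imp by blast+
  then have "Ck_on k U (\<lambda>u. frechet_derivative (\<lambda>u. prod (f u) (g u)) (at u) v)" for v
    by (intro Ck_on_cong[OF assms(1) eq[symmetric] Ck_on_add[OF assms(1) Suc.IH Suc.IH]])
      (use Suc.prems in auto)
  with D show ?case by (auto simp: differentiable_def)
qed

lemma (in bounded_bilinear) smooth_on:
  "open U \<Longrightarrow> smooth_on U f \<Longrightarrow> smooth_on U g \<Longrightarrow> smooth_on U (\<lambda>u. prod (f u) (g u))"
  using Ck_on unfolding smooth_on_def by blast

lemmas smooth_on_scaleR = bounded_bilinear.smooth_on[OF bounded_bilinear_scaleR]
lemmas smooth_on_mult = bounded_bilinear.smooth_on[OF bounded_bilinear_mult]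
  for f g :: "_ \<Rightarrow> real"
lemmas smooth_on_vec_nth = bounded_linear.smooth_on[OF bounded_linear_vec_nth]

lemma smooth_on_minus: "open U \<Longrightarrow> smooth_on U f \<Longrightarrow> smooth_on U (\<lambda>u. - f u)"
  by (rule bounded_linear.smooth_on[OF bounded_linear_minus[OF bounded_linear_ident]])

lemma smooth_on_diff:
  "open U \<Longrightarrow> smooth_on U f \<Longrightarrow> smooth_on U g \<Longrightarrow> smooth_on U (\<lambda>u. f u - g u)"
  using smooth_on_add[of U f "\<lambda>u. - g u"] smooth_on_minus[of U g] by simp

lemma smooth_on_sum:
  assumes "open U" "\<And>i. i \<in> I \<Longrightarrow> smooth_on U (f i)"
  shows "smooth_on U (\<lambda>u. \<Sum>i\<in>I. f i u)"
  using assms(2)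
  by (induction I rule: infinite_finite_induct) (auto simp: smooth_on_add assms(1))

text \<open>Bootstrapping: the last hypothesis feeds the regularity already reached for
  \<open>\<phi> \<circ> g\<close> back into \<open>\<phi>' \<circ> g\<close>, which suits functions
  whose derivative is an expression in themselves, such as the inverse and exp.\<close>

lemma Ck_on_compose_real:
  fixes g :: "'a::real_normed_vector \<Rightarrow> real"
  assumes "open U" "smooth_on U g" "\<And>u. u \<in> U \<Longrightarrow> (\<phi> has_real_derivative \<phi>' (g u)) (at (g u))"
    "\<And>k. Ck_on k U (\<lambda>u. \<phi> (g u)) \<Longrightarrow> Ck_on k U (\<lambda>u. \<phi>' (g u))"
  shows "smooth_on U (\<lambda>u. \<phi> (g u))"
proof -
  have D: "((\<lambda>u. \<phi> (g u)) has_derivative (\<lambda>v. \<phi>' (g u) * frechet_derivative g (at u) v)) (at u)"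
    if "u \<in> U" for u
    using DERIV_compose_FDERIV[OF assms(3)[OF that] smooth_on_imp_has_derivative[OF assms(2) that]]
    by (simp add: mult.commute)
  have eq: "frechet_derivative (\<lambda>u. \<phi> (g u)) (at u) v = \<phi>' (g u) * frechet_derivative g (at u) v"
    if "u \<in> U" for u v
    using frechet_derivativeI[OF D[OF that]] by simp
  have "Ck_on k U (\<lambda>u. \<phi> (g u))" for k
  proof (induction k)
    case 0
    have "isCont (\<lambda>u. \<phi> (g u)) u" if "u \<in> U" for u
      using D[OF that] has_derivative_continuous by blast
    then show ?case by (simp add: continuous_at_imp_continuous_on)
  next
    case (Suc k)
    have "Ck_on k U (\<lambda>u. frechet_derivative g (at u) v)" for v
      using smooth_on_frechet_derivative[OF assms(2)] by (simp add: smooth_on_def)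
    then have "Ck_on k U (\<lambda>u. frechet_derivative (\<lambda>u. \<phi> (g u)) (at u) v)" for v
      by (intro Ck_on_cong[OF assms(1) eq[symmetric] bounded_bilinear.Ck_on[OF bounded_bilinear_mult]]
          assms(1) assms(4)[OF Suc.IH]) auto
    with D show ?case by (auto simp: differentiable_def)
  qed
  then show ?thesis by (simp add: smooth_on_def)
qed

lemma smooth_on_inverse:
  fixes g :: "'a::real_normed_vector \<Rightarrow> real"
  assumes "open U" "smooth_on U g" "\<And>u. u \<in> U \<Longrightarrow> g u \<noteq> 0"
  shows "smooth_on U (\<lambda>u. inverse (g u))"
proof (rule Ck_on_compose_real[OF assms(1,2)])
  fix u assume "u \<in> U"
  then show "(inverse has_real_derivative - (inverse (g u) * inverse (g u))) (at (g u))"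
    using DERIV_inverse[of "g u"] assms(3) by (simp add: power2_eq_square)
next
  fix k assume "Ck_on k U (\<lambda>u. inverse (g u))"
  then show "Ck_on k U (\<lambda>u. - (inverse (g u) * inverse (g u)))"
    using bounded_linear.Ck_on[OF bounded_linear_minus[OF bounded_linear_ident]]
      bounded_bilinear.Ck_on[OF bounded_bilinear_mult] assms(1) by blast
qed

lemma smooth_on_divide:
  fixes f g :: "'a::real_normed_vector \<Rightarrow> real"
  assumes "open U" "smooth_on U f" "smooth_on U g" "\<And>u. u \<in> U \<Longrightarrow> g u \<noteq> 0"
  shows "smooth_on U (\<lambda>u. f u / g u)"
  unfolding divide_inverse by (intro smooth_on_mult smooth_on_inverse assms)

lemma smooth_on_ln:
  fixes g :: "'a::real_normed_vector \<Rightarrow> real"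
  assumes "open U" "smooth_on U g" "\<And>u. u \<in> U \<Longrightarrow> g u > 0"
  shows "smooth_on U (\<lambda>u. ln (g u))"
proof (rule Ck_on_compose_real[OF assms(1,2)])
  show "(ln has_real_derivative inverse (g u)) (at (g u))" if "u \<in> U" for u
    using assms(3)[OF that] DERIV_ln by blast
  show "Ck_on k U (\<lambda>u. inverse (g u))" for k
    using smooth_on_inverse[of U g] assms unfolding smooth_on_def by (metis less_irrefl)
qed

lemma smooth_on_exp:
  fixes g :: "'a::real_normed_vector \<Rightarrow> real"
  assumes "open U" "smooth_on U g"
  shows "smooth_on U (\<lambda>u. exp (g u))"
  by (rule Ck_on_compose_real[OF assms DERIV_exp])

lemma smooth_on_sqrt:
  fixes g :: "'a::real_normed_vector \<Rightarrow> real"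
  assumes "open U" "smooth_on U g" "\<And>u. u \<in> U \<Longrightarrow> g u > 0"
  shows "smooth_on U (\<lambda>u. sqrt (g u))"
proof -
  have "smooth_on U (\<lambda>u. exp (1 / 2 * ln (g u)))"
    using assms by (intro smooth_on_exp smooth_on_mult smooth_on_ln smooth_on_const)
  moreover have "exp (1 / 2 * ln (g u)) = sqrt (g u)" if "u \<in> U" for u
    using assms(3)[OF that] powr_half_sqrt[of "g u"] by (simp add: powr_def)
  ultimately show ?thesis
    by (rule smooth_on_cong[OF assms(1), rotated])
qed

section \<open>Derivatives along vector fields\<close>

definition lie :: "('a::real_normed_vector \<Rightarrow> 'a) \<Rightarrow> ('a \<Rightarrow> 'b::real_normed_vector) \<Rightarrow> 'a \<Rightarrow> 'b" where
  "lie V f u = frechet_derivative f (at u) (V u)"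

lemma has_derivative_imp_lie: "(f has_derivative f') (at u) \<Longrightarrow> lie V f u = f' (V u)"
  by (simp add: lie_def frechet_derivativeI)

lemma frechet_derivative_cong_open:
  assumes "open U" "u \<in> U" "\<And>z. z \<in> U \<Longrightarrow> f z = g z"
  shows "frechet_derivative f (at u) = frechet_derivative g (at u)"
proof -
  have "(f has_derivative D) (at u) \<longleftrightarrow> (g has_derivative D) (at u)" for D
    using has_derivative_transform_within_open[of _ D u UNIV U] assms by metis
  then show ?thesis by (simp add: frechet_derivative_def)
qed

lemma lie_cong:
  "open U \<Longrightarrow> u \<in> U \<Longrightarrow> (\<And>z. z \<in> U \<Longrightarrow> f z = g z) \<Longrightarrow> lie V f u = lie V g u"
  using frechet_derivative_cong_open[of U u f g] by (simp add: lie_def)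

lemma lie_const [simp]: "lie V (\<lambda>u. c) u = 0"
  by (simp add: lie_def)

context
  fixes U :: "'a::real_normed_vector set" and u
  assumes u: "u \<in> U"
begin

lemma lie_add:
  "smooth_on U f \<Longrightarrow> smooth_on U g \<Longrightarrow> lie V (\<lambda>z. f z + g z) u = lie V f u + lie V g u"
  using smooth_on_imp_has_derivative[OF _ u]
  by (subst has_derivative_imp_lie[OF has_derivative_add]) (auto simp: lie_def)

lemma lie_diff:
  "smooth_on U f \<Longrightarrow> smooth_on U g \<Longrightarrow> lie V (\<lambda>z. f z - g z) u = lie V f u - lie V g u"
  using smooth_on_imp_has_derivative[OF _ u]
  by (subst has_derivative_imp_lie[OF has_derivative_diff]) (auto simp: lie_def)

lemma lie_linear:
  "bounded_linear h \<Longrightarrow> smooth_on U f \<Longrightarrow> lie V (\<lambda>z. h (f z)) u = h (lie V f u)"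
  using smooth_on_imp_has_derivative[OF _ u]
  by (subst has_derivative_imp_lie[OF bounded_linear.has_derivative]) (auto simp: lie_def)

lemma lie_minus: "smooth_on U f \<Longrightarrow> lie V (\<lambda>z. - f z) u = - lie V f u"
  by (rule lie_linear[OF bounded_linear_minus[OF bounded_linear_ident]])

lemma lie_bilinear:
  "bounded_bilinear b \<Longrightarrow> smooth_on U f \<Longrightarrow> smooth_on U g \<Longrightarrow>
    lie V (\<lambda>z. b (f z) (g z)) u = b (lie V f u) (g u) + b (f u) (lie V g u)"
  using has_derivative_imp_lie[OF bounded_bilinear.FDERIV[OF _ smooth_on_imp_has_derivative[OF _ u]
        smooth_on_imp_has_derivative[OF _ u]], of b f g V]
  by (simp add: lie_def)

lemmas lie_scaleR = lie_bilinear[OF bounded_bilinear_scaleR]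
lemmas lie_mult = lie_bilinear[OF bounded_bilinear_mult] for f g :: "_ \<Rightarrow> real"

end

text \<open>Smoothness is defined through derivatives in fixed directions; expanding
  \<open>V u\<close> in the standard basis moves the varying direction into smooth scalar
  coefficients.\<close>

lemma smooth_on_frechet_derivative_field:
  fixes f :: "'a::euclidean_space \<Rightarrow> 'b::real_normed_vector"
  assumes "open U" "smooth_on U f" "smooth_on U V"
  shows "smooth_on U (\<lambda>u. frechet_derivative f (at u) (V u))"
proof -
  have eq: "frechet_derivative f (at u) (V u)
      = (\<Sum>b\<in>Basis. (V u \<bullet> b) *\<^sub>R frechet_derivative f (at u) b)" if "u \<in> U" for u
  proof -
    interpret linear "frechet_derivative f (at u)"
      by (rule linear_frechet_derivative[OF smooth_on_imp_differentiable[OF assms(2) that]])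
    show ?thesis
      by (subst euclidean_representation[symmetric]) (simp only: sum scale)
  qed
  have "smooth_on U (\<lambda>u. \<Sum>b\<in>Basis. (V u \<bullet> b) *\<^sub>R frechet_derivative f (at u) b)"
    by (intro smooth_on_sum smooth_on_scaleR assms smooth_on_frechet_derivative
        bounded_linear.smooth_on[OF bounded_linear_inner_left])
  then show ?thesis
    by (rule smooth_on_cong[OF assms(1), rotated]) (simp add: eq)
qed

lemma smooth_on_lie:
  fixes f :: "'a::euclidean_space \<Rightarrow> 'b::real_normed_vector"
  shows "open U \<Longrightarrow> smooth_on U V \<Longrightarrow> smooth_on U f \<Longrightarrow> smooth_on U (lie V f)"
  using smooth_on_frechet_derivative_field[of U f V] by (simp add: lie_def[abs_def])

section \<open>Second derivatives and the commutator of vector fields\<close>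

definition hess :: "('a::real_normed_vector \<Rightarrow> 'b::real_normed_vector) \<Rightarrow> 'a \<Rightarrow> 'a \<Rightarrow> 'a \<Rightarrow> 'b" where
  "hess f u a b = frechet_derivative (\<lambda>z. frechet_derivative f (at z) a) (at u) b"

lemma has_derivative_along_line:
  fixes g :: "'a::real_normed_vector \<Rightarrow> real"
  assumes "smooth_on U g" "w + s *\<^sub>R v \<in> U"
  shows "((\<lambda>s. g (w + s *\<^sub>R v)) has_real_derivative frechet_derivative g (at (w + s *\<^sub>R v)) v) (at s)"
proof -
  have "((\<lambda>s. g (w + s *\<^sub>R v)) has_derivative (\<lambda>h. frechet_derivative g (at (w + s *\<^sub>R v)) (h *\<^sub>R v))) (at s)"
    by (rule has_derivative_compose[where f="\<lambda>s. w + s *\<^sub>R v", OF _ smooth_on_imp_has_derivative[OF assms]])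
      (auto intro!: derivative_eq_intros)
  moreover have "(\<lambda>h. frechet_derivative g (at (w + s *\<^sub>R v)) (h *\<^sub>R v))
      = (*) (frechet_derivative g (at (w + s *\<^sub>R v)) v)"
    using linear_scale[OF linear_frechet_derivative[OF smooth_on_imp_differentiable[OF assms]]]
    by (simp add: fun_eq_iff mult.commute)
  ultimately show ?thesis by (simp only: has_field_derivative_def)
qed

text \<open>The mixed second difference quotient is a value of either mixed derivative nearby.\<close>

lemma hess_symmetric_real:
  fixes f :: "'a::real_normed_vector \<Rightarrow> real"
  assumes "open U" "smooth_on U f" "u \<in> U"
  shows "hess f u a b = hess f u b a"
proof -
  obtain r where r: "r > 0" "ball u r \<subseteq> U"
    using assms(1,3) openE by blast
  \<comment> \<open>\<open>h * K\<close> dominates the displacement \<open>s a + t b\<close> for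
    \<bar>s\<bar>, \<bar>t\<bar> \<le> h; the summand 1 keeps \<open>K\<close> positive when
    \<open>a\<close> and \<open>b\<close> vanish.\<close>
  define K where "K = norm a + norm b + 1"
  have K: "K > 0" unfolding K_def by (smt (verit) norm_ge_zero)
  have inU: "u + s *\<^sub>R a + t *\<^sub>R b \<in> ball u e"
    if "\<bar>s\<bar> \<le> h" "\<bar>t\<bar> \<le> h" "h * K < e" for s t h e
  proof -
    have "norm (s *\<^sub>R a + t *\<^sub>R b) \<le> \<bar>s\<bar> * norm a + \<bar>t\<bar> * norm b"
      by (metis norm_scaleR norm_triangle_ineq)
    also have "\<dots> \<le> h * norm a + h * norm b"
      using that by (intro add_mono mult_right_mono) auto
    also have "\<dots> \<le> h * K" using that by (auto simp: K_def algebra_simps)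
    finally have "norm (s *\<^sub>R a + t *\<^sub>R b) < e" using that(3) by linarith
    moreover have "dist u (u + w) = norm w" for w by (simp add: dist_norm)
    ultimately show ?thesis by (simp only: mem_ball add.assoc)
  qed
  have key: "\<exists>s t. \<bar>s\<bar> \<le> h \<and> \<bar>t\<bar> \<le> h \<and>
      f (u + h *\<^sub>R a + h *\<^sub>R b) - f (u + h *\<^sub>R a) - f (u + h *\<^sub>R b) + f u
      = h * h * hess f (u + s *\<^sub>R a + t *\<^sub>R b) a b"
    if h: "0 < h" "\<And>s t. \<bar>s\<bar> \<le> h \<Longrightarrow> \<bar>t\<bar> \<le> h \<Longrightarrow> u + s *\<^sub>R a + t *\<^sub>R b \<in> U" for h a b
  proof -
    \<comment> \<open>The mean value theorem is used twice: \<open>G\<close>, a difference in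
      direction \<open>b\<close>, is followed in direction \<open>a\<close>; its derivative is a
      difference of first derivatives, which is then followed in direction \<open>b\<close>.\<close>
    define G where "G s = f (u + h *\<^sub>R b + s *\<^sub>R a) - f (u + s *\<^sub>R a)" for s
    define G' where "G' s = frechet_derivative f (at (u + h *\<^sub>R b + s *\<^sub>R a)) a
        - frechet_derivative f (at (u + s *\<^sub>R a)) a" for s
    have "(G has_real_derivative G' s) (at s)" if "0 \<le> s" "s \<le> h" for s
      unfolding G_def G'_def
      using h(2)[of s h] h(2)[of s 0] that h(1)
      by (intro DERIV_diff has_derivative_along_line[of U] assms(2)) (auto simp: ac_simps)
    then obtain s where s: "0 < s" "s < h" "G h - G 0 = h * G' s"
      using MVT2[of 0 h G G'] h(1) by auto
    define J where "J t = frechet_derivative f (at (u + s *\<^sub>R a + t *\<^sub>R b)) a" for t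
    have "(J has_real_derivative hess f (u + s *\<^sub>R a + t *\<^sub>R b) a b) (at t)" if "0 \<le> t" "t \<le> h" for t
      unfolding J_def hess_def
      using h(2)[of s t] that s
      by (intro has_derivative_along_line[of U] smooth_on_frechet_derivative assms(2)) auto
    then obtain t where t: "0 < t" "t < h" "J h - J 0 = h * hess f (u + s *\<^sub>R a + t *\<^sub>R b) a b"
      using MVT2[of 0 h J "\<lambda>t. hess f (u + s *\<^sub>R a + t *\<^sub>R b) a b"] h(1) by auto
    have "G' s = J h - J 0" unfolding G'_def J_def by (simp add: ac_simps)
    then show ?thesis using s t unfolding G_def
      by (intro exI[of _ s] exI[of _ t]) (auto simp: ac_simps)
  qed
  have cont: "isCont (\<lambda>z. hess f z a b) u" for a b
    unfolding hess_def
    by (intro smooth_on_imp_isCont[of U] smooth_on_frechet_derivative assms)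
  show ?thesis
  proof (rule ccontr)
    assume ne: "hess f u a b \<noteq> hess f u b a"
    define e where "e = \<bar>hess f u a b - hess f u b a\<bar> / 2"
    have e: "e > 0" using ne by (simp add: e_def)
    obtain d1 where d1: "d1 > 0" "\<And>z. dist z u < d1 \<Longrightarrow> \<bar>hess f z a b - hess f u a b\<bar> < e"
      using cont[of a b] e unfolding continuous_at_eps_delta dist_real_def by metis
    obtain d2 where d2: "d2 > 0" "\<And>z. dist z u < d2 \<Longrightarrow> \<bar>hess f z b a - hess f u b a\<bar> < e"
      using cont[of b a] e unfolding continuous_at_eps_delta dist_real_def by metis
    define m where "m = min r (min d1 d2)"
    have m: "m > 0" using r d1 d2 by (simp add: m_def)
    define h where "h = m / (2 * K)"
    have h: "h > 0" "h * K < m" using m K by (auto simp: h_def field_simps)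
    have sub: "ball u m \<subseteq> U" using r by (auto simp: m_def)
    have P: "u + s *\<^sub>R a + t *\<^sub>R b \<in> ball u m" if "\<bar>s\<bar> \<le> h" "\<bar>t\<bar> \<le> h" for s t
      using inU[OF that h(2)] .
    have P': "u + s *\<^sub>R b + t *\<^sub>R a \<in> ball u m" if "\<bar>s\<bar> \<le> h" "\<bar>t\<bar> \<le> h" for s t
      using P[OF that(2,1)] by (simp add: ac_simps)
    obtain s t where st: "\<bar>s\<bar> \<le> h" "\<bar>t\<bar> \<le> h"
      "f (u + h *\<^sub>R a + h *\<^sub>R b) - f (u + h *\<^sub>R a) - f (u + h *\<^sub>R b) + f u
      = h * h * hess f (u + s *\<^sub>R a + t *\<^sub>R b) a b"
      using key[of h a b] h(1) P sub by blast
    obtain s' t' where st': "\<bar>s'\<bar> \<le> h" "\<bar>t'\<bar> \<le> h"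
      "f (u + h *\<^sub>R b + h *\<^sub>R a) - f (u + h *\<^sub>R b) - f (u + h *\<^sub>R a) + f u
      = h * h * hess f (u + s' *\<^sub>R b + t' *\<^sub>R a) b a"
      using key[of h b a] h(1) P' sub by blast
    have "h * h * hess f (u + s *\<^sub>R a + t *\<^sub>R b) a b = h * h * hess f (u + s' *\<^sub>R b + t' *\<^sub>R a) b a"
    proof -
      have "u + h *\<^sub>R b + h *\<^sub>R a = u + h *\<^sub>R a + h *\<^sub>R b" by (simp add: add_ac)
      with st'(3) have "f (u + h *\<^sub>R a + h *\<^sub>R b) - f (u + h *\<^sub>R b) - f (u + h *\<^sub>R a) + f u
        = h * h * hess f (u + s' *\<^sub>R b + t' *\<^sub>R a) b a" by simp
      with st(3) show ?thesis by linarith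
    qed
    then have "hess f (u + s *\<^sub>R a + t *\<^sub>R b) a b = hess f (u + s' *\<^sub>R b + t' *\<^sub>R a) b a"
      using h(1) by simp
    moreover have "\<bar>hess f (u + s *\<^sub>R a + t *\<^sub>R b) a b - hess f u a b\<bar> < e"
      using d1(2) P[OF st(1,2)] by (auto simp: m_def dist_commute)
    moreover have "\<bar>hess f (u + s' *\<^sub>R b + t' *\<^sub>R a) b a - hess f u b a\<bar> < e"
      using d2(2) P'[OF st'(1,2)] by (auto simp: m_def dist_commute)
    moreover have "\<bar>hess f u a b - hess f u b a\<bar> = 2 * e" by (simp add: e_def)
    ultimately show False by linarith
  qed
qed

lemma frechet_derivative_inner_right:
  "f differentiable (at u) \<Longrightarrow>
    frechet_derivative (\<lambda>z. w \<bullet> f z) (at u) v = w \<bullet> frechet_derivative f (at u) v"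
  by (subst frechet_derivativeI[OF has_derivative_inner_right]) (auto simp: frechet_derivative_works)

lemma hess_symmetric:
  fixes f :: "'a::real_normed_vector \<Rightarrow> 'b::real_inner"
  assumes "open U" "smooth_on U f" "u \<in> U"
  shows "hess f u a b = hess f u b a"
proof -
  have eq: "hess (\<lambda>z. w \<bullet> f z) u a b = w \<bullet> hess f u a b" for w a b
  proof -
    have "frechet_derivative (\<lambda>z. frechet_derivative (\<lambda>z. w \<bullet> f z) (at z) a) (at u)
      = frechet_derivative (\<lambda>z. w \<bullet> frechet_derivative f (at z) a) (at u)"
      using assms
      by (intro frechet_derivative_cong_open[of U] frechet_derivative_inner_right smooth_on_imp_differentiable)
    then show ?thesis unfolding hess_def
      using frechet_derivative_inner_right[OF smooth_on_imp_differentiable[OF smooth_on_frechet_derivative[OF assms(2)] assms(3)]]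
      by metis
  qed
  have "w \<bullet> hess f u a b = w \<bullet> hess f u b a" for w
    unfolding eq[symmetric]
    by (intro hess_symmetric_real[of U] assms bounded_linear.smooth_on[OF bounded_linear_inner_right])
  then show ?thesis using vector_eq_ldot by blast
qed

lemma linear_hess_right:
  "smooth_on U f \<Longrightarrow> u \<in> U \<Longrightarrow> linear (hess f u a)"
  unfolding hess_def[abs_def]
  by (intro linear_frechet_derivative smooth_on_imp_differentiable[of U] smooth_on_frechet_derivative)

lemma linear_hess_left:
  assumes "open U" "smooth_on U f" "u \<in> U"
  shows "linear (\<lambda>a. hess f u a b)"
proof (rule linearI)
  note lin = linear_frechet_derivative[OF smooth_on_imp_differentiable[OF assms(2)]]
  note sm = smooth_on_frechet_derivative[OF assms(2)]
  note d = smooth_on_imp_has_derivative[OF sm assms(3)]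
  fix a a' and r :: real
  have "frechet_derivative (\<lambda>z. frechet_derivative f (at z) (a + a')) (at u)
    = frechet_derivative (\<lambda>z. frechet_derivative f (at z) a + frechet_derivative f (at z) a') (at u)"
    using lin by (intro frechet_derivative_cong_open[OF assms(1,3)]) (auto simp: linear_add)
  also have "\<dots> = (\<lambda>b. hess f u a b + hess f u a' b)"
    unfolding hess_def by (rule frechet_derivativeI, rule has_derivative_add[OF d d])
  finally show "hess f u (a + a') b = hess f u a b + hess f u a' b"
    unfolding hess_def by metis
  have "frechet_derivative (\<lambda>z. frechet_derivative f (at z) (r *\<^sub>R a)) (at u)
    = frechet_derivative (\<lambda>z. r *\<^sub>R frechet_derivative f (at z) a) (at u)"
    using lin by (intro frechet_derivative_cong_open[OF assms(1,3)]) (auto simp: linear_scale)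
  also have "\<dots> = (\<lambda>b. r *\<^sub>R hess f u a b)"
    unfolding hess_def by (rule frechet_derivativeI, rule has_derivative_scaleR_right[OF d])
  finally show "hess f u (r *\<^sub>R a) b = r *\<^sub>R hess f u a b"
    unfolding hess_def by metis
qed

text \<open>One chain rule for two uses: with \<sigma> the identity it differentiates a tangent
  field along the surface, with \<sigma> a transition map it compares second derivatives in two
  charts.\<close>

lemma frechet_derivative_field_along:
  fixes f :: "'a::euclidean_space \<Rightarrow> 'b::real_normed_vector"
    and \<sigma> :: "'c::real_normed_vector \<Rightarrow> 'a"
  assumes U: "open U" and f: "smooth_on U f" and D: "open D" "u \<in> D" "\<sigma> ` D \<subseteq> U"
    and \<sigma>: "\<sigma> differentiable (at u)" and W: "W differentiable (at u)"
  shows "frechet_derivative (\<lambda>z. frechet_derivative f (at (\<sigma> z)) (W z)) (at u) v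
    = hess f (\<sigma> u) (W u) (frechet_derivative \<sigma> (at u) v)
      + frechet_derivative f (at (\<sigma> u)) (frechet_derivative W (at u) v)"
proof -
  note lin = linear_frechet_derivative[OF smooth_on_imp_differentiable[OF f]]
  have \<sigma>u: "\<sigma> u \<in> U" using D by auto
  have exp: "frechet_derivative f (at (\<sigma> z)) w
    = (\<Sum>b\<in>Basis. (w \<bullet> b) *\<^sub>R frechet_derivative f (at (\<sigma> z)) b)" if "z \<in> D" for z w
  proof -
    interpret linear "frechet_derivative f (at (\<sigma> z))" by (rule lin) (use D that in auto)
    show ?thesis by (subst euclidean_representation[symmetric]) (simp only: sum scale)
  qed
  have \<sigma>': "((\<lambda>z. frechet_derivative f (at (\<sigma> z)) b) has_derivative
      (\<lambda>v. hess f (\<sigma> u) b (frechet_derivative \<sigma> (at u) v))) (at u)" for b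
    unfolding hess_def
    by (rule has_derivative_compose[where f=\<sigma> and g="\<lambda>z. frechet_derivative f (at z) b", OF _
          smooth_on_imp_has_derivative[OF smooth_on_frechet_derivative[OF f] \<sigma>u]])
      (use \<sigma> frechet_derivative_works in blast)
  interpret h: linear "\<lambda>a. hess f (\<sigma> u) a w" for w by (rule linear_hess_left[OF U f \<sigma>u])
  have "frechet_derivative (\<lambda>z. frechet_derivative f (at (\<sigma> z)) (W z)) (at u)
    = frechet_derivative (\<lambda>z. \<Sum>b\<in>Basis. (W z \<bullet> b) *\<^sub>R frechet_derivative f (at (\<sigma> z)) b) (at u)"
    by (intro frechet_derivative_cong_open[OF D(1,2)] exp)
  also have "\<dots> = (\<lambda>v. \<Sum>b\<in>Basis. (W u \<bullet> b) *\<^sub>R hess f (\<sigma> u) b (frechet_derivative \<sigma> (at u) v)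
      + (frechet_derivative W (at u) v \<bullet> b) *\<^sub>R frechet_derivative f (at (\<sigma> u)) b)"
    by (intro frechet_derivativeI has_derivative_sum has_derivative_scaleR has_derivative_inner_left \<sigma>')
      (use W frechet_derivative_works in blast)
  finally have "frechet_derivative (\<lambda>z. frechet_derivative f (at (\<sigma> z)) (W z)) (at u) v
    = (\<Sum>b\<in>Basis. (W u \<bullet> b) *\<^sub>R hess f (\<sigma> u) b (frechet_derivative \<sigma> (at u) v))
      + (\<Sum>b\<in>Basis. (frechet_derivative W (at u) v \<bullet> b) *\<^sub>R frechet_derivative f (at (\<sigma> u)) b)"
    by (simp only: sum.distrib)
  moreover have "hess f (\<sigma> u) (W u) w = (\<Sum>b\<in>Basis. (W u \<bullet> b) *\<^sub>R hess f (\<sigma> u) b w)" for w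
    by (subst euclidean_representation[of "W u", symmetric]) (simp only: h.sum h.scale)
  ultimately show ?thesis
    by (simp only: exp[OF D(2), of "frechet_derivative W (at u) v"])
qed

lemma frechet_derivative_field:
  fixes f :: "'a::euclidean_space \<Rightarrow> 'b::real_normed_vector"
  assumes "open U" "u \<in> U" "smooth_on U f" "W differentiable (at u)"
  shows "frechet_derivative (\<lambda>z. frechet_derivative f (at z) (W z)) (at u) v
    = hess f u (W u) v + frechet_derivative f (at u) (frechet_derivative W (at u) v)"
  using frechet_derivative_field_along[of U f U u "\<lambda>z. z" W v] assms by simp

lemma lie_lie:
  fixes f :: "'a::euclidean_space \<Rightarrow> 'b::real_normed_vector"
  assumes "open U" "u \<in> U" "smooth_on U f" "smooth_on U W"
  shows "lie V (lie W f) u = hess f u (W u) (V u) + frechet_derivative f (at u) (lie V W u)"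
  using frechet_derivative_field[of U u f W "V u"] assms smooth_on_imp_differentiable
  by (auto simp: lie_def[abs_def])

text \<open>The Hessian terms cancel by symmetry, leaving the derivative along the bracket of the
  two fields.\<close>

lemma lie_commutator:
  fixes f :: "'a::euclidean_space \<Rightarrow> 'b::real_inner"
  assumes "open U" "u \<in> U" "smooth_on U f" "smooth_on U V" "smooth_on U W"
  shows "lie V (lie W f) u - lie W (lie V f) u
    = frechet_derivative f (at u) (lie V W u - lie W V u)"
  using lie_lie[OF assms(1-3)] assms(4,5) hess_symmetric[OF assms(1,3,2)]
    linear_diff[OF linear_frechet_derivative[OF smooth_on_imp_differentiable[OF assms(3,2)]]]
  by simp

section \<open>Minkowski algebra and space-like patches\<close>

lemma vec4_eq_iff: "(x::'a^4) = y \<longleftrightarrow> x$1 = y$1 \<and> x$2 = y$2 \<and> x$3 = y$3 \<and> x$4 = y$4"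
  by (simp add: vec_eq_iff forall_4)

lemma bounded_bilinear_mink: "bounded_bilinear mink"
  unfolding bilinear_conv_bounded_bilinear[symmetric] bilinear_def
  by (auto intro!: linearI simp: mink_def algebra_simps)

interpretation mink: bounded_bilinear mink
  by (rule bounded_bilinear_mink)

lemma bounded_bilinear_wedge: "bounded_bilinear wedge"
  unfolding bilinear_conv_bounded_bilinear[symmetric] bilinear_def
  by (auto intro!: linearI simp: wedge_def vec_eq_iff algebra_simps)

interpretation wedge: bounded_bilinear wedge
  by (rule bounded_bilinear_wedge)

lemmas mink_simps = mink.add_left mink.add_right mink.diff_left mink.diff_right mink.minus_left
  mink.minus_right mink.scaleR_left mink.scaleR_right

lemma wedge_self [simp]: "wedge v v = 0"
  by (simp add: wedge_def vec_eq_iff)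

lemma wedge_commute: "wedge w v = - wedge v w"
  by (simp add: wedge_def vec_eq_iff)

lemma mink_commute: "mink x y = mink y x"
  by (simp add: mink_def algebra_simps)

lemma mink_nondegenerate:
  assumes "\<And>w. mink v w = 0"
  shows "v = 0"
  using assms[of "axis 1 1"] assms[of "axis 2 1"] assms[of "axis 3 1"] assms[of "axis 4 1"]
  by (simp add: mink_def axis_def vec4_eq_iff)

lemma independent_pair_spans_plane:
  fixes a b c :: "real^2"
  assumes "\<And>r s. r *\<^sub>R a + s *\<^sub>R b = 0 \<Longrightarrow> r = 0 \<and> s = 0"
  obtains r s where "c = r *\<^sub>R a + s *\<^sub>R b"
proof -
  have ab: "a \<noteq> b" using assms[of 1 "-1"] by auto
  have "b \<noteq> 0" using assms[of 0 1] by auto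
  moreover have "a \<notin> span {b}"
  proof
    assume "a \<in> span {b}"
    then obtain k where "a = k *\<^sub>R b" by (auto simp: span_singleton)
    then show False using assms[of 1 "-k"] by auto
  qed
  ultimately have "independent {a, b}"
    by (simp add: independent_insert ab)
  then have "(UNIV::(real^2) set) \<subseteq> span {a, b}"
    using ab by (intro card_ge_dim_independent) auto
  then have "c \<in> span {a, b}" by auto
  then obtain r s where "c = r *\<^sub>R a + s *\<^sub>R b"
    unfolding span_insert span_singleton by (auto simp: algebra_simps)
  then show thesis by (rule that)
qed

section \<open>Tangential and normal parts on a patch\<close>

definition normal_part :: "(real^2 \<Rightarrow> real^4) \<Rightarrow> real^2 \<Rightarrow> real^4 \<Rightarrow> real^4" where
  "normal_part X u w = w - tangential_part X u w"

text \<open>The description hidden in \<open>conn\<close>, made a function of the ambient vector so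
  that its linearity can be used.\<close>

definition tangential_coord :: "(real^2 \<Rightarrow> real^4) \<Rightarrow> real^2 \<Rightarrow> real^4 \<Rightarrow> real^2" where
  "tangential_coord X u w = (THE a. push X u a = tangential_part X u w)"

definition orthonormal_at :: "(real^2 \<Rightarrow> real^4) \<Rightarrow> real^2 \<Rightarrow> real^2 \<Rightarrow> real^2 \<Rightarrow> bool" where
  "orthonormal_at X u a b \<longleftrightarrow> mink (push X u a) (push X u a) = 1 \<and>
     mink (push X u b) (push X u b) = 1 \<and> mink (push X u a) (push X u b) = 0"

locale spacelike_patch =
  fixes U :: "(real^2) set" and X :: "real^2 \<Rightarrow> real^4"
  assumes open_U: "open U" and smooth_X: "smooth_on U X"
    and inj_push: "\<And>u. u \<in> U \<Longrightarrow> inj (push X u)"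
    and spacelike: "\<And>u v. u \<in> U \<Longrightarrow> v \<in> tangent_plane X u \<Longrightarrow> v \<noteq> 0 \<Longrightarrow> mink v v > 0"
begin

lemma linear_push: "u \<in> U \<Longrightarrow> linear (push X u)"
  by (rule linear_frechet_derivative[OF smooth_on_imp_differentiable[OF smooth_X]])

lemma push_eq_0_iff: "u \<in> U \<Longrightarrow> push X u a = 0 \<longleftrightarrow> a = 0"
  using inj_push linear_push linear_injective_0 linear_0 by metis

lemma mink_push_pos: "u \<in> U \<Longrightarrow> a \<noteq> 0 \<Longrightarrow> mink (push X u a) (push X u a) > 0"
  using spacelike[of u "push X u a"] push_eq_0_iff by (auto simp: tangent_plane_def)

lemma spacelike_patch_subset: "open V \<Longrightarrow> V \<subseteq> U \<Longrightarrow> spacelike_patch V X"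
  by unfold_locales (use smooth_on_subset[OF smooth_X] inj_push spacelike in auto)

context
  fixes u a b
  assumes u: "u \<in> U" and ab: "orthonormal_at X u a b"
begin

lemma mink_frame:
  "mink (push X u a) (push X u a) = 1" "mink (push X u b) (push X u b) = 1"
  "mink (push X u a) (push X u b) = 0" "mink (push X u b) (push X u a) = 0"
  using ab by (auto simp: orthonormal_at_def mink_commute)

lemma orthonormal_expansion:
  "c = mink (push X u c) (push X u a) *\<^sub>R a + mink (push X u c) (push X u b) *\<^sub>R b"
proof -
  interpret push: linear "push X u" by (rule linear_push[OF u])
  have "r = 0 \<and> s = 0" if "r *\<^sub>R a + s *\<^sub>R b = 0" for r s
  proof -
    have "r *\<^sub>R push X u a + s *\<^sub>R push X u b = 0"
      using push.add push.scale that push.zero by metis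
    then have "mink (r *\<^sub>R push X u a + s *\<^sub>R push X u b) w = 0" for w
      by (simp add: mink.zero_left)
    from this[of "push X u a"] this[of "push X u b"] show ?thesis
      by (simp add: mink.add_left mink.scaleR_left mink_frame)
  qed
  then obtain r s where c: "c = r *\<^sub>R a + s *\<^sub>R b"
    using independent_pair_spans_plane by blast
  have "mink (push X u c) (push X u a) = r" "mink (push X u c) (push X u b) = s"
    by (auto simp: c push.add push.scale mink.add_left mink.scaleR_left mink_frame)
  with c show ?thesis by simp
qed

lemma push_expansion:
  "push X u c = mink (push X u c) (push X u a) *\<^sub>R push X u a
    + mink (push X u c) (push X u b) *\<^sub>R push X u b"
  using orthonormal_expansion[of c] linear_add[OF linear_push[OF u]] linear_scale[OF linear_push[OF u]]
  by metis

text \<open>Two candidates for the projection differ by a tangent vector orthogonal to the tangent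
  plane; as the induced metric is positive definite, this difference is zero.\<close>

lemma tangential_part_eq:
  "tangential_part X u w = mink w (push X u a) *\<^sub>R push X u a + mink w (push X u b) *\<^sub>R push X u b"
    (is "_ = ?t")
proof -
  interpret push: linear "push X u" by (rule linear_push[OF u])
  have t: "?t = push X u (mink w (push X u a) *\<^sub>R a + mink w (push X u b) *\<^sub>R b)"
    by (simp add: push.add push.scale)
  have orth: "mink (w - ?t) (push X u c) = 0" for c
    by (subst push_expansion[of c])
      (simp add: mink.diff_left mink.add_left mink.add_right mink.scaleR_left mink.scaleR_right mink_frame)
  show ?thesis
    unfolding tangential_part_def
  proof (rule the_equality)
    show "?t \<in> tangent_plane X u \<and> (\<forall>s\<in>tangent_plane X u. mink (w - ?t) s = 0)"
      using orth unfolding tangent_plane_def by (auto simp only: t)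
    fix t' assume t': "t' \<in> tangent_plane X u \<and> (\<forall>s\<in>tangent_plane X u. mink (w - t') s = 0)"
    then obtain c where c: "t' = push X u c" by (auto simp: tangent_plane_def)
    obtain c' where c': "?t - t' = push X u c'"
      unfolding t c using push.diff by metis
    have "mink (?t - t') (push X u c') = mink (w - t') (push X u c') - mink (w - ?t) (push X u c')"
      by (simp add: mink.diff_left)
    also have "\<dots> = 0" using orth t' by (auto simp: tangent_plane_def)
    finally have "c' = 0" unfolding c' using mink_push_pos[OF u] by fastforce
    then show "t' = ?t" using c' push.zero by simp
  qed
qed

lemma push_tangential_coord: "push X u (tangential_coord X u w) = tangential_part X u w"
  and tangential_coord_eq:
    "tangential_coord X u w = mink w (push X u a) *\<^sub>R a + mink w (push X u b) *\<^sub>R b" (is "_ = ?c")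
proof -
  have "push X u ?c = tangential_part X u w"
    using linear_add[OF linear_push[OF u]] linear_scale[OF linear_push[OF u]]
    by (simp add: tangential_part_eq)
  then show "tangential_coord X u w = ?c"
    unfolding tangential_coord_def
    using inj_push[OF u] \<open>push X u ?c = tangential_part X u w\<close>
    by (intro the_equality) (auto simp: inj_def)
  with \<open>push X u ?c = tangential_part X u w\<close> show "push X u (tangential_coord X u w) = tangential_part X u w"
    by simp
qed

end

text \<open>The transition matrix between orthonormal bases is orthogonal, so the trace of a
  bilinear map does not depend on the basis. This discharges the definite descriptions in
  \<open>mean_curvature\<close>, \<open>laplacian\<close> and
  \<open>second_ff_norm2\<close>.\<close>

lemma orthonormal_trace:
  fixes B :: "real^2 \<Rightarrow> real^2 \<Rightarrow> 'b::real_vector"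
  assumes l: "\<And>v. linear (\<lambda>c. B c v)" and r: "\<And>v. linear (B v)" and u: "u \<in> U"
    and ab: "orthonormal_at X u a b" and cd: "orthonormal_at X u c d"
  shows "B c c + B d d = B a a + B b b"
proof -
  interpret push: linear "push X u" by (rule linear_push[OF u])
  define g where "g v w = mink (push X u v) (push X u w)" for v w
  have g: "g a a = 1" "g b b = 1" "g a b = 0"
    using ab by (auto simp: g_def orthonormal_at_def)
  define p q s t where "p = g c a" "q = g c b" "s = g d a" "t = g d b"
  have gadd: "g v (m *\<^sub>R w + n *\<^sub>R z) = m * g v w + n * g v z" for v m w n z
    by (simp add: g_def push.add push.scale mink.add_right mink.scaleR_right)
  have gsym: "g v w = g w v" for v w by (simp add: g_def mink_commute)
  have c: "c = p *\<^sub>R a + q *\<^sub>R b" and d: "d = s *\<^sub>R a + t *\<^sub>R b"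
    unfolding p_q_s_t_def g_def by (rule orthonormal_expansion[OF u ab])+
  \<comment> \<open>Expanding \<open>a\<close>, \<open>b\<close> in the basis \<open>c\<close>,
    \<open>d\<close> yields the relations between the columns of the transition matrix; these, not
    the ones between its rows, occur in the trace.\<close>
  have a: "a = p *\<^sub>R c + s *\<^sub>R d" and b: "b = q *\<^sub>R c + t *\<^sub>R d"
    unfolding p_q_s_t_def g_def mink_commute[of "push X u c"] mink_commute[of "push X u d"]
    by (rule orthonormal_expansion[OF u cd])+
  have "g a a = p * g a c + s * g a d" "g b b = q * g b c + t * g b d" "g a b = q * g a c + t * g a d"
    using gadd[of a p c s d, folded a] gadd[of b q c t d, folded b] gadd[of a q c t d, folded b]
    by auto
  moreover have sym: "g a c = p" "g b c = q" "g a d = s" "g b d = t"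
    unfolding p_q_s_t_def by (rule gsym)+
  ultimately have 1: "p * p + s * s = 1" "q * q + t * t = 1" "q * p + t * s = 0"
    using g by (simp_all add: sym)
  have Bl: "B (m *\<^sub>R v + n *\<^sub>R w) z = m *\<^sub>R B v z + n *\<^sub>R B w z" for m v n w z
    using linear_add[OF l[of z]] linear_scale[OF l[of z]] by simp
  have Br: "B z (m *\<^sub>R v + n *\<^sub>R w) = m *\<^sub>R B z v + n *\<^sub>R B z w" for m v n w z
    using linear_add[OF r[of z]] linear_scale[OF r[of z]] by simp
  have "B c c + B d d = (p *\<^sub>R p *\<^sub>R B a a + p *\<^sub>R q *\<^sub>R B b a
        + (q *\<^sub>R p *\<^sub>R B a b + q *\<^sub>R q *\<^sub>R B b b))
      + (s *\<^sub>R s *\<^sub>R B a a + s *\<^sub>R t *\<^sub>R B b a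
        + (t *\<^sub>R s *\<^sub>R B a b + t *\<^sub>R t *\<^sub>R B b b))"
    unfolding c d Bl Br scaleR_add_right ..
  also have "\<dots> = (p * p + s * s) *\<^sub>R B a a + (q * q + t * t) *\<^sub>R B b b
      + (q * p + t * s) *\<^sub>R (B a b + B b a)"
    by (simp add: algebra_simps)
  finally have *: "B c c + B d d = B a a + B b b" unfolding 1 by simp
  show ?thesis by (rule *)
qed

end

section \<open>Second fundamental form, mean curvature and Laplacian\<close>

lemma smooth_on_mink: "open U \<Longrightarrow> smooth_on U f \<Longrightarrow> smooth_on U g \<Longrightarrow> smooth_on U (\<lambda>u. mink (f u) (g u))"
  by (rule mink.smooth_on)

lemma smooth_on_wedge: "open U \<Longrightarrow> smooth_on U f \<Longrightarrow> smooth_on U g \<Longrightarrow> smooth_on U (\<lambda>u. wedge (f u) (g u))"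
  by (rule wedge.smooth_on)

lemmas smooth_intros = smooth_on_add smooth_on_diff smooth_on_minus smooth_on_mult smooth_on_scaleR
  smooth_on_divide smooth_on_const smooth_on_lie smooth_on_mink smooth_on_wedge

text \<open>The second fundamental form as a bilinear map on tangent coordinates; by
  \<open>second_ff_eq\<close> the derivative of the second field contributes nothing normal.\<close>

definition hess_normal :: "(real^2 \<Rightarrow> real^4) \<Rightarrow> real^2 \<Rightarrow> real^2 \<Rightarrow> real^2 \<Rightarrow> real^4" where
  "hess_normal X u a b = normal_part X u (hess X u a b)"

context spacelike_patch
begin

lemma smooth_push: "smooth_on U W \<Longrightarrow> smooth_on U (\<lambda>u. push X u (W u))"
  by (rule smooth_on_frechet_derivative_field[OF open_U smooth_X])

text \<open>Gram-Schmidt on the coordinate fields; the change of basis is triangular with positive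
  diagonal, which gives the orientation.\<close>

lemma orthonormal_frame:
  obtains E1 E2 where "smooth_on U E1" "smooth_on U E2"
    "\<And>u. u \<in> U \<Longrightarrow> orthonormal_at X u (E1 u) (E2 u)"
    "\<And>u. u \<in> U \<Longrightarrow> det (vector [E1 u, E2 u] :: real^2^2) > 0"
proof -
  define g where "g v w u = mink (push X u (v u)) (push X u (w u))" for v w u
  define a b :: "real^2 \<Rightarrow> real^2" where "a u = axis 1 1" and "b u = axis 2 1" for u
  define c where "c u = b u - (g a b u / g a a u) *\<^sub>R a u" for u
  define E1 E2 where "E1 u = (1 / sqrt (g a a u)) *\<^sub>R a u" and "E2 u = (1 / sqrt (g c c u)) *\<^sub>R c u" for u
  have nz: "a u \<noteq> 0" "c u \<noteq> 0" for u
    by (auto simp: a_def b_def c_def vec_eq_iff forall_2 axis_def)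
  have gpos: "g a a u > 0" "g c c u > 0" if "u \<in> U" for u
    unfolding g_def using mink_push_pos[OF that] nz by auto
  have sg: "smooth_on U (g v w)" if "smooth_on U v" "smooth_on U w" for v w
    using smooth_on_mink[OF open_U smooth_push[OF that(1)] smooth_push[OF that(2)]]
    by (simp add: g_def[abs_def])
  have sa: "smooth_on U a" "smooth_on U b" by (auto simp: a_def[abs_def] b_def[abs_def])
  have sc: "smooth_on U c" unfolding c_def[abs_def]
    using gpos by (intro smooth_intros sg sa open_U) fastforce+
  have "smooth_on U E1" "smooth_on U E2" unfolding E1_def[abs_def] E2_def[abs_def]
    using gpos by (intro smooth_intros smooth_on_sqrt smooth_on_const sg sa sc open_U; fastforce)+
  moreover have "orthonormal_at X u (E1 u) (E2 u)" if u: "u \<in> U" for u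
  proof -
    interpret push: linear "push X u" by (rule linear_push[OF u])
    have "g a c u = 0"
      using gpos[OF u] by (simp add: g_def c_def push.diff push.scale mink.diff_right mink.scaleR_right)
    then show ?thesis using gpos[OF u]
      by (auto simp: orthonormal_at_def E1_def E2_def push.scale mink.scaleR_left mink.scaleR_right
          g_def[symmetric])
  qed
  moreover have "det (vector [E1 u, E2 u] :: real^2^2) > 0" if u: "u \<in> U" for u
    using gpos[OF u] by (simp add: det_2 E1_def E2_def c_def a_def b_def axis_def)
  ultimately show thesis by (rule that)
qed

lemma orthonormal_at_exists:
  assumes "u \<in> U" obtains a b where "orthonormal_at X u a b"
  using orthonormal_frame assms by metis

context
  fixes u assumes u: "u \<in> U"
begin

lemma push_coord: "push X u (tangential_coord X u w) = tangential_part X u w"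
  using orthonormal_at_exists[OF u] push_tangential_coord[OF u] by metis

lemma linear_tangential_part: "linear (tangential_part X u)"
proof -
  obtain a b where ab: "orthonormal_at X u a b" using orthonormal_at_exists[OF u] .
  show ?thesis
    by (rule linearI) (simp_all add: tangential_part_eq[OF u ab] mink.add_left mink.scaleR_left algebra_simps)
qed

lemma linear_normal_part: "linear (normal_part X u)"
  unfolding normal_part_def[abs_def]
  by (intro linear_compose_sub linear_ident linear_tangential_part)

lemma linear_tangential_coord: "linear (tangential_coord X u)"
proof -
  obtain a b where ab: "orthonormal_at X u a b" using orthonormal_at_exists[OF u] .
  show ?thesis
    by (rule linearI) (simp_all add: tangential_coord_eq[OF u ab] mink.add_left mink.scaleR_left algebra_simps)
qed

lemma tangential_part_push: "tangential_part X u (push X u c) = push X u c"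
proof -
  obtain a b where ab: "orthonormal_at X u a b" using orthonormal_at_exists[OF u] .
  show ?thesis by (metis tangential_part_eq[OF u ab] push_expansion[OF u ab])
qed

lemma normal_part_push: "normal_part X u (push X u c) = 0"
  by (simp add: normal_part_def tangential_part_push)

lemma tangential_coord_push: "tangential_coord X u (push X u c) = c"
  using push_coord tangential_part_push inj_push[OF u] by (metis injD)

lemma mink_normal_part: "mink (normal_part X u w) (push X u c) = 0"
proof -
  obtain a b where ab: "orthonormal_at X u a b" using orthonormal_at_exists[OF u] .
  show ?thesis
    by (subst push_expansion[OF u ab, of c])
      (simp add: normal_part_def tangential_part_eq[OF u ab] mink_simps mink_frame[OF u ab])
qed

lemma linear_hess_normal: "linear (hess_normal X u a)" "linear (\<lambda>a. hess_normal X u a b)"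
  unfolding hess_normal_def[abs_def]
  using linear_compose[OF linear_hess_right[OF smooth_X u] linear_normal_part]
    linear_compose[OF linear_hess_left[OF open_U smooth_X u] linear_normal_part]
  by (simp_all add: o_def)

lemma flat_conn_eq:
  "W differentiable (at u) \<Longrightarrow>
    flat_conn X V W u = hess X u (W u) (V u) + push X u (frechet_derivative W (at u) (V u))"
  unfolding flat_conn_def by (rule frechet_derivative_field[OF open_U u smooth_X])

lemma conn_eq: "conn X V W u = tangential_coord X u (flat_conn X V W u)"
  by (simp add: conn_def tangential_coord_def)

lemma second_ff_eq_normal_part: "second_ff X V W u = normal_part X u (flat_conn X V W u)"
  by (simp add: second_ff_def conn_eq push_coord normal_part_def)

lemma second_ff_eq: "W differentiable (at u) \<Longrightarrow> second_ff X V W u = hess_normal X u (W u) (V u)"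
  by (simp add: second_ff_eq_normal_part flat_conn_eq linear_add[OF linear_normal_part]
      normal_part_push hess_normal_def)

lemma conn_eq_hess: "W differentiable (at u) \<Longrightarrow> conn X V W u
    = tangential_coord X u (hess X u (W u) (V u)) + frechet_derivative W (at u) (V u)"
  by (simp add: conn_eq flat_conn_eq linear_add[OF linear_tangential_coord] tangential_coord_push)

lemma frame_differentiable: "tangent_frame_on X N E \<Longrightarrow> u \<in> N \<Longrightarrow> E i differentiable (at u)"
  using smooth_on_imp_differentiable by (auto simp: tangent_frame_on_def)

lemma frame_orthonormal: "tangent_frame_on X N E \<Longrightarrow> u \<in> N \<Longrightarrow> orthonormal_at X u (E 1 u) (E 2 u)"
  by (auto simp: tangent_frame_on_def orthonormal_at_def)

end

lemma tangent_frame_exists: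
  obtains E where "tangent_frame_on X U E"
proof -
  obtain E1 E2 where E: "smooth_on U E1" "smooth_on U E2"
    "\<And>u. u \<in> U \<Longrightarrow> orthonormal_at X u (E1 u) (E2 u)"
    using orthonormal_frame by metis
  have "tangent_frame_on X U (\<lambda>i. if i = 1 then E1 else E2)"
    using E by (auto simp: tangent_frame_on_def forall_2 orthonormal_at_def mink_commute)
  then show thesis by (rule that)
qed

lemma mean_curvature_eq:
  assumes u: "u \<in> U" and ab: "orthonormal_at X u a b"
  shows "mean_curvature X u = (1/2) *\<^sub>R (hess_normal X u a a + hess_normal X u b b)"
proof -
  have *: "(\<Sum>i\<in>UNIV. second_ff X (E i) (E i) u) = hess_normal X u a a + hess_normal X u b b"
    if "u \<in> N" "tangent_frame_on X N E" for N E
    using orthonormal_trace[OF linear_hess_normal(2,1)[OF u] u ab frame_orthonormal[OF u that(2,1)]]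
    by (simp add: sum_2 second_ff_eq[OF u frame_differentiable[OF u that(2,1)]])
  obtain E where "tangent_frame_on X U E" using tangent_frame_exists .
  then show ?thesis
    unfolding mean_curvature_def using open_U u *
    by (intro the_equality exI[of _ U] exI[of _ E] conjI) (auto simp del: sum_2)
qed

text \<open>Freezing a frame at \<open>u\<close> costs a derivative of the frame both in the
  connection term and in the second derivative; the two cancel, and what remains is bilinear, so
  \<open>orthonormal_trace\<close> applies.\<close>

lemma laplacian_eq:
  assumes u: "u \<in> U" and ab: "orthonormal_at X u a b" and F: "smooth_on U F"
  shows "laplacian X F u = push F u (tangential_coord X u (hess X u a a)) - hess F u a a
    + (push F u (tangential_coord X u (hess X u b b)) - hess F u b b)"
proof -
  define B where "B v w = push F u (tangential_coord X u (hess X u v w)) - hess F u v w" for v w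
  interpret F: linear "push F u"
    by (rule linear_frechet_derivative[OF smooth_on_imp_differentiable[OF F u]])
  have B: "linear (\<lambda>c. B c v)" "linear (B v)" for v
    unfolding B_def[abs_def]
    using linear_compose[OF linear_compose[OF linear_hess_right[OF smooth_X u] linear_tangential_coord[OF u]] F.linear_axioms]
      linear_compose[OF linear_compose[OF linear_hess_left[OF open_U smooth_X u] linear_tangential_coord[OF u]] F.linear_axioms]
    by (intro linear_compose_sub linear_hess_right[OF F u] linear_hess_left[OF open_U F u]; simp add: o_def)+
  have *: "(\<Sum>i\<in>UNIV. push F u (conn X (E i) (E i) u) - push (\<lambda>z. push F z (E i z)) u (E i u))
      = B a a + B b b"
    if "u \<in> N" "tangent_frame_on X N E" for N E
  proof -
    have "push F u (conn X (E i) (E i) u) - push (\<lambda>z. push F z (E i z)) u (E i u) = B (E i u) (E i u)" for i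
      using frame_differentiable[OF u that(2,1), of i]
      by (simp add: conn_eq_hess[OF u] frechet_derivative_field[OF open_U u F] B_def F.add)
    then show ?thesis
      using orthonormal_trace[OF B u ab frame_orthonormal[OF u that(2,1)]] by (simp add: sum_2)
  qed
  obtain E where "tangent_frame_on X U E" using tangent_frame_exists .
  then show ?thesis
    unfolding laplacian_def B_def[symmetric] using open_U u *
    by (intro the_equality exI[of _ U] exI[of _ E] conjI) auto
qed

lemma laplacian_eq_lie:
  assumes u: "u \<in> U" and F: "smooth_on U F" and E: "smooth_on U E1" "smooth_on U E2"
    and orth: "orthonormal_at X u (E1 u) (E2 u)"
  shows "laplacian X F u = push F u (conn X E1 E1 u) - lie E1 (lie E1 F) u
    + (push F u (conn X E2 E2 u) - lie E2 (lie E2 F) u)"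
proof -
  interpret F: linear "push F u"
    by (rule linear_frechet_derivative[OF smooth_on_imp_differentiable[OF F u]])
  show ?thesis
    using smooth_on_imp_differentiable[OF E(1) u] smooth_on_imp_differentiable[OF E(2) u]
    unfolding laplacian_eq[OF u orth F] lie_lie[OF open_U u F E(1)] lie_lie[OF open_U u F E(2)]
    by (simp add: conn_eq_hess[OF u] F.add lie_def)
qed

end

lemma laplacian_cong:
  assumes "open U" "u \<in> U" "\<And>z. z \<in> U \<Longrightarrow> F z = G z"
  shows "laplacian X F u = laplacian X G u"
proof -
  have 1: "push F z = push G z" if "z \<in> U" for z
    by (rule frechet_derivative_cong_open[OF assms(1) that assms(3)])
  have "push (\<lambda>z. push F z (E z)) u = push (\<lambda>z. push G z (E z)) u" for E
    by (rule frechet_derivative_cong_open[OF assms(1,2)]) (simp add: 1)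
  then show ?thesis by (simp add: laplacian_def 1[OF assms(2)])
qed

text \<open>The squared length of the second fundamental form, possibly negative because normal
  vectors need not be space-like. It is the coefficient of the Gauss map in its Laplacian and a
  candidate for \<open>f\<close> that depends on no chart.\<close>

definition second_ff_norm2 :: "(real^2 \<Rightarrow> real^4) \<Rightarrow> real^2 \<Rightarrow> real" where
  "second_ff_norm2 X u = (THE r. \<exists>a b. orthonormal_at X u a b \<and>
     r = (let h = hess_normal X u; s = (\<lambda>v. mink v v) in s (h a a) + s (h a b) + (s (h b a) + s (h b b))))"

text \<open>The sum is a double trace; the frame is exchanged in one slot of \<open>h\<close> at a
  time.\<close>

lemma (in spacelike_patch) second_ff_norm2_eq:
  assumes u: "u \<in> U" and ab: "orthonormal_at X u a b"
  defines "h \<equiv> hess_normal X u"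
  shows "second_ff_norm2 X u = mink (h a a) (h a a) + mink (h a b) (h a b)
    + (mink (h b a) (h b a) + mink (h b b) (h b b))"
proof -
  have comp: "linear f \<Longrightarrow> linear (\<lambda>x. mink w (f x))" "linear f \<Longrightarrow> linear (\<lambda>x. mink (f x) w)" for f and w
    by (auto intro!: linearI simp: linear_add linear_scale mink_simps)
  note h = linear_hess_normal[OF u, folded h_def]
  have *: "mink (h a a) (h a a) + mink (h a b) (h a b) + (mink (h b a) (h b a) + mink (h b b) (h b b))
     = mink (h c c) (h c c) + mink (h c d) (h c d) + (mink (h d c) (h d c) + mink (h d d) (h d d))"
    if cd: "orthonormal_at X u c d" for c d
  proof -
    have 1: "mink (h v a) (h v a) + mink (h v b) (h v b) = mink (h v c) (h v c) + mink (h v d) (h v d)" for v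
      by (rule orthonormal_trace[OF _ _ u cd ab, where B="\<lambda>x y. mink (h v x) (h v y)"]) (intro comp h)+
    have 2: "mink (h a v) (h a v) + mink (h b v) (h b v) = mink (h c v) (h c v) + mink (h d v) (h d v)" for v
      by (rule orthonormal_trace[OF _ _ u cd ab, where B="\<lambda>x y. mink (h x v) (h y v)"]) (intro comp h)+
    show ?thesis using 1[of a] 1[of b] 2[of c] 2[of d] by linarith
  qed
  show ?thesis unfolding second_ff_norm2_def Let_def h_def[symmetric]
  proof (rule the_equality)
    fix r assume "\<exists>c d. orthonormal_at X u c d \<and>
      r = mink (h c c) (h c c) + mink (h c d) (h c d) + (mink (h d c) (h d c) + mink (h d d) (h d d))"
    then obtain c d where "orthonormal_at X u c d" and r:
      "r = mink (h c c) (h c c) + mink (h c d) (h c d) + (mink (h d c) (h d c) + mink (h d d) (h d d))"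
      by blast
    from *[OF this(1)] r show "r = mink (h a a) (h a a) + mink (h a b) (h a b)
        + (mink (h b a) (h b a) + mink (h b b) (h b b))"
      by (rule trans[OF _ sym, rotated])
  qed (use ab in blast)
qed

section \<open>Change of chart\<close>

locale reparametrization = X: spacelike_patch U X + Y: spacelike_patch V Y
  for U X V Y +
  fixes D \<tau>
  assumes open_D: "open D" and D_subset: "D \<subseteq> U" and smooth_\<tau>: "smooth_on D \<tau>"
    and \<tau>_image: "\<tau> ` D \<subseteq> V" and XY: "\<And>z. z \<in> D \<Longrightarrow> X z = Y (\<tau> z)"
begin

context
  fixes u assumes u: "u \<in> D"
begin

lemma push_reparam: "push X u a = push Y (\<tau> u) (push \<tau> u a)"
proof -
  have \<tau>u: "\<tau> u \<in> V" using u \<tau>_image by auto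
  have "push X u = push (\<lambda>z. Y (\<tau> z)) u"
    by (rule frechet_derivative_cong_open[OF open_D u XY])
  also have "\<dots> = (\<lambda>a. push Y (\<tau> u) (push \<tau> u a))"
    by (rule frechet_derivativeI,
        rule has_derivative_compose[where f=\<tau> and g=Y, OF smooth_on_imp_has_derivative[OF smooth_\<tau> u]
          smooth_on_imp_has_derivative[OF Y.smooth_X \<tau>u]])
  finally show ?thesis by simp
qed

lemma orthonormal_reparam: "orthonormal_at X u a b \<Longrightarrow> orthonormal_at Y (\<tau> u) (push \<tau> u a) (push \<tau> u b)"
  by (simp add: orthonormal_at_def push_reparam)

end

context
  fixes u assumes u: "u \<in> D"
begin

text \<open>The second derivative of the transition map enters only through a tangent vector, which
  the normal part removes.\<close>

lemma hess_normal_reparam: "hess_normal X u a b = hess_normal Y (\<tau> u) (push \<tau> u a) (push \<tau> u b)"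
proof -
  have uU: "u \<in> U" and \<tau>u: "\<tau> u \<in> V" using u \<tau>_image D_subset by auto
  obtain c d where cd: "orthonormal_at X u c d" using X.orthonormal_at_exists[OF uU] .
  have 1: "normal_part X u w = normal_part Y (\<tau> u) w" for w
    by (simp add: normal_part_def X.tangential_part_eq[OF uU cd]
        Y.tangential_part_eq[OF \<tau>u orthonormal_reparam[OF u cd]] push_reparam[OF u])
  have "push (\<lambda>z. push X z a) u = push (\<lambda>z. push Y (\<tau> z) (push \<tau> z a)) u"
    by (rule frechet_derivative_cong_open[OF open_D u push_reparam])
  then have "hess X u a b = frechet_derivative (\<lambda>z. push Y (\<tau> z) (push \<tau> z a)) (at u) b"
    by (simp add: hess_def)
  also have "\<dots> = hess Y (\<tau> u) (push \<tau> u a) (push \<tau> u b)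
      + push Y (\<tau> u) (frechet_derivative (\<lambda>z. push \<tau> z a) (at u) b)"
    by (rule frechet_derivative_field_along[OF Y.open_U Y.smooth_X open_D u \<tau>_image])
      (intro smooth_on_imp_differentiable[OF _ u] smooth_on_frechet_derivative smooth_\<tau>)+
  finally show ?thesis
    by (simp add: hess_normal_def 1 linear_add[OF Y.linear_normal_part[OF \<tau>u]] Y.normal_part_push[OF \<tau>u])
qed

lemma mean_curvature_reparam: "mean_curvature X u = mean_curvature Y (\<tau> u)"
  and second_ff_norm2_reparam: "second_ff_norm2 X u = second_ff_norm2 Y (\<tau> u)"
proof -
  have uU: "u \<in> U" and \<tau>u: "\<tau> u \<in> V" using u \<tau>_image D_subset by auto
  obtain a b where ab: "orthonormal_at X u a b" using X.orthonormal_at_exists[OF uU] .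
  note ab' = orthonormal_reparam[OF u ab]
  show "mean_curvature X u = mean_curvature Y (\<tau> u)"
    by (simp add: X.mean_curvature_eq[OF uU ab] Y.mean_curvature_eq[OF \<tau>u ab'] hess_normal_reparam)
  show "second_ff_norm2 X u = second_ff_norm2 Y (\<tau> u)"
    by (simp add: X.second_ff_norm2_eq[OF uU ab] Y.second_ff_norm2_eq[OF \<tau>u ab'] hess_normal_reparam)
qed

end

end

section \<open>Images under isometries\<close>

lemma (in spacelike_patch) isometry_image:
  fixes L :: "real^4 \<Rightarrow> real^4" and b
  assumes L: "linear L" "\<And>v w. mink (L v) (L w) = mink v w"
  defines "Y \<equiv> \<lambda>u. L (X u) + b"
  shows "spacelike_patch U Y"
    and "u \<in> U \<Longrightarrow> mean_curvature Y u = L (mean_curvature X u)"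
proof -
  have bl: "bounded_linear L" using L(1) linear_conv_bounded_linear by blast
  have L0: "L v = 0 \<longleftrightarrow> v = 0" for v
    using mink_nondegenerate[of v] L linear_0[OF L(1)] mink.zero_left by metis
  have sY: "smooth_on U Y" unfolding Y_def
    by (intro smooth_on_add bounded_linear.smooth_on[OF bl] smooth_on_const open_U smooth_X)
  have pushY: "push Y u a = L (push X u a)" if "u \<in> U" for u a
  proof -
    have "(Y has_derivative (\<lambda>a. L (push X u a) + 0)) (at u)"
      unfolding Y_def
      by (intro has_derivative_add bounded_linear.has_derivative[OF bl] has_derivative_const
          smooth_on_imp_has_derivative[OF smooth_X that])
    then show ?thesis by (simp add: frechet_derivativeI)
  qed
  show P: "spacelike_patch U Y"
  proof
    show "inj (push Y u)" if "u \<in> U" for u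
    proof (rule injI)
      fix a a' assume "push Y u a = push Y u a'"
      then have "L (push X u a - push X u a') = 0" using pushY[OF that] linear_diff[OF L(1)] by simp
      then show "a = a'" using L0 inj_push[OF that] by (auto simp: inj_def)
    qed
    show "mink v v > 0" if "u \<in> U" "v \<in> tangent_plane Y u" "v \<noteq> 0" for u v
    proof -
      from that(2) obtain a where "v = push Y u a" by (auto simp: tangent_plane_def)
      then have "v = L (push X u a)" using pushY[OF that(1)] by simp
      then show ?thesis using spacelike[OF that(1), of "push X u a"] L0 L(2) that(3)
        by (auto simp: tangent_plane_def)
    qed
  qed (use open_U sY in auto)
  then interpret Y: spacelike_patch U Y .
  assume u: "u \<in> U"
  obtain a b where ab: "orthonormal_at X u a b" using orthonormal_at_exists[OF u] .
  then have ab': "orthonormal_at Y u a b" by (simp add: orthonormal_at_def pushY[OF u] L(2))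
  have "hess Y u c d = L (hess X u c d)" for c d
  proof -
    have "push (\<lambda>z. push Y z c) u = push (\<lambda>z. L (push X z c)) u"
      by (rule frechet_derivative_cong_open[OF open_U u pushY])
    also have "\<dots> = (\<lambda>d. L (hess X u c d))" unfolding hess_def
      by (intro frechet_derivativeI bounded_linear.has_derivative[OF bl]
          smooth_on_imp_has_derivative[OF smooth_on_frechet_derivative[OF smooth_X] u])
    finally show ?thesis by (simp add: hess_def)
  qed
  then have "hess_normal Y u c d = L (hess_normal X u c d)" for c d
    by (simp add: hess_normal_def normal_part_def tangential_part_eq[OF u ab] Y.tangential_part_eq[OF u ab']
        pushY[OF u] L(2) linear_diff[OF L(1)] linear_add[OF L(1)] linear_scale[OF L(1)])
  then show "mean_curvature Y u = L (mean_curvature X u)"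
    by (simp add: mean_curvature_eq[OF u ab] Y.mean_curvature_eq[OF u ab'] linear_add[OF L(1)] linear_scale[OF L(1)])
qed

section \<open>Unique continuation\<close>

text \<open>If the second derivative along \<open>a\<close> were positive, the first one, zero at
  \<open>z\<close>, would become positive right after \<open>z\<close>, and \<open>f\<close> would
  exceed its maximum.\<close>

lemma hess_nonpos_at_max:
  fixes f :: "'a::euclidean_space \<Rightarrow> real"
  assumes V: "open V" "z \<in> V" and f: "smooth_on V f" and max: "\<And>y. y \<in> V \<Longrightarrow> f y \<le> f z"
  shows "hess f z a a \<le> 0" and "frechet_derivative f (at z) = (\<lambda>v. 0)"
proof -
  show f0: "frechet_derivative f (at z) = (\<lambda>v. 0)"
    using differential_zero_maxmin[OF V(2,1) smooth_on_imp_has_derivative[OF f V(2)]] max by blast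
  show "hess f z a a \<le> 0"
  proof (rule ccontr)
    assume pos: "\<not> hess f z a a \<le> 0"
    have D: "((\<lambda>s. g (z + s *\<^sub>R a)) has_real_derivative frechet_derivative g (at (z + s *\<^sub>R a)) a) (at s)"
      if "smooth_on V g" "z + s *\<^sub>R a \<in> V" for g :: "'a \<Rightarrow> real" and s
      by (rule has_derivative_along_line[OF that])
    define h' where "h' s = frechet_derivative f (at (z + s *\<^sub>R a)) a" for s
    have "(h' has_real_derivative hess f z a a) (at 0)"
      using D[OF smooth_on_frechet_derivative[OF f], of 0 a] V(2) by (simp add: h'_def[abs_def] hess_def)
    then obtain d where d: "d > 0" "\<And>s. 0 < s \<Longrightarrow> s < d \<Longrightarrow> h' 0 < h' s"
      using DERIV_pos_inc_right[of h' "hess f z a a" 0] pos by auto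
    have "isCont (\<lambda>s. z + s *\<^sub>R a) 0" by (intro continuous_intros)
    then have "\<forall>\<^sub>F s in at 0. z + s *\<^sub>R a \<in> V"
      using V topological_tendstoD[of "\<lambda>s. z + s *\<^sub>R a" z "at 0" V] by (simp add: isCont_def)
    then obtain e where e: "e > 0" "\<And>s. s \<noteq> 0 \<Longrightarrow> \<bar>s\<bar> < e \<Longrightarrow> z + s *\<^sub>R a \<in> V"
      unfolding eventually_at by (auto simp: dist_real_def)
    have inV: "z + s *\<^sub>R a \<in> V" if "\<bar>s\<bar> < e" for s
      using e(2)[of s] that V(2) by (cases "s = 0") auto
    define b where "b = min d e / 2"
    have b: "0 < b" "b < d" "b < e" using d(1) e(1) by (auto simp: b_def min_def)
    obtain s where s: "0 < s" "s < b" "f (z + b *\<^sub>R a) - f (z + 0 *\<^sub>R a) = (b - 0) * h' s"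
      using MVT2[of 0 b "\<lambda>s. f (z + s *\<^sub>R a)" h'] D[OF f inV] b unfolding h'_def by auto
    moreover have "h' s > 0" using d(2)[of s] s b f0 by (simp add: h'_def)
    ultimately have "f (z + b *\<^sub>R a) > f z" using b(1) by (simp add: algebra_simps)
    then show False using max[OF inV[of b]] b by auto
  qed
qed

text \<open>A metric on a plane domain, detached from the surface: \<open>E1\<close>,
  \<open>E2\<close> is its orthonormal frame, \<open>\<omega>1\<close>, \<open>\<omega>2\<close> are
  the values of the connection form on the frame, and \<open>bracket\<close> expresses vanishing
  torsion. \<open>frame_spans\<close> has the form in which the gradient of a radial function is
  tested against the frame.\<close>

locale moving_frame =
  fixes U :: "(real^2) set" and E1 E2 :: "real^2 \<Rightarrow> real^2" and \<omega>1 \<omega>2 :: "real^2 \<Rightarrow> real"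
  assumes open_U: "open U" and smooth_frame: "smooth_on U E1" "smooth_on U E2"
    and smooth_\<omega>: "smooth_on U \<omega>1" "smooth_on U \<omega>2"
    and frame_spans: "\<And>u v. u \<in> U \<Longrightarrow> v \<bullet> E1 u = 0 \<Longrightarrow> v \<bullet> E2 u = 0 \<Longrightarrow> v = 0"
    and bracket: "\<And>u. u \<in> U \<Longrightarrow> lie E1 E2 u - lie E2 E1 u = - \<omega>1 u *\<^sub>R E1 u - \<omega>2 u *\<^sub>R E2 u"
begin

text \<open>The Laplace-Beltrami operator with the analyst's sign, so that it is non-positive at a
  maximum; \<open>laplacian\<close> has the opposite sign.\<close>

definition Lap :: "(real^2 \<Rightarrow> real) \<Rightarrow> real^2 \<Rightarrow> real" where
  "Lap f u = lie E1 (lie E1 f) u + lie E2 (lie E2 f) u - \<omega>1 u * lie E2 f u + \<omega>2 u * lie E1 f u"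

lemma moving_frame_subset: "open V \<Longrightarrow> V \<subseteq> U \<Longrightarrow> moving_frame V E1 E2 \<omega>1 \<omega>2"
  by unfold_locales (use smooth_on_subset smooth_frame smooth_\<omega> frame_spans bracket in \<open>auto\<close>)

lemma commutator:
  fixes f :: "real^2 \<Rightarrow> 'b::real_inner"
  assumes u: "u \<in> U" and f: "smooth_on U f"
  shows "lie E1 (lie E2 f) u - lie E2 (lie E1 f) u = - \<omega>1 u *\<^sub>R lie E1 f u - \<omega>2 u *\<^sub>R lie E2 f u"
proof -
  interpret linear "frechet_derivative f (at u)"
    by (rule linear_frechet_derivative[OF smooth_on_imp_differentiable[OF f u]])
  have "lie E1 (lie E2 f) u - lie E2 (lie E1 f) u
      = frechet_derivative f (at u) ((- \<omega>1 u) *\<^sub>R E1 u - \<omega>2 u *\<^sub>R E2 u)"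
    unfolding lie_commutator[OF open_U u f smooth_frame] bracket[OF u] ..
  then show ?thesis unfolding diff scale lie_def .
qed

lemma smooth_Lap: "smooth_on U f \<Longrightarrow> smooth_on U (Lap f)"
  unfolding Lap_def[abs_def]
  by (intro smooth_intros open_U smooth_frame smooth_\<omega>)

text \<open>At a maximum the first derivative vanishes, and with it the \<open>\<omega>1\<close>,
  \<open>\<omega>2\<close> terms and the derivatives of the frame; only the two Hessian terms
  remain.\<close>

lemma Lap_nonpos_at_max:
  assumes "open V" "V \<subseteq> U" "z \<in> V" "smooth_on V f" "\<And>y. y \<in> V \<Longrightarrow> f y \<le> f z"
  shows "Lap f z \<le> 0"
proof -
  note h = hess_nonpos_at_max[OF assms(1,3,4,5)]
  note sE = smooth_frame[THEN smooth_on_subset, OF assms(2)]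
  show ?thesis
    unfolding Lap_def lie_lie[OF assms(1,3,4) sE(1)] lie_lie[OF assms(1,3,4) sE(2)]
    using h(1)[of "E1 z"] h(1)[of "E2 z"] by (simp add: lie_def h(2))
qed

text \<open>The two first-order equations say that \<open>c1 - \<i> c2\<close> is annihilated by a
  Cauchy--Riemann operator up to a term proportional to it, so \<open>ln (c1\<^sup>2 + c2\<^sup>2)\<close> has a
  prescribed Laplacian away from the zeros.\<close>

lemma Lap_ln_norm:
  assumes V: "open V" "V \<subseteq> U" "u \<in> V"
    and c: "smooth_on U c1" "smooth_on U c2"
    and eq1: "\<And>u. u \<in> U \<Longrightarrow> lie E1 c1 u + lie E2 c2 u = 2 * \<omega>1 u * c2 u - 2 * \<omega>2 u * c1 u"
    and eq2: "\<And>u. u \<in> U \<Longrightarrow> lie E2 c1 u - lie E1 c2 u = 2 * \<omega>1 u * c1 u + 2 * \<omega>2 u * c2 u"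
    and pos: "\<And>z. z \<in> V \<Longrightarrow> c1 z * c1 z + c2 z * c2 z > 0"
  shows "Lap (\<lambda>z. ln (c1 z * c1 z + c2 z * c2 z)) u
    = - 4 * (\<omega>1 u * \<omega>1 u + \<omega>2 u * \<omega>2 u + lie E1 \<omega>2 u - lie E2 \<omega>1 u)"
proof -
  have u: "u \<in> U" using V by auto
  define s where "s z = c1 z * c1 z + c2 z * c2 z" for z
  note sm = smooth_intros open_U smooth_frame smooth_\<omega> c
  have ss: "smooth_on U s" unfolding s_def[abs_def] by (intro sm)
  note sE = smooth_frame[THEN smooth_on_subset, OF V(2)]
  have ssV: "smooth_on V s" by (rule smooth_on_subset[OF ss V(2)])
  have spos: "s z > 0" if "z \<in> V" for z using pos[OF that] by (simp add: s_def)
  have lns: "lie E (\<lambda>z. ln (s z)) z = lie E s z / s z" if "z \<in> V" for E z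
    using has_derivative_imp_lie[OF DERIV_compose_FDERIV[OF DERIV_ln[OF spos[OF that]]
        smooth_on_imp_has_derivative[OF ssV that]]]
    by (simp add: lie_def divide_inverse mult.commute)
  have lns2: "lie E (lie E (\<lambda>z. ln (s z))) u = lie E (lie E s) u / s u - (lie E s u)\<^sup>2 / (s u)\<^sup>2"
    if E: "smooth_on U E" for E
  proof -
    have "lie E (lie E (\<lambda>z. ln (s z))) u = lie E (\<lambda>z. lie E s z / s z) u"
      by (rule lie_cong[OF V(1,3) lns])
    also have "\<dots> = (lie E (lie E s) u * s u - lie E s u * lie E s u) / (s u * s u)"
      using has_derivative_imp_lie[OF has_derivative_divide'[OF
          smooth_on_imp_has_derivative[OF smooth_on_lie[OF open_U E ss] u]
          smooth_on_imp_has_derivative[OF ss u]], of E] spos[OF V(3)]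
      by (simp add: lie_def)
    finally show ?thesis using spos[OF V(3)] by (simp add: field_simps power2_eq_square)
  qed
  have Ds: "lie E s z = 2 * (c1 z * lie E c1 z + c2 z * lie E c2 z)" if "z \<in> U" for E z
    unfolding s_def[abs_def]
    by (simp add: lie_add[OF that smooth_on_mult[OF open_U c(1) c(1)] smooth_on_mult[OF open_U c(2) c(2)]]
        lie_mult[OF that c(1) c(1)] lie_mult[OF that c(2) c(2)])
  have DDs: "lie E (lie E s) u = 2 * ((lie E c1 u)\<^sup>2 + c1 u * lie E (lie E c1) u
      + (lie E c2 u)\<^sup>2 + c2 u * lie E (lie E c2) u)" if E: "smooth_on U E" for E
  proof -
    have "lie E (lie E s) u = lie E (\<lambda>z. 2 * (c1 z * lie E c1 z + c2 z * lie E c2 z)) u"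
      by (rule lie_cong[OF open_U u Ds])
    also have "\<dots> = 2 * lie E (\<lambda>z. c1 z * lie E c1 z + c2 z * lie E c2 z) u"
      by (rule lie_linear[OF u bounded_linear_mult_right]) (intro sm E)
    also have "lie E (\<lambda>z. c1 z * lie E c1 z + c2 z * lie E c2 z) u
      = lie E (\<lambda>z. c1 z * lie E c1 z) u + lie E (\<lambda>z. c2 z * lie E c2 z) u"
      by (rule lie_add[OF u]) (intro sm E)+
    finally show ?thesis
      by (simp add: lie_mult[OF u c(1) smooth_on_lie[OF open_U E c(1)]]
          lie_mult[OF u c(2) smooth_on_lie[OF open_U E c(2)]] power2_eq_square algebra_simps)
  qed
  have prod: "smooth_on U (\<lambda>z. 2 * (f z * g z))"
    "lie E (\<lambda>z. 2 * (f z * g z)) u = 2 * (lie E f u * g u + f u * lie E g u)"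
    if "smooth_on U f" "smooth_on U g" for E and f g :: "real^2 \<Rightarrow> real"
    using lie_linear[OF u bounded_linear_mult_right smooth_on_mult[OF open_U that], of E 2]
      lie_mult[OF u that] smooth_on_mult[OF open_U smooth_on_const smooth_on_mult[OF open_U that]] by simp_all
  note prods = prod[OF smooth_\<omega>(1) c(1)] prod[OF smooth_\<omega>(1) c(2)] prod[OF smooth_\<omega>(2) c(1)]
    prod[OF smooth_\<omega>(2) c(2)]
  \<comment> \<open>Second derivatives of \<open>c1\<close>, \<open>c2\<close> come from
    differentiating the two first-order equations once, in an arbitrary direction
    \<open>E\<close>.\<close>
  have d1: "lie E (lie E1 c1) u + lie E (lie E2 c2) u = 2 * (lie E \<omega>1 u * c2 u + \<omega>1 u * lie E c2 u)
      - 2 * (lie E \<omega>2 u * c1 u + \<omega>2 u * lie E c1 u)" for E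
  proof -
    have "lie E (lie E1 c1) u + lie E (lie E2 c2) u = lie E (\<lambda>z. lie E1 c1 z + lie E2 c2 z) u"
      by (rule lie_add[OF u, symmetric]) (intro sm)+
    also have "\<dots> = lie E (\<lambda>z. 2 * (\<omega>1 z * c2 z) - 2 * (\<omega>2 z * c1 z)) u"
      by (rule lie_cong[OF open_U u]) (simp add: eq1)
    finally show ?thesis by (simp add: lie_diff[OF u] prods)
  qed
  have d2: "lie E (lie E2 c1) u - lie E (lie E1 c2) u = 2 * (lie E \<omega>1 u * c1 u + \<omega>1 u * lie E c1 u)
      + 2 * (lie E \<omega>2 u * c2 u + \<omega>2 u * lie E c2 u)" for E
  proof -
    have "lie E (lie E2 c1) u - lie E (lie E1 c2) u = lie E (\<lambda>z. lie E2 c1 z - lie E1 c2 z) u"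
      by (rule lie_diff[OF u, symmetric]) (intro sm)+
    also have "\<dots> = lie E (\<lambda>z. 2 * (\<omega>1 z * c1 z) + 2 * (\<omega>2 z * c2 z)) u"
      by (rule lie_cong[OF open_U u]) (simp add: eq2)
    finally show ?thesis by (simp add: lie_add[OF u] prods)
  qed
  define S where "S = s u"
  have S: "S > 0" using spos[OF V(3)] by (simp add: S_def)
  \<comment> \<open>From here on the claim is a polynomial identity in the values and first
    derivatives of \<open>c1\<close>, \<open>c2\<close>, \<open>\<omega>1\<close>,
    \<open>\<omega>2\<close>; single letters keep it within reach of
    \<open>algebra_simps\<close>.\<close>
  define a b where "a = c1 u" and "b = c2 u"
  define p q where "p = \<omega>1 u" and "q = \<omega>2 u"
  define x1 x2 y1 y2 where "x1 = lie E1 c1 u" and "x2 = lie E2 c1 u" and "y1 = lie E1 c2 u" and "y2 = lie E2 c2 u"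
  define p1 p2 q1 q2 where "p1 = lie E1 \<omega>1 u" and "p2 = lie E2 \<omega>1 u" and "q1 = lie E1 \<omega>2 u" and "q2 = lie E2 \<omega>2 u"
  define X where "X = lie E1 (lie E1 c1) u + lie E2 (lie E2 c1) u"
  define Y where "Y = lie E1 (lie E1 c2) u + lie E2 (lie E2 c2) u"
  note defs = a_def b_def p_def q_def x1_def x2_def y1_def y2_def p1_def p2_def q1_def q2_def X_def Y_def
  have y2: "y2 = 2 * p * b - 2 * q * a - x1" and x2: "x2 = 2 * p * a + 2 * q * b + y1"
    using eq1[OF u] eq2[OF u] unfolding defs by linarith+
  \<comment> \<open>Adding the equation differentiated along \<open>E1\<close> to the one
    differentiated along \<open>E2\<close> leaves a commutator acting on \<open>c2\<close>, which is
    of first order by \<open>commutator\<close>; \<open>Y\<close> is treated in the same way with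
    \<open>c1\<close>.\<close>
  have X: "X = p * y1 + q * y2 + 2 * (p1 * b + p * y1) - 2 * (q1 * a + q * x1)
      + 2 * (p2 * a + p * x2) + 2 * (q2 * b + q * y2)"
    using d1[of E1] d2[of E2] commutator[OF u c(2)] unfolding defs by simp
  have Y: "Y = - (p * x1 + q * x2) + 2 * (p2 * b + p * y2) - 2 * (q2 * a + q * x2)
      - 2 * (p1 * a + p * x1) - 2 * (q1 * b + q * y1)"
    using d1[of E2] d2[of E1] commutator[OF u c(1)] unfolding defs by simp
  have SS: "S = a * a + b * b" by (simp add: S_def s_def defs)
  have "Lap (\<lambda>z. ln (s z)) u
    = 2 * (x1\<^sup>2 + x2\<^sup>2 + y1\<^sup>2 + y2\<^sup>2 + a * X + b * Y) / S
      - ((2 * (a * x1 + b * y1))\<^sup>2 + (2 * (a * x2 + b * y2))\<^sup>2) / S\<^sup>2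
      - p * (2 * (a * x2 + b * y2)) / S + q * (2 * (a * x1 + b * y1)) / S"
    unfolding Lap_def lns2[OF smooth_frame(1)] lns2[OF smooth_frame(2)] lns[OF V(3)]
      DDs[OF smooth_frame(1)] DDs[OF smooth_frame(2)] Ds[OF u] S_def defs
    by (simp add: add_divide_distrib diff_divide_distrib algebra_simps)
  also have "\<dots> = - 4 * (p * p + q * q + q1 - p2)"
  proof -
    have "2 * (x1\<^sup>2 + x2\<^sup>2 + y1\<^sup>2 + y2\<^sup>2 + a * X + b * Y) * S
      - ((2 * (a * x1 + b * y1))\<^sup>2 + (2 * (a * x2 + b * y2))\<^sup>2)
      - p * (2 * (a * x2 + b * y2)) * S + q * (2 * (a * x1 + b * y1)) * S
      = - 4 * (p * p + q * q + q1 - p2) * S\<^sup>2"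
      unfolding SS X Y y2 x2 by (simp add: power2_eq_square algebra_simps)
    moreover have "A / S - B / S\<^sup>2 - C / S + D / S = R"
      if "A * S - B - C * S + D * S = R * S\<^sup>2" for A B C D R
    proof -
      have "A / S - B / S\<^sup>2 - C / S + D / S = (A * S - B - C * S + D * S) / S\<^sup>2"
        using S by (simp add: power2_eq_square add_divide_distrib diff_divide_distrib)
      then show ?thesis using that S by simp
    qed
    ultimately show ?thesis by blast
  qed
  finally show ?thesis unfolding s_def defs .
qed

end

context moving_frame
begin

text \<open>The barrier of Hopf's boundary point lemma. With \<open>t\<close> the squared distance
  to \<open>z0\<close> and \<open>k\<close> the squared length of its gradient, the Laplacian of
  \<open>exp (- m * t)\<close> is \<open>m * exp (- m * t)\<close> times
  \<open>m * k - Lap t\<close>; on a compact set that misses \<open>z0\<close>, \<open>k\<close> is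
  bounded below and wins for large \<open>m\<close>.\<close>

lemma barrier:
  assumes K: "compact K" "K \<subseteq> U" "z0 \<notin> K"
  obtains m :: real and \<delta> :: real where "m > 0" "\<delta> > 0"
    "\<And>z. z \<in> K \<Longrightarrow> Lap (\<lambda>z. exp (- m * ((z - z0) \<bullet> (z - z0)))) z \<ge> \<delta>"
proof (cases "K = {}")
  case True
  then show ?thesis using that[of 1 1] by auto
next
  case False
  define t where "t z = (z - z0) \<bullet> (z - z0)" for z
  have st: "smooth_on U t" unfolding t_def[abs_def]
    by (intro bounded_bilinear.smooth_on[OF bounded_bilinear_inner] smooth_on_diff smooth_on_ident
        smooth_on_const open_U)
  have Dt: "lie E t z = 2 * ((z - z0) \<bullet> E z)" for E z
    unfolding t_def[abs_def]
    by (subst has_derivative_imp_lie, (rule derivative_eq_intros refl)+) (simp add: inner_commute)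
  define k where "k z = (lie E1 t z)\<^sup>2 + (lie E2 t z)\<^sup>2" for z
  have kpos: "k z > 0" if "z \<in> K" for z
  proof -
    have "z - z0 \<noteq> 0" using K(3) that by auto
    then have "(z - z0) \<bullet> E1 z \<noteq> 0 \<or> (z - z0) \<bullet> E2 z \<noteq> 0"
      using frame_spans[of z "z - z0"] K(2) that by blast
    then show ?thesis unfolding k_def Dt sum_power2_gt_zero_iff by simp
  qed
  have contk: "continuous_on K k"
    unfolding k_def[abs_def]
    by (intro continuous_intros continuous_on_subset[OF smooth_on_imp_continuous_on K(2)] smooth_on_lie
        open_U smooth_frame st)
  obtain \<kappa> where \<kappa>: "\<kappa> > 0" "\<And>z. z \<in> K \<Longrightarrow> \<kappa> \<le> k z"
    using continuous_attains_inf[OF K(1) False contk] kpos by metis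
  obtain C where C: "\<And>z. z \<in> K \<Longrightarrow> Lap t z \<le> C"
    using continuous_attains_sup[OF K(1) False
        continuous_on_subset[OF smooth_on_imp_continuous_on[OF smooth_Lap[OF st]] K(2)]] by metis
  \<comment> \<open>This choice makes \<open>m * \<kappa> = \<bar>C\<bar> + 1\<close>, which exceeds
    \<open>Lap t\<close> on \<open>K\<close>.\<close>
  define m where "m = (\<bar>C\<bar> + 1) / \<kappa>"
  have m: "m > 0" using \<kappa>(1) by (simp add: m_def)
  define \<rho> where "\<rho> z = exp (- m * t z)" for z
  have smt: "smooth_on U (\<lambda>z. - m * t z)" by (intro smooth_intros open_U st)
  have s\<rho>: "smooth_on U \<rho>" unfolding \<rho>_def[abs_def] by (intro smooth_on_exp open_U smt)
  have D\<rho>: "lie E \<rho> z = - m * (\<rho> z * lie E t z)" if "z \<in> U" for E z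
  proof -
    have "lie E \<rho> z = \<rho> z * lie E (\<lambda>z. - m * t z) z"
      using has_derivative_imp_lie[OF DERIV_compose_FDERIV[OF DERIV_exp
          smooth_on_imp_has_derivative[OF smt that]]]
      unfolding \<rho>_def[abs_def] lie_def by simp
    then show ?thesis
      using lie_linear[OF that bounded_linear_mult_right[of "-m"] st, of E] by simp
  qed
  have DD\<rho>: "lie E (lie E \<rho>) z = m * \<rho> z * (m * (lie E t z)\<^sup>2 - lie E (lie E t) z)"
    if z: "z \<in> U" and E: "smooth_on U E" for E z
  proof -
    have "lie E (lie E \<rho>) z = lie E (\<lambda>z. - m * (\<rho> z * lie E t z)) z"
      by (rule lie_cong[OF open_U z D\<rho>])
    also have "\<dots> = - m * lie E (\<lambda>z. \<rho> z * lie E t z) z"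
      by (rule lie_linear[OF z bounded_linear_mult_right])
        (intro smooth_intros open_U E s\<rho> st)
    finally show ?thesis
      by (simp add: lie_mult[OF z s\<rho> smooth_on_lie[OF open_U E st]] D\<rho>[OF z] power2_eq_square algebra_simps)
  qed
  have L\<rho>: "Lap \<rho> z = m * \<rho> z * (m * k z - Lap t z)" if "z \<in> U" for z
    unfolding Lap_def k_def DD\<rho>[OF that smooth_frame(1)] DD\<rho>[OF that smooth_frame(2)] D\<rho>[OF that]
    by (simp add: algebra_simps)
  have pos: "Lap \<rho> z > 0" if "z \<in> K" for z
  proof -
    have "m * k z \<ge> m * \<kappa>" using \<kappa>(2)[OF that] m by simp
    moreover have "m * \<kappa> = \<bar>C\<bar> + 1" using \<kappa>(1) by (simp add: m_def)
    ultimately have "m * k z - Lap t z > 0" using C[OF that] by linarith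
    then show ?thesis using L\<rho> K(2) that m by (auto simp: \<rho>_def)
  qed
  obtain w where w: "w \<in> K" "\<And>z. z \<in> K \<Longrightarrow> Lap \<rho> w \<le> Lap \<rho> z"
    using continuous_attains_inf[OF K(1) False
        continuous_on_subset[OF smooth_on_imp_continuous_on[OF smooth_Lap[OF s\<rho>]] K(2)]] by metis
  show ?thesis
    by (rule that[OF m pos[OF w(1)]]) (use w(2) in \<open>simp add: \<rho>_def[abs_def] t_def\<close>)
qed

text \<open>A maximum-principle version of weak unique continuation: on an annulus around the zero ball
  the function \<open>ln (c1\<^sup>2 + c2\<^sup>2) + N \<rho>\<close> has positive Laplacian once \<open>N\<close> is large, so
  it is bounded by its values on the outer circle, and \<open>N \<rightarrow> \<infinity>\<close> forces \<open>c1 = c2 = 0\<close>.\<close>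

lemma unique_continuation:
  assumes r: "0 < r0" "r0 < r1" "cball z0 r1 \<subseteq> U"
    and c: "smooth_on U c1" "smooth_on U c2"
    and eq1: "\<And>u. u \<in> U \<Longrightarrow> lie E1 c1 u + lie E2 c2 u = 2 * \<omega>1 u * c2 u - 2 * \<omega>2 u * c1 u"
    and eq2: "\<And>u. u \<in> U \<Longrightarrow> lie E2 c1 u - lie E1 c2 u = 2 * \<omega>1 u * c1 u + 2 * \<omega>2 u * c2 u"
    and zero: "\<And>z. z \<in> ball z0 r0 \<Longrightarrow> c1 z = 0 \<and> c2 z = 0"
    and z: "z \<in> ball z0 r1"
  shows "c1 z = 0 \<and> c2 z = 0"
proof -
  define s where "s z = c1 z * c1 z + c2 z * c2 z" for z
  have s0: "s z \<ge> 0" for z by (simp add: s_def)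
  have ss: "smooth_on U s" unfolding s_def[abs_def]
    by (intro smooth_intros open_U c)
  \<comment> \<open>The inner radius is \<open>r0 / 2\<close>, so that a neighbourhood of the inner
    circle lies in the zero ball and no positive maximum can sit there.\<close>
  define K where "K = cball z0 r1 - ball z0 (r0 / 2)"
  have K: "compact K" "K \<subseteq> U" "z0 \<notin> K" using r by (auto simp: K_def compact_diff)
  obtain m \<delta> where m: "m > 0" "\<delta> > 0"
    "\<And>z. z \<in> K \<Longrightarrow> Lap (\<lambda>z. exp (- m * ((z - z0) \<bullet> (z - z0)))) z \<ge> \<delta>"
    using barrier[OF K] by blast
  define \<rho> where "\<rho> z = exp (- m * ((z - z0) \<bullet> (z - z0)))" for z
  have L\<rho>: "Lap \<rho> z \<ge> \<delta>" if "z \<in> K" for z using m(3)[OF that] by (simp add: \<rho>_def[abs_def])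
  have s\<rho>: "smooth_on U \<rho>" unfolding \<rho>_def[abs_def]
    by (intro smooth_on_exp smooth_on_mult bounded_bilinear.smooth_on[OF bounded_bilinear_inner]
        smooth_on_diff smooth_on_ident smooth_on_const open_U)
  define \<rho>1 where "\<rho>1 = exp (- m * r1\<^sup>2)"
  have \<rho>dist: "\<rho> z = exp (- m * (dist z0 z)\<^sup>2)" for z
    by (simp add: \<rho>_def dist_norm norm_minus_commute[of z0] power2_norm_eq_inner)
  \<comment> \<open>Four times the Gauss curvature of the metric given by the frame; only its lower
    bound on \<open>K\<close> enters.\<close>
  define G where "G z = - 4 * (\<omega>1 z * \<omega>1 z + \<omega>2 z * \<omega>2 z + lie E1 \<omega>2 z - lie E2 \<omega>1 z)" for z
  have contG: "continuous_on K G" unfolding G_def[abs_def]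
    by (intro continuous_intros continuous_on_subset[OF smooth_on_imp_continuous_on K(2)] smooth_on_lie
        open_U smooth_frame smooth_\<omega>)
  have ext: "z0 + r1 *\<^sub>R axis 1 1 \<in> K"
    using r by (auto simp: K_def dist_norm norm_axis_1)
  then have ne: "K \<noteq> {}" by auto
  obtain C where C: "\<And>z. z \<in> K \<Longrightarrow> C \<le> G z"
    using continuous_attains_inf[OF K(1) ne contG] by metis
  have conts: "continuous_on K s"
    by (rule continuous_on_subset[OF smooth_on_imp_continuous_on[OF ss] K(2)])
  obtain B where B: "\<And>z. z \<in> K \<Longrightarrow> s z \<le> B"
    using continuous_attains_sup[OF K(1) ne conts] by metis
  have B0: "B \<ge> 0" using B[OF ext] s0 order_trans by blast
  \<comment> \<open>The exponential of the comparison function is continuous across the zeros of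
    \<open>s\<close>, so its maximum over \<open>K\<close> exists; logarithms are taken only near a
    maximum point with \<open>s > 0\<close>.\<close>
  have main: "s z * exp (N * \<rho> z) \<le> B * exp (N * \<rho>1)" if N: "N > 0" "N * \<delta> + C > 0" and z: "z \<in> K" for N z
  proof -
    have "continuous_on K (\<lambda>z. s z * exp (N * \<rho> z))"
      by (intro continuous_intros conts continuous_on_subset[OF smooth_on_imp_continuous_on[OF s\<rho>] K(2)])
    then obtain w where w: "w \<in> K" "\<And>z. z \<in> K \<Longrightarrow> s z * exp (N * \<rho> z) \<le> s w * exp (N * \<rho> w)"
      using continuous_attains_sup[OF K(1) ne] by blast
    consider "s w = 0" | "s w > 0" "dist z0 w = r1" | "s w > 0" "dist z0 w < r1"
      using s0[of w] w(1) by (force simp: K_def)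
    then have "s w * exp (N * \<rho> w) \<le> B * exp (N * \<rho>1)"
    proof cases
      case 1
      then show ?thesis using B0 by simp
    next
      case 2
      then have "\<rho> w = \<rho>1" by (simp add: \<rho>dist \<rho>1_def)
      then show ?thesis using B[OF w(1)] by simp
    next
      case 3
      have "r0 \<le> dist z0 w" using zero[of w] 3(1) by (force simp: s_def)
      define V where "V = (ball z0 r1 - cball z0 (r0 / 2)) \<inter> {z \<in> U. s z \<in> {0<..}}"
      have "open {z \<in> U. s z \<in> {0<..}}"
        using continuous_open_preimage[OF smooth_on_imp_continuous_on[OF ss] open_U, of "{0<..}"]
        by (simp add: vimage_def Int_def)
      then have "open V" unfolding V_def by (intro open_Int open_Diff open_ball closed_cball)
      have V: "V \<subseteq> U" "V \<subseteq> K" "w \<in> V"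
        using 3 r \<open>r0 \<le> dist z0 w\<close> w(1) K(2) by (auto simp: V_def K_def)
      have spos: "s z > 0" if "z \<in> V" for z using that by (simp add: V_def)
      define \<phi> where "\<phi> z = ln (s z) + N * \<rho> z" for z
      have sln: "smooth_on V (\<lambda>z. ln (s z))"
        by (intro smooth_on_ln \<open>open V\<close> smooth_on_subset[OF ss V(1)] spos)
      have sN\<rho>: "smooth_on V (\<lambda>z. N * \<rho> z)"
        by (intro smooth_intros \<open>open V\<close> smooth_on_subset[OF s\<rho> V(1)])
      have "smooth_on V \<phi>" unfolding \<phi>_def[abs_def]
        by (intro smooth_on_add sln sN\<rho> \<open>open V\<close>)
      moreover have "\<phi> y \<le> \<phi> w" if "y \<in> V" for y
      proof -
        have "ln (s y * exp (N * \<rho> y)) \<le> ln (s w * exp (N * \<rho> w))"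
          using w(2)[of y] that V spos by (subst ln_le_cancel_iff) auto
        then show ?thesis using spos[OF that] spos[OF V(3)] by (simp add: \<phi>_def ln_mult)
      qed
      ultimately have "Lap \<phi> w \<le> 0" by (intro Lap_nonpos_at_max[OF \<open>open V\<close> V(1,3)])
      moreover have "Lap \<phi> w = Lap (\<lambda>z. ln (s z)) w + N * Lap \<rho> w"
      proof -
        interpret V: moving_frame V E1 E2 \<omega>1 \<omega>2 by (rule moving_frame_subset[OF \<open>open V\<close> V(1)])
        have 1: "lie E \<phi> z = lie E (\<lambda>z. ln (s z)) z + N * lie E \<rho> z" if "z \<in> V" for E z
          unfolding \<phi>_def[abs_def] lie_add[OF that sln sN\<rho>]
          using lie_linear[OF that bounded_linear_mult_right[of N] smooth_on_subset[OF s\<rho> V(1)]] by simp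
        have 2: "lie E (lie E \<phi>) w = lie E (lie E (\<lambda>z. ln (s z))) w + N * lie E (lie E \<rho>) w"
          if E: "smooth_on V E" for E
        proof -
          note sl = smooth_on_lie[OF \<open>open V\<close> E]
          note s\<rho>V = sl[OF smooth_on_subset[OF s\<rho> V(1)]]
          have "lie E (lie E \<phi>) w = lie E (\<lambda>z. lie E (\<lambda>z. ln (s z)) z + N * lie E \<rho> z) w"
            by (rule lie_cong[OF \<open>open V\<close> V(3) 1])
          also have "\<dots> = lie E (\<lambda>z. lie E (\<lambda>z. ln (s z)) z) w + lie E (\<lambda>z. N * lie E \<rho> z) w"
            by (rule lie_add[OF V(3)]) (intro sl sln smooth_intros \<open>open V\<close> s\<rho>V)+
          finally show ?thesis
            using lie_linear[OF V(3) bounded_linear_mult_right[of N] s\<rho>V] by simp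
        qed
        show ?thesis
          unfolding Lap_def 1[OF V(3)] 2[OF V.smooth_frame(1)] 2[OF V.smooth_frame(2)]
          by (simp add: algebra_simps)
      qed
      moreover have "Lap (\<lambda>z. ln (s z)) w = G w"
        unfolding s_def G_def
        by (rule Lap_ln_norm[OF \<open>open V\<close> V(1,3) c eq1 eq2]) (use spos in \<open>auto simp: s_def\<close>)
      moreover have "N * Lap \<rho> w \<ge> N * \<delta>" using L\<rho>[OF w(1)] N(1) by simp
      ultimately have False using C[OF w(1)] N(2) by linarith
      then show ?thesis ..
    qed
    with w(2)[OF z] show ?thesis by linarith
  qed
  show ?thesis
  proof (cases "dist z0 z < r0")
    case True
    then show ?thesis using zero by simp
  next
    case False
    then have zK: "z \<in> K" using z r by (auto simp: K_def)
    have "\<rho> z > \<rho>1"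
      using z m(1) by (simp add: \<rho>dist \<rho>1_def power_strict_mono)
    define d where "d = \<rho> z - \<rho>1"
    have d: "d > 0" using \<open>\<rho> z > \<rho>1\<close> by (simp add: d_def)
    have "s z = 0"
    proof (rule ccontr)
      assume "s z \<noteq> 0"
      then have sz: "s z > 0" using s0[of z] by linarith
      \<comment> \<open>The first summand beats \<open>C\<close> in \<open>N * \<delta> + C\<close>,
        the second makes \<open>s z * (N * d)\<close> reach \<open>B\<close>; since
        \<open>exp y > y\<close>, this contradicts \<open>s z * exp (N * d) \<le> B\<close>.\<close>
      define N where "N = \<bar>C\<bar> / \<delta> + B / (s z * d) + 1"
      have N: "N > 0" "N * \<delta> + C > 0"
      proof -
        show "N > 0" unfolding N_def using m(2) B0 sz d by (intro add_nonneg_pos add_nonneg_nonneg) auto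
        have "N * \<delta> = \<bar>C\<bar> + B / (s z * d) * \<delta> + \<delta>" using m(2) by (simp add: N_def algebra_simps)
        moreover have "B / (s z * d) * \<delta> \<ge> 0" using m(2) B0 sz d by simp
        ultimately show "N * \<delta> + C > 0" using m(2) by linarith
      qed
      have "s z * exp (N * d) \<le> B"
      proof -
        have "exp (N * \<rho> z) = exp (N * d) * exp (N * \<rho>1)"
          by (simp add: d_def algebra_simps flip: exp_add)
        then have "(s z * exp (N * d)) * exp (N * \<rho>1) \<le> B * exp (N * \<rho>1)"
          using main[OF N zK] by (simp only: mult.assoc)
        then show ?thesis by (rule mult_right_le_imp_le) simp
      qed
      moreover have "exp (N * d) > N * d" using exp_ge_add_one_self[of "N * d"] by linarith
      then have "s z * exp (N * d) > s z * (N * d)" using sz by simp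
      moreover have "s z * (N * d) \<ge> B"
      proof -
        have "N \<ge> B / (s z * d)" unfolding N_def using m(2) by simp
        then have "N * (s z * d) \<ge> B" using sz d by (simp add: pos_divide_le_eq)
        then show ?thesis by (simp add: algebra_simps)
      qed
      ultimately show False by linarith
    qed
    then show ?thesis unfolding s_def by (simp add: sum_squares_eq_zero_iff)
  qed
qed

end

section \<open>Normal frames and the Gauss map\<close>

text \<open>The coefficient of the 4-vector \<open>V \<and> W\<close>, in the shape of the Laplace
  expansion of a determinant along its first two rows; only entries above the diagonal are
  read.\<close>

definition wedge_pairing :: "real^4^4 \<Rightarrow> real^4^4 \<Rightarrow> real" where
  "wedge_pairing V W = V$1$2 * W$3$4 - V$1$3 * W$2$4 + V$1$4 * W$2$3
     + V$2$3 * W$1$4 - V$2$4 * W$1$3 + V$3$4 * W$1$2"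

lemma det_4:
  fixes A :: "real^4^4"
  shows "det A = wedge_pairing (wedge (A$1) (A$2)) (wedge (A$3) (A$4))"
proof -
  have f: "finite {2::4, 3, 4}" "1 \<notin> {2::4, 3, 4}" "finite {3::4, 4}" "2 \<notin> {3::4, 4}"
    "finite {4::4}" "3 \<notin> {4::4}" by auto
  show ?thesis
    unfolding det_def UNIV_4
    unfolding sum_over_permutations_insert[OF f(1,2)]
    unfolding sum_over_permutations_insert[OF f(3,4)]
    unfolding sum_over_permutations_insert[OF f(5,6)]
    unfolding permutes_sing
    by (simp add: sign_swap_id permutation_swap_id permutation_compose sign_compose sign_id
        swap_id_eq wedge_pairing_def wedge_def algebra_simps)
qed

lemma wedge_combination:
  "wedge (x *\<^sub>R a + y *\<^sub>R b) (z *\<^sub>R a + t *\<^sub>R b) = (x * t - y * z) *\<^sub>R wedge a b"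
  by (simp add: wedge_def vec_eq_iff algebra_simps)

lemma wedge_pairing_scaleR:
  "wedge_pairing (x *\<^sub>R V) (y *\<^sub>R W) = x * y * wedge_pairing V W"
  by (simp add: wedge_pairing_def algebra_simps)

text \<open>The vector dual to \<open>w \<mapsto> det (a, b, w, axis 1 1)\<close> with respect to the Minkowski
  product; it is the cross product of the spatial parts of \<open>a\<close> and \<open>b\<close>, up to sign.\<close>

definition spatial_cross :: "real^4 \<Rightarrow> real^4 \<Rightarrow> real^4" where
  "spatial_cross a b = (- wedge a b$3$4) *\<^sub>R axis 2 1 + wedge a b$2$4 *\<^sub>R axis 3 1
     + (- wedge a b$2$3) *\<^sub>R axis 4 1"

lemma spatial_cross_nth:
  "spatial_cross a b $ 1 = 0" "spatial_cross a b $ 2 = - wedge a b$3$4"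
  "spatial_cross a b $ 3 = wedge a b$2$4" "spatial_cross a b $ 4 = - wedge a b$2$3"
  by (simp_all add: spatial_cross_def axis_def)

lemma mink_spatial_cross:
  "mink (spatial_cross a b) w = wedge_pairing (wedge a b) (wedge w (axis 1 1))"
  by (simp add: mink_def spatial_cross_nth wedge_pairing_def wedge_def axis_def algebra_simps)

lemma mink_spatial_cross_orthogonal:
  "mink (spatial_cross a b) a = 0" "mink (spatial_cross a b) b = 0" "mink (spatial_cross a b) (axis 1 1) = 0"
  by (simp_all add: mink_def spatial_cross_nth wedge_def axis_def algebra_simps)

text \<open>Lagrange's identity for the cross product of the spatial parts, whose Euclidean product
  is \<open>mink\<close> plus the product of the time components.\<close>

lemma mink_spatial_cross_self:
  "mink (spatial_cross a b) (spatial_cross a b)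
    = (mink a a + (a$1)\<^sup>2) * (mink b b + (b$1)\<^sup>2) - (mink a b + a$1 * b$1)\<^sup>2"
  by (simp add: mink_def spatial_cross_nth wedge_def power2_eq_square algebra_simps)

lemma wedge_pairing_degenerate:
  "wedge_pairing (wedge a b) (wedge w a) = 0" "wedge_pairing (wedge a b) (wedge w b) = 0"
  by (simp_all add: wedge_pairing_def wedge_def algebra_simps)

lemma wedge_pairing_add_right: "wedge_pairing V (W + W') = wedge_pairing V W + wedge_pairing V W'"
  by (simp add: wedge_pairing_def algebra_simps)

lemma wedge_pairing_scaleR_right: "wedge_pairing V (x *\<^sub>R W) = x * wedge_pairing V W"
  by (simp add: wedge_pairing_def algebra_simps)

lemma pseudo_orthonormal_expansion:
  fixes e :: "4 \<Rightarrow> real^4"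
  assumes orth: "\<And>i j. i \<noteq> j \<Longrightarrow> mink (e i) (e j) = 0" and unit: "\<And>i. \<bar>mink (e i) (e i)\<bar> = 1"
    and det: "det (\<chi> i. e i) \<noteq> 0"
  shows "w = (\<Sum>i\<in>UNIV. (mink (e i) (e i) * mink w (e i)) *\<^sub>R e i)"
proof -
  define v where "v = w - (\<Sum>i\<in>UNIV. (mink (e i) (e i) * mink w (e i)) *\<^sub>R e i)"
  have v: "mink v (e j) = 0" for j
  proof -
    have "mink (\<Sum>i\<in>UNIV. (mink (e i) (e i) * mink w (e i)) *\<^sub>R e i) (e j)
      = (\<Sum>i\<in>UNIV. if i = j then mink w (e j) * (mink (e j) (e j) * mink (e j) (e j)) else 0)"
      unfolding mink.sum_left
      by (intro sum.cong) (auto simp: mink.scaleR_left orth)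
    also have "\<dots> = mink w (e j)"
    proof -
      have "mink (e j) (e j) = 1 \<or> mink (e j) (e j) = -1" using unit[of j] by linarith
      then show ?thesis by (subst sum.delta) auto
    qed
    finally show ?thesis by (simp add: v_def mink.diff_left)
  qed
  \<comment> \<open>Flipping the sign of the time component turns \<open>mink\<close> into the
    Euclidean product, so orthogonality to all \<open>e i\<close> becomes a kernel condition for an
    invertible matrix.\<close>
  define v' :: "real^4" where "v' = (\<chi> i. if i = 1 then - v$1 else v$i)"
  have "(\<chi> i. e i) *v v' = 0"
    using v by (simp add: vec_eq_iff matrix_vector_mult_def sum_4 v'_def mink_def algebra_simps)
  moreover have "invertible (\<chi> i. e i)" using det by (simp add: invertible_det_nz)
  ultimately have "v' = 0"
    by (metis invertible_def matrix_left_invertible_ker)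
  then have "v = 0" by (auto simp: v'_def vec4_eq_iff)
  then show ?thesis by (simp add: v_def)
qed


context spacelike_patch
begin

text \<open>The time-like normal is the normalized normal part of the first basis vector; the
  space-like one is its partner given by \<open>spatial_cross\<close>.\<close>

lemma adapted_frame:
  obtains E1 E2 n3 n4 where "smooth_on U E1" "smooth_on U E2" "smooth_on U n3" "smooth_on U n4"
    "\<And>u. u \<in> U \<Longrightarrow> orthonormal_at X u (E1 u) (E2 u)"
    "\<And>u. u \<in> U \<Longrightarrow> det (vector [E1 u, E2 u] :: real^2^2) > 0"
    "\<And>u. u \<in> U \<Longrightarrow> mink (n3 u) (n3 u) = 1 \<and> mink (n4 u) (n4 u) = -1 \<and> mink (n3 u) (n4 u) = 0"
    "\<And>u a. u \<in> U \<Longrightarrow> mink (n3 u) (push X u a) = 0 \<and> mink (n4 u) (push X u a) = 0"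
    "\<And>u. u \<in> U \<Longrightarrow> wedge_pairing (wedge (push X u (E1 u)) (push X u (E2 u))) (wedge (n3 u) (n4 u)) > 0"
proof -
  obtain E1 E2 where E: "smooth_on U E1" "smooth_on U E2"
    and orth: "\<And>u. u \<in> U \<Longrightarrow> orthonormal_at X u (E1 u) (E2 u)"
    and det: "\<And>u. u \<in> U \<Longrightarrow> det (vector [E1 u, E2 u] :: real^2^2) > 0"
    using orthonormal_frame by metis
  define e1 e2 where "e1 u = push X u (E1 u)" and "e2 u = push X u (E2 u)" for u
  have se: "smooth_on U e1" "smooth_on U e2"
    unfolding e1_def[abs_def] e2_def[abs_def] by (intro smooth_push E)+
  have m: "mink (e1 u) (e1 u) = 1" "mink (e2 u) (e2 u) = 1" "mink (e1 u) (e2 u) = 0" "mink (e2 u) (e1 u) = 0"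
    if "u \<in> U" for u
    using mink_frame[OF that orth[OF that]] by (auto simp: e1_def e2_def)
  define \<tau> where "\<tau> u = sqrt (1 + (e1 u$1)\<^sup>2 + (e2 u$1)\<^sup>2)" for u
  have \<tau>pos: "1 + (e1 u$1)\<^sup>2 + (e2 u$1)\<^sup>2 > 0" for u by (simp add: add_pos_nonneg)
  have \<tau>: "\<tau> u > 0" "\<tau> u * \<tau> u = 1 + (e1 u$1)\<^sup>2 + (e2 u$1)\<^sup>2" for u
    using \<tau>pos[of u] by (auto simp: \<tau>_def)
  have s\<tau>: "smooth_on U \<tau>"
    unfolding \<tau>_def[abs_def] power2_eq_square
    by (intro smooth_on_sqrt smooth_intros smooth_on_vec_nth open_U se)
      (use \<tau>pos in \<open>simp add: power2_eq_square\<close>)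
  \<comment> \<open>The normal part of the first basis vector; the plus signs come from
    \<open>mink (axis 1 1) w = - (w$1)\<close>.\<close>
  define t where "t u = axis 1 1 + (e1 u$1) *\<^sub>R e1 u + (e2 u$1) *\<^sub>R e2 u" for u
  have ax: "mink (axis 1 1) w = - (w$1)" for w by (simp add: mink_def axis_def)
  have te: "mink (t u) (e1 u) = 0" "mink (t u) (e2 u) = 0" if "u \<in> U" for u
    using m[OF that] by (simp_all add: t_def mink.add_left mink.scaleR_left ax)
  have tt: "mink (t u) (t u) = - (\<tau> u * \<tau> u)" if u: "u \<in> U" for u
  proof -
    have "mink (t u) (t u) = mink (t u) (axis 1 1)"
      by (subst (2) t_def) (simp add: mink.add_right mink.scaleR_right te[OF u])
    also have "\<dots> = - (\<tau> u * \<tau> u)"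
      unfolding \<tau>(2) by (simp add: mink_commute[of "t u"] ax) (simp add: t_def power2_eq_square axis_def)
    finally show ?thesis .
  qed
  have tang: "mink w (push X u a) = 0" if "u \<in> U" "mink w (e1 u) = 0" "mink w (e2 u) = 0" for w u a
    by (subst push_expansion[OF that(1) orth[OF that(1)], of a])
      (use that in \<open>simp add: mink.add_right mink.scaleR_right e1_def e2_def\<close>)
  define N where "N u = spatial_cross (e1 u) (e2 u)" for u
  define n3 n4 where "n3 u = (1 / \<tau> u) *\<^sub>R N u" and "n4 u = (1 / \<tau> u) *\<^sub>R t u" for u
  have sN: "smooth_on U N" unfolding N_def[abs_def] spatial_cross_def
    by (intro smooth_intros open_U
        smooth_on_vec_nth smooth_on_wedge se)
  have st: "smooth_on U t" unfolding t_def[abs_def]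
    by (intro smooth_intros open_U smooth_on_vec_nth se)
  have "smooth_on U n3" "smooth_on U n4" unfolding n3_def[abs_def] n4_def[abs_def]
    using \<tau>(1) by (intro smooth_intros open_U s\<tau> sN st; simp add: less_imp_neq[symmetric])+
  moreover have NN: "mink (N u) (N u) = \<tau> u * \<tau> u" if "u \<in> U" for u
    unfolding N_def mink_spatial_cross_self \<tau>(2) by (simp add: m[OF that] power2_eq_square algebra_simps)
  have Nt: "mink (N u) (t u) = 0" for u
    by (simp add: t_def N_def mink.add_right mink.scaleR_right mink_spatial_cross_orthogonal)
  have "mink (n3 u) (n3 u) = 1 \<and> mink (n4 u) (n4 u) = -1 \<and> mink (n3 u) (n4 u) = 0" if "u \<in> U" for u
    using NN[OF that] tt[OF that] Nt[of u] \<tau>(1)[of u]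
    by (simp add: n3_def n4_def mink.scaleR_left mink.scaleR_right)
  moreover have "mink (n3 u) (push X u a) = 0 \<and> mink (n4 u) (push X u a) = 0" if u: "u \<in> U" for u a
    using tang[OF u te[OF u]] tang[OF u, of "N u"]
    by (simp add: n3_def n4_def mink.scaleR_left N_def mink_spatial_cross_orthogonal)
  moreover have "wedge_pairing (wedge (push X u (E1 u)) (push X u (E2 u))) (wedge (n3 u) (n4 u)) > 0"
    if u: "u \<in> U" for u
  proof -
    \<comment> \<open>The tangential terms of \<open>t\<close> drop out of the pairing, and the rest
      is the defining property of \<open>spatial_cross\<close>; this settles the
      orientation.\<close>
    have "wedge_pairing (wedge (e1 u) (e2 u)) (wedge (N u) (t u)) = mink (N u) (N u)"
      by (simp add: t_def wedge.add_right wedge.scaleR_right wedge_pairing_add_right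
          wedge_pairing_scaleR_right wedge_pairing_degenerate mink_spatial_cross[symmetric])
         (simp add: N_def)
    then have "wedge_pairing (wedge (e1 u) (e2 u)) (wedge (N u) (t u)) > 0"
      using NN[OF u] \<tau>(1)[of u] by simp
    then show ?thesis using \<tau>(1)[of u]
      by (simp add: n3_def n4_def wedge.scaleR_left wedge.scaleR_right wedge_pairing_scaleR_right
          e1_def[symmetric] e2_def[symmetric])
  qed
  ultimately show thesis using that[OF E _ _ orth det] by blast
qed

text \<open>Any other adapted frame multiplies \<open>n3 \<and> n4\<close> by the determinant
  \<open>k\<close> of the change of normal basis. Comparing Gram determinants gives
  \<open>k * k = 1\<close>, and the two orientation conditions make \<open>k\<close>
  positive.\<close>

lemma gauss_map_eq:
  assumes u: "u \<in> U" and orth: "orthonormal_at X u a b"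
    and det: "det (vector [a, b] :: real^2^2) > 0"
    and n: "mink n3 n3 = 1" "mink n4 n4 = -1" "mink n3 n4 = 0"
    and nX: "\<And>c. mink n3 (push X u c) = 0" "\<And>c. mink n4 (push X u c) = 0"
    and pos: "wedge_pairing (wedge (push X u a) (push X u b)) (wedge n3 n4) > 0"
  shows "gauss_map X u = wedge n3 n4"
    and "w = mink w (push X u a) *\<^sub>R push X u a + mink w (push X u b) *\<^sub>R push X u b
      + mink w n3 *\<^sub>R n3 - mink w n4 *\<^sub>R n4"
proof -
  interpret push: linear "push X u" by (rule linear_push[OF u])
  define e1 e2 where "e1 = push X u a" and "e2 = push X u b"
  define e :: "4 \<Rightarrow> real^4" where "e i = (if i = 1 then e1 else if i = 2 then e2 else if i = 3 then n3 else n4)" for i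
  have e: "e 1 = e1" "e 2 = e2" "e 3 = n3" "e 4 = n4" by (simp_all add: e_def)
  have nX': "mink (push X u c) n3 = 0" "mink (push X u c) n4 = 0" for c
    using nX mink_commute by metis+
  note mm = mink_frame[OF u orth] n nX nX' mink_commute[of n4 n3]
  have deto: "det (\<chi> i. e i) > 0" using pos by (simp add: det_4 e e1_def e2_def)
  have eo: "\<forall>i j. i \<noteq> j \<longrightarrow> mink (e i) (e j) = 0" "\<forall>i. \<bar>mink (e i) (e i)\<bar> = 1"
    by (simp_all add: forall_4 e e1_def e2_def mm)
  have exp: "w = mink w e1 *\<^sub>R e1 + mink w e2 *\<^sub>R e2 + mink w n3 *\<^sub>R n3 - mink w n4 *\<^sub>R n4" for w
    using pseudo_orthonormal_expansion[of e w] eo deto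
    by (simp add: sum_4 e) (simp add: e1_def e2_def mm)
  then show "w = mink w (push X u a) *\<^sub>R push X u a + mink w (push X u b) *\<^sub>R push X u b
      + mink w n3 *\<^sub>R n3 - mink w n4 *\<^sub>R n4" unfolding e1_def e2_def .
  show "gauss_map X u = wedge n3 n4"
    unfolding gauss_map_def
  proof (rule the_equality)
    show "\<exists>e. adapted_frame_at X u e \<and> wedge n3 n4 = wedge (e 3) (e 4)"
      using eo deto det unfolding adapted_frame_at_def
      by (intro exI[of _ e]) (auto simp: e e1_def e2_def)
    fix W assume "\<exists>e. adapted_frame_at X u e \<and> W = wedge (e 3) (e 4)"
    then obtain f where f: "adapted_frame_at X u f" and W: "W = wedge (f 3) (f 4)" by blast
    from f obtain c d where cd: "f 1 = push X u c" "f 2 = push X u d" "det (vector [c, d] :: real^2^2) > 0"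
      by (auto simp: adapted_frame_at_def)
    have fo: "i \<noteq> j \<Longrightarrow> mink (f i) (f j) = 0" "\<bar>mink (f i) (f i)\<bar> = 1" and fdet: "det (\<chi> i. f i) > 0" for i j
      using f by (auto simp: adapted_frame_at_def)
    have "mink (f 1) (f 1) = 1" "mink (f 2) (f 2) = 1"
      using fo(2)[of 1] fo(2)[of 2] mink_push_pos[OF u, of c] mink_push_pos[OF u, of d]
      by (auto simp: cd push.zero mink.zero_left) (metis abs_of_pos mink.zero_left push.zero zero_neq_one abs_zero)+
    then have cdo: "orthonormal_at X u c d"
      using fo(1)[of 1 2] by (simp add: orthonormal_at_def cd)
    have fn: "mink (f i) e1 = 0" "mink (f i) e2 = 0" if "i = 3 \<or> i = 4" for i
    proof -
      have "mink (f i) (f 1) = 0" "mink (f i) (f 2) = 0" using fo(1) that by auto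
      then have "mink (f i) (push X u v) = 0" for v
        by (subst push_expansion[OF u cdo, of v]) (simp add: cd mink.add_right mink.scaleR_right)
      then show "mink (f i) e1 = 0" "mink (f i) e2 = 0" by (simp_all add: e1_def e2_def)
    qed
    define p q r s where "p = mink (f 3) n3" and "q = - mink (f 3) n4" and "r = mink (f 4) n3" and "s = - mink (f 4) n4"
    have f3: "f 3 = p *\<^sub>R n3 + q *\<^sub>R n4" and f4: "f 4 = r *\<^sub>R n3 + s *\<^sub>R n4"
      using exp[of "f 3"] exp[of "f 4"] fn by (simp_all add: p_def q_def r_def s_def)
    define k where "k = p * s - q * r"
    have w34: "wedge (f 3) (f 4) = k *\<^sub>R wedge n3 n4" unfolding f3 f4 k_def by (rule wedge_combination)
    have g: "mink (f 3) (f 3) = p * p - q * q" "mink (f 4) (f 4) = r * r - s * s" "mink (f 3) (f 4) = p * r - q * s"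
      unfolding f3 f4 by (simp_all add: mink_simps mm)
    have "(mink (f 3) (f 3)) * (mink (f 4) (f 4)) = (mink (f 3) (f 4)) * (mink (f 3) (f 4)) - k * k"
      unfolding g k_def by (simp add: algebra_simps)
    then have "k * k = 1"
    proof -
      assume *: "(mink (f 3) (f 3)) * (mink (f 4) (f 4)) = (mink (f 3) (f 4)) * (mink (f 3) (f 4)) - k * k"
      have "\<bar>k * k\<bar> = \<bar>mink (f 3) (f 3)\<bar> * \<bar>mink (f 4) (f 4)\<bar>"
        using * fo(1)[of 3 4] by (simp flip: abs_mult)
      then show ?thesis by (simp add: fo(2))
    qed
    define x y z t where "x = mink (f 1) e1" and "y = mink (f 1) e2" and "z = mink (f 2) e1" and "t = mink (f 2) e2"
    have c: "c = x *\<^sub>R a + y *\<^sub>R b" and d: "d = z *\<^sub>R a + t *\<^sub>R b"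
      unfolding x_def y_def z_def t_def cd e1_def e2_def by (rule orthonormal_expansion[OF u orth])+
    have f1: "f 1 = x *\<^sub>R e1 + y *\<^sub>R e2" and f2: "f 2 = z *\<^sub>R e1 + t *\<^sub>R e2"
      unfolding cd c d e1_def e2_def by (simp_all add: push.add push.scale)
    have "det (vector [c, d] :: real^2^2) = (x * t - y * z) * det (vector [a, b] :: real^2^2)"
      unfolding c d by (simp add: det_2 algebra_simps)
    then have xt: "x * t - y * z > 0" using cd(3) det by (simp add: zero_less_mult_iff)
    have "det (\<chi> i. f i) = ((x * t - y * z) * k) * det (\<chi> i. e i)"
    proof -
      have "wedge (f 1) (f 2) = (x * t - y * z) *\<^sub>R wedge e1 e2" unfolding f1 f2 by (rule wedge_combination)
      then show ?thesis by (simp add: det_4 e w34 wedge_pairing_scaleR)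
    qed
    then have "(x * t - y * z) * k > 0" using fdet deto by (simp add: zero_less_mult_iff)
    then have "k > 0" using xt by (simp add: zero_less_mult_iff)
    then have "k = 1" using \<open>k * k = 1\<close> by (metis abs_of_pos abs_square_eq_1 power2_eq_square)
    then show "W = wedge n3 n4" by (simp add: W w34)
  qed
qed

end

section \<open>Structure equations\<close>

locale orthonormal_patch = spacelike_patch +
  fixes E1 E2
  assumes smooth_E: "smooth_on U E1" "smooth_on U E2"
    and orthonormal: "\<And>u. u \<in> U \<Longrightarrow> orthonormal_at X u (E1 u) (E2 u)"
begin

definition "e1 u = push X u (E1 u)"
definition "e2 u = push X u (E2 u)"
text \<open>The connection form of the frame; the ambient derivative may replace the covariant one
  because their difference is normal and so orthogonal to \<open>e2\<close>.\<close>

definition "\<omega>1 u = mink (lie E1 e1 u) (e2 u)"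
definition "\<omega>2 u = mink (lie E2 e1 u) (e2 u)"
definition "h11 \<nu> u = mink (lie E1 e1 u) (\<nu> u)" for \<nu> :: "real^2 \<Rightarrow> real^4"
definition "h12 \<nu> u = mink (lie E1 e2 u) (\<nu> u)" for \<nu> :: "real^2 \<Rightarrow> real^4"
definition "h22 \<nu> u = mink (lie E2 e2 u) (\<nu> u)" for \<nu> :: "real^2 \<Rightarrow> real^4"

lemma e_eq_lie: "e1 = lie E1 X" "e2 = lie E2 X"
  by (simp_all add: e1_def[abs_def] e2_def[abs_def] lie_def[abs_def])

lemma smooth_e: "smooth_on U e1" "smooth_on U e2"
  unfolding e_eq_lie by (intro smooth_on_lie open_U smooth_E smooth_X)+

lemma smooth_coeffs:
  "smooth_on U \<omega>1" "smooth_on U \<omega>2"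
  "smooth_on U \<nu> \<Longrightarrow> smooth_on U (h11 \<nu>)" "smooth_on U \<nu> \<Longrightarrow> smooth_on U (h12 \<nu>)"
  "smooth_on U \<nu> \<Longrightarrow> smooth_on U (h22 \<nu>)"
  unfolding \<omega>1_def[abs_def] \<omega>2_def[abs_def] h11_def[abs_def] h12_def[abs_def] h22_def[abs_def]
  by (intro smooth_intros open_U smooth_E smooth_e; assumption)+

lemma lie_mink:
  assumes "u \<in> U" "smooth_on U f" "smooth_on U g"
  shows "lie V (\<lambda>z. mink (f z) (g z)) u = mink (lie V f u) (g u) + mink (f u) (lie V g u)"
  by (rule lie_bilinear[OF assms(1) bounded_bilinear_mink assms(2,3)])

lemma lie_mink_const:
  assumes "u \<in> U" "smooth_on U f" "smooth_on U g" "\<And>z. z \<in> U \<Longrightarrow> mink (f z) (g z) = c"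
  shows "mink (lie V f u) (g u) = - mink (lie V g u) (f u)"
proof -
  have "lie V (\<lambda>z. mink (f z) (g z)) u = lie V (\<lambda>z. c) u"
    by (rule lie_cong[OF open_U assms(1,4)])
  then show ?thesis
    using lie_mink[OF assms(1-3), of V] mink_commute[of "f u"] by simp
qed

lemma lie_lie_component:
  assumes "u \<in> U" "smooth_on U f" "smooth_on U g" "smooth_on U W"
    "\<And>z. z \<in> U \<Longrightarrow> mink (lie W f z) (g z) = k z"
  shows "mink (lie V (lie W f) u) (g u) = lie V k u - mink (lie W f u) (lie V g u)"
proof -
  have "lie V (\<lambda>z. mink (lie W f z) (g z)) u = lie V k u"
    by (rule lie_cong[OF open_U assms(1,5)])
  then show ?thesis
    using lie_mink[OF assms(1) smooth_on_lie[OF open_U assms(4,2)] assms(3), of V] by simp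
qed

context
  fixes u assumes u: "u \<in> U"
begin

lemma mink_e: "mink (e1 u) (e1 u) = 1" "mink (e2 u) (e2 u) = 1"
  "mink (e1 u) (e2 u) = 0" "mink (e2 u) (e1 u) = 0"
  using mink_frame[OF u orthonormal[OF u]] by (simp_all add: e1_def e2_def)

lemma push_eq: "push X u c = mink (push X u c) (e1 u) *\<^sub>R e1 u + mink (push X u c) (e2 u) *\<^sub>R e2 u"
  unfolding e1_def e2_def by (rule push_expansion[OF u orthonormal[OF u]])

end

context
  fixes u assumes u: "u \<in> U"
begin

lemma lie_e_tangential:
  "mink (lie V e1 u) (e1 u) = 0" "mink (lie V e2 u) (e2 u) = 0"
  "mink (lie V e2 u) (e1 u) = - mink (lie V e1 u) (e2 u)"
  using lie_mink_const[OF u smooth_e(1) smooth_e(1) mink_e(1), of V]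
    lie_mink_const[OF u smooth_e(2) smooth_e(2) mink_e(2), of V]
    lie_mink_const[OF u smooth_e(2) smooth_e(1) mink_e(4), of V]
  by simp_all

text \<open>Equality of mixed derivatives makes the difference of the derivatives of
  \<open>e2\<close> and \<open>e1\<close> the push of a bracket, hence tangent, and its components
  follow from differentiating the orthonormality relations. Injectivity of the push carries the
  identity back to coordinates.\<close>

lemma lie_bracket: "lie E1 E2 u - lie E2 E1 u = - \<omega>1 u *\<^sub>R E1 u - \<omega>2 u *\<^sub>R E2 u"
  and lie_e_symmetric: "lie E1 e2 u - lie E2 e1 u = - \<omega>1 u *\<^sub>R e1 u - \<omega>2 u *\<^sub>R e2 u"
proof -
  interpret push: linear "push X u" by (rule linear_push[OF u])
  have eq: "lie E1 e2 u - lie E2 e1 u = push X u (lie E1 E2 u - lie E2 E1 u)"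
    unfolding e_eq_lie by (rule lie_commutator[OF open_U u smooth_X smooth_E])
  then have "lie E1 e2 u - lie E2 e1 u
    = mink (lie E1 e2 u - lie E2 e1 u) (e1 u) *\<^sub>R e1 u + mink (lie E1 e2 u - lie E2 e1 u) (e2 u) *\<^sub>R e2 u"
    using push_eq[OF u] by metis
  also have "\<dots> = - \<omega>1 u *\<^sub>R e1 u - \<omega>2 u *\<^sub>R e2 u"
    by (simp add: mink.diff_left lie_e_tangential \<omega>1_def \<omega>2_def)
  finally show *: "lie E1 e2 u - lie E2 e1 u = - \<omega>1 u *\<^sub>R e1 u - \<omega>2 u *\<^sub>R e2 u" .
  have "push X u (lie E1 E2 u - lie E2 E1 u) = push X u (- \<omega>1 u *\<^sub>R E1 u - \<omega>2 u *\<^sub>R E2 u)"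
    unfolding eq[symmetric] * by (simp add: push.diff push.scale push.neg e1_def e2_def)
  then show "lie E1 E2 u - lie E2 E1 u = - \<omega>1 u *\<^sub>R E1 u - \<omega>2 u *\<^sub>R E2 u"
    using inj_push[OF u] by (auto simp: inj_def)
qed

end

sublocale moving_frame U E1 E2 \<omega>1 \<omega>2
proof
  fix u v assume u: "u \<in> U" and v: "v \<bullet> E1 u = 0" "v \<bullet> E2 u = 0"
  obtain r s where "v = r *\<^sub>R E1 u + s *\<^sub>R E2 u"
    using orthonormal_expansion[OF u orthonormal[OF u]] by metis
  then have "v \<bullet> v = 0" using v by (metis inner_add_right inner_scaleR_right add_0 mult_zero_right)
  then show "v = 0" by simp
qed (use open_U smooth_E smooth_coeffs lie_bracket in auto)

lemma conn_frame: "u \<in> U \<Longrightarrow> conn X E1 E1 u = \<omega>1 u *\<^sub>R E2 u" "u \<in> U \<Longrightarrow> conn X E2 E2 u = - \<omega>2 u *\<^sub>R E1 u"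
proof -
  assume u: "u \<in> U"
  have "flat_conn X E1 E1 u = lie E1 e1 u" "flat_conn X E2 E2 u = lie E2 e2 u"
    by (simp_all add: flat_conn_def lie_def e1_def[abs_def] e2_def[abs_def])
  then show "conn X E1 E1 u = \<omega>1 u *\<^sub>R E2 u" "conn X E2 E2 u = - \<omega>2 u *\<^sub>R E1 u"
    using lie_e_tangential[OF u]
    by (simp_all add: conn_eq[OF u] tangential_coord_eq[OF u orthonormal[OF u]] e1_def[symmetric] e2_def[symmetric] \<omega>1_def \<omega>2_def)
qed

lemma laplacian_eq_frame:
  assumes u: "u \<in> U" and F: "smooth_on U F"
  shows "laplacian X F u = \<omega>1 u *\<^sub>R lie E2 F u - \<omega>2 u *\<^sub>R lie E1 F u
    - lie E1 (lie E1 F) u - lie E2 (lie E2 F) u"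
proof -
  interpret F: linear "push F u"
    by (rule linear_frechet_derivative[OF smooth_on_imp_differentiable[OF F u]])
  have "push F u (- \<omega>2 u *\<^sub>R E1 u) = - \<omega>2 u *\<^sub>R lie E1 F u" "push F u (\<omega>1 u *\<^sub>R E2 u) = \<omega>1 u *\<^sub>R lie E2 F u"
    unfolding F.scale lie_def by simp_all
  then show ?thesis
    using laplacian_eq_lie[OF u F smooth_E orthonormal[OF u]] by (simp add: conn_frame[OF u])
qed

lemma mean_curvature_mink:
  assumes u: "u \<in> U" and \<nu>: "\<And>c. mink (\<nu> u) (push X u c) = 0"
  shows "mink (mean_curvature X u) (\<nu> u) = (h11 \<nu> u + h22 \<nu> u) / 2"
proof -
  have np: "mink (normal_part X u w) (\<nu> u) = mink w (\<nu> u)" for w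
    using \<nu> by (simp add: normal_part_def tangential_part_eq[OF u orthonormal[OF u]] mink_simps mink_commute[of _ "\<nu> u"])
  have d: "E1 differentiable at u" "E2 differentiable at u"
    using smooth_E smooth_on_imp_differentiable u by blast+
  have "hess_normal X u (E1 u) (E1 u) = normal_part X u (lie E1 e1 u)"
    using second_ff_eq[OF u d(1), of E1] second_ff_eq_normal_part[OF u, of E1 E1]
    by (simp add: flat_conn_def lie_def e1_def[abs_def])
  moreover have "hess_normal X u (E2 u) (E2 u) = normal_part X u (lie E2 e2 u)"
    using second_ff_eq[OF u d(2), of E2] second_ff_eq_normal_part[OF u, of E2 E2]
    by (simp add: flat_conn_def lie_def e2_def[abs_def])
  ultimately show ?thesis
    by (simp add: mean_curvature_eq[OF u orthonormal[OF u]] mink.scaleR_left mink.add_left np h11_def h22_def)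
qed

lemma mean_curvature_normal: "u \<in> U \<Longrightarrow> mink (mean_curvature X u) (push X u c) = 0"
  using orthonormal[of u]
  by (simp add: mean_curvature_eq hess_normal_def mink.scaleR_left mink.add_left mink_normal_part)

context
  fixes \<nu> and u
  assumes \<nu>: "smooth_on U \<nu>" "\<And>z c. z \<in> U \<Longrightarrow> mink (\<nu> z) (push X z c) = 0" and u: "u \<in> U"
begin

lemma mink_e_normal:
  "mink (e1 u) (\<nu> u) = 0" "mink (e2 u) (\<nu> u) = 0" "mink (\<nu> u) (e1 u) = 0" "mink (\<nu> u) (e2 u) = 0"
  using \<nu>(2)[OF u] by (simp_all add: e1_def e2_def mink_commute)

text \<open>Symmetry of the second fundamental form: the bracket term is tangent and has no product
  with \<nu>.\<close>

lemma mink_lie_e: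
  "mink (lie E1 e1 u) (\<nu> u) = h11 \<nu> u" "mink (lie E1 e2 u) (\<nu> u) = h12 \<nu> u"
  "mink (lie E2 e1 u) (\<nu> u) = h12 \<nu> u" "mink (lie E2 e2 u) (\<nu> u) = h22 \<nu> u"
proof -
  have "mink (lie E1 e2 u - lie E2 e1 u) (\<nu> u) = 0"
    unfolding lie_e_symmetric[OF u] by (simp add: mink_simps mink_e_normal)
  then show "mink (lie E2 e1 u) (\<nu> u) = h12 \<nu> u" by (simp add: mink.diff_left h12_def)
qed (simp_all add: h11_def h12_def h22_def)

end

context
  fixes \<nu> and u
  assumes \<nu>: "smooth_on U \<nu>" "\<And>z c. z \<in> U \<Longrightarrow> mink (\<nu> z) (push X z c) = 0" and u: "u \<in> U"
begin

lemma mink_lie_normal: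
  "mink (lie E1 \<nu> u) (e1 u) = - h11 \<nu> u" "mink (lie E1 \<nu> u) (e2 u) = - h12 \<nu> u"
  "mink (lie E2 \<nu> u) (e1 u) = - h12 \<nu> u" "mink (lie E2 \<nu> u) (e2 u) = - h22 \<nu> u"
  using lie_mink_const[OF u \<nu>(1) smooth_e(1) mink_e_normal(3)[OF \<nu>]]
    lie_mink_const[OF u \<nu>(1) smooth_e(2) mink_e_normal(4)[OF \<nu>]] mink_lie_e[OF \<nu> u]
  by simp_all

end

text \<open>Since the ambient space is flat, second derivatives of \<nu> commute up to the bracket;
  the \<open>e1\<close> and \<open>e2\<close> components of this are the two equations.
  \<open>D1\<close>, \<open>D2\<close> ask that the normal derivative of \<nu> be a multiple of
  \<nu>, as happens for null normals and for parallel ones.\<close>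

lemma codazzi:
  assumes \<nu>: "smooth_on U \<nu>" "\<And>z c. z \<in> U \<Longrightarrow> mink (\<nu> z) (push X z c) = 0" and u: "u \<in> U"
    and D1: "lie E1 \<nu> u = - h11 \<nu> u *\<^sub>R e1 u - h12 \<nu> u *\<^sub>R e2 u + t1 *\<^sub>R \<nu> u"
    and D2: "lie E2 \<nu> u = - h12 \<nu> u *\<^sub>R e1 u - h22 \<nu> u *\<^sub>R e2 u + t2 *\<^sub>R \<nu> u"
  shows "lie E2 (h11 \<nu>) u - lie E1 (h12 \<nu>) u
      = \<omega>1 u * (h11 \<nu> u - h22 \<nu> u) + 2 * \<omega>2 u * h12 \<nu> u + t2 * h11 \<nu> u - t1 * h12 \<nu> u"
    and "lie E2 (h12 \<nu>) u - lie E1 (h22 \<nu>) u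
      = 2 * \<omega>1 u * h12 \<nu> u + \<omega>2 u * (h22 \<nu> u - h11 \<nu> u) + t2 * h12 \<nu> u - t1 * h22 \<nu> u"
proof -
  note s = \<nu>(1) smooth_e smooth_E
  note neg = lie_minus[OF u smooth_coeffs(3)[OF \<nu>(1)]] lie_minus[OF u smooth_coeffs(4)[OF \<nu>(1)]]
    lie_minus[OF u smooth_coeffs(5)[OF \<nu>(1)]]
  note sim = mink_simps mink_commute[of "e1 u" "lie _ _ u"]
    mink_commute[of "e2 u" "lie _ _ u"] mink_commute[of "\<nu> u" "lie _ _ u"] lie_e_tangential[OF u]
    mink_lie_e[OF \<nu> u] mink_lie_normal[OF \<nu> u] neg \<omega>1_def[symmetric] \<omega>2_def[symmetric]
  have a: "mink (lie E1 (lie E2 \<nu>) u) (e1 u) = - lie E1 (h12 \<nu>) u - mink (lie E2 \<nu> u) (lie E1 e1 u)"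
    using lie_lie_component[OF u s(1,2) s(5) mink_lie_normal(3)[OF \<nu>], of E1] by (simp add: neg)
  have b: "mink (lie E2 (lie E1 \<nu>) u) (e1 u) = - lie E2 (h11 \<nu>) u - mink (lie E1 \<nu> u) (lie E2 e1 u)"
    using lie_lie_component[OF u s(1,2) s(4) mink_lie_normal(1)[OF \<nu>], of E2] by (simp add: neg)
  have c: "mink (lie E1 (lie E2 \<nu>) u) (e2 u) = - lie E1 (h22 \<nu>) u - mink (lie E2 \<nu> u) (lie E1 e2 u)"
    using lie_lie_component[OF u s(1,3) s(5) mink_lie_normal(4)[OF \<nu>], of E1] by (simp add: neg)
  have d: "mink (lie E2 (lie E1 \<nu>) u) (e2 u) = - lie E2 (h12 \<nu>) u - mink (lie E1 \<nu> u) (lie E2 e2 u)"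
    using lie_lie_component[OF u s(1,3) s(4) mink_lie_normal(2)[OF \<nu>], of E2] by (simp add: neg)
  have com: "mink (lie E1 (lie E2 \<nu>) u) v - mink (lie E2 (lie E1 \<nu>) u) v
      = - \<omega>1 u * mink (lie E1 \<nu> u) v - \<omega>2 u * mink (lie E2 \<nu> u) v" for v
    using arg_cong[OF commutator[OF u \<nu>(1)], of "\<lambda>x. mink x v"] by (simp add: mink_simps)
  have r: "mink (lie E2 \<nu> u) (lie E1 e1 u) = - h22 \<nu> u * \<omega>1 u + t2 * h11 \<nu> u"
    "mink (lie E1 \<nu> u) (lie E2 e1 u) = - h12 \<nu> u * \<omega>2 u + t1 * h12 \<nu> u"
    "mink (lie E2 \<nu> u) (lie E1 e2 u) = h12 \<nu> u * \<omega>1 u + t2 * h12 \<nu> u"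
    "mink (lie E1 \<nu> u) (lie E2 e2 u) = h11 \<nu> u * \<omega>2 u + t1 * h22 \<nu> u"
    unfolding D1 D2 by (simp_all add: sim)
  show "lie E2 (h11 \<nu>) u - lie E1 (h12 \<nu>) u
      = \<omega>1 u * (h11 \<nu> u - h22 \<nu> u) + 2 * \<omega>2 u * h12 \<nu> u + t2 * h11 \<nu> u - t1 * h12 \<nu> u"
    using a b com[of "e1 u"] r by (simp add: mink_lie_normal[OF \<nu> u] algebra_simps)
  show "lie E2 (h12 \<nu>) u - lie E1 (h22 \<nu>) u
      = 2 * \<omega>1 u * h12 \<nu> u + \<omega>2 u * (h22 \<nu> u - h11 \<nu> u) + t2 * h12 \<nu> u - t1 * h22 \<nu> u"
    using c d com[of "e2 u"] r by (simp add: mink_lie_normal[OF \<nu> u] algebra_simps)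
qed

end

section \<open>Null frames and the Laplacian of the Gauss map\<close>

definition wedge_eval :: "real^4^4 \<Rightarrow> real^4 \<Rightarrow> real^4 \<Rightarrow> real" where
  "wedge_eval W v w = mink (\<chi> i. mink (W$i) v) w"

text \<open>Minus the inner product of \<open>a \<and> b\<close> with \<open>v \<and> w\<close>;
  evaluation on frame vectors thus reads off coefficients of a bivector.\<close>

lemma wedge_eval_wedge: "wedge_eval (wedge a b) v w = mink a w * mink b v - mink a v * mink b w"
  by (simp add: wedge_eval_def wedge_def mink_def algebra_simps)

lemma wedge_eval_linear:
  "wedge_eval (V + W) v w = wedge_eval V v w + wedge_eval W v w"
  "wedge_eval (V - W) v w = wedge_eval V v w - wedge_eval W v w"
  "wedge_eval (c *\<^sub>R W) v w = c * wedge_eval W v w"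
  "wedge_eval (- W) v w = - wedge_eval W v w"
  by (simp_all add: wedge_eval_def mink_def algebra_simps)

text \<open>In a null frame the two normal connection forms reduce to one, and the normalization
  makes \<open>l\<close> the component of the mean curvature vector \<open>H = l + P n\<close> along its null line.\<close>

locale null_frame = orthonormal_patch +
  fixes l n
  assumes smooth_ln: "smooth_on U l" "smooth_on U n"
    and normal: "\<And>u c. u \<in> U \<Longrightarrow> mink (l u) (push X u c) = 0" "\<And>u c. u \<in> U \<Longrightarrow> mink (n u) (push X u c) = 0"
    and null: "\<And>u. u \<in> U \<Longrightarrow> mink (l u) (l u) = 0" "\<And>u. u \<in> U \<Longrightarrow> mink (n u) (n u) = 0"
      "\<And>u. u \<in> U \<Longrightarrow> mink (l u) (n u) = 1"
    and expansion: "\<And>u w. u \<in> U \<Longrightarrow> w = mink w (e1 u) *\<^sub>R e1 u + mink w (e2 u) *\<^sub>R e2 u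
      + mink w (n u) *\<^sub>R l u + mink w (l u) *\<^sub>R n u"
    and gauss: "\<And>u. u \<in> U \<Longrightarrow> gauss_map X u = wedge (n u) (l u)"
    and mean_curvature_n: "\<And>u. u \<in> U \<Longrightarrow> mink (mean_curvature X u) (n u) = 1"
begin

definition "t1 u = mink (lie E1 l u) (n u)"
definition "t2 u = mink (lie E2 l u) (n u)"
definition "P u = (h11 l u + h22 l u) / 2"

lemma smooth_P: "smooth_on U P"
  unfolding P_def[abs_def]
  by (intro smooth_intros smooth_coeffs smooth_ln smooth_on_const open_U) simp

lemma smooth_t: "smooth_on U t1" "smooth_on U t2"
  unfolding t1_def[abs_def] t2_def[abs_def]
  by (intro smooth_intros open_U smooth_E smooth_ln)+

lemma trace_n: "u \<in> U \<Longrightarrow> h11 n u + h22 n u = 2"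
  using mean_curvature_mink[of u n] mean_curvature_n[of u] normal(2) by simp

lemma mean_curvature_l: "u \<in> U \<Longrightarrow> mink (mean_curvature X u) (l u) = P u"
  using mean_curvature_mink[of u l] normal(1) by (simp add: P_def)

lemma mean_curvature_frame: "u \<in> U \<Longrightarrow> mean_curvature X u = l u + P u *\<^sub>R n u"
  using expansion[of u "mean_curvature X u"]
  by (simp add: mean_curvature_normal e1_def e2_def mean_curvature_l mean_curvature_n)

text \<open>So \<open>H\<close> is non-null iff \<open>P\<close> is non-zero, and constant mean
  curvature means constant \<open>P\<close>.\<close>

lemma mink_mean_curvature: "u \<in> U \<Longrightarrow> mink (mean_curvature X u) (mean_curvature X u) = 2 * P u"
  using null[of u] mink_commute[of "n u" "l u"]
  by (simp add: mean_curvature_frame mink_simps)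

context
  fixes u assumes u: "u \<in> U"
begin

lemma mink_ln:
  "mink (l u) (l u) = 0" "mink (n u) (n u) = 0" "mink (l u) (n u) = 1" "mink (n u) (l u) = 1"
  "mink (e1 u) (l u) = 0" "mink (e2 u) (l u) = 0" "mink (e1 u) (n u) = 0" "mink (e2 u) (n u) = 0"
  "mink (l u) (e1 u) = 0" "mink (l u) (e2 u) = 0" "mink (n u) (e1 u) = 0" "mink (n u) (e2 u) = 0"
  using null[OF u] mink_commute[of "n u" "l u"] mink_e_normal[OF smooth_ln(1) normal(1) u]
    mink_e_normal[OF smooth_ln(2) normal(2) u] by simp_all

end

context
  fixes u assumes u: "u \<in> U"
begin

lemma lie_e:
  "lie E1 e1 u = \<omega>1 u *\<^sub>R e2 u + h11 n u *\<^sub>R l u + h11 l u *\<^sub>R n u"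
  "lie E2 e1 u = \<omega>2 u *\<^sub>R e2 u + h12 n u *\<^sub>R l u + h12 l u *\<^sub>R n u"
  "lie E1 e2 u = - \<omega>1 u *\<^sub>R e1 u + h12 n u *\<^sub>R l u + h12 l u *\<^sub>R n u"
  "lie E2 e2 u = - \<omega>2 u *\<^sub>R e1 u + h22 n u *\<^sub>R l u + h22 l u *\<^sub>R n u"
proof -
  note sim = lie_e_tangential[OF u] mink_lie_e[OF smooth_ln(1) normal(1) u]
    mink_lie_e[OF smooth_ln(2) normal(2) u] \<omega>1_def[symmetric] \<omega>2_def[symmetric]
  show "lie E1 e1 u = \<omega>1 u *\<^sub>R e2 u + h11 n u *\<^sub>R l u + h11 l u *\<^sub>R n u"
    using expansion[OF u, of "lie E1 e1 u"] by (simp add: sim)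
  show "lie E2 e1 u = \<omega>2 u *\<^sub>R e2 u + h12 n u *\<^sub>R l u + h12 l u *\<^sub>R n u"
    using expansion[OF u, of "lie E2 e1 u"] by (simp add: sim)
  show "lie E1 e2 u = - \<omega>1 u *\<^sub>R e1 u + h12 n u *\<^sub>R l u + h12 l u *\<^sub>R n u"
    using expansion[OF u, of "lie E1 e2 u"] by (simp add: sim)
  show "lie E2 e2 u = - \<omega>2 u *\<^sub>R e1 u + h22 n u *\<^sub>R l u + h22 l u *\<^sub>R n u"
    using expansion[OF u, of "lie E2 e2 u"] by (simp add: sim)
qed

text \<open>Differentiating \<open>\<langle>l, l\<rangle> = 0\<close> removes the \<open>n\<close>
  component, so the normal derivative of \<open>l\<close> stays on its null line.\<close>

lemma lie_l:
  "lie E1 l u = - h11 l u *\<^sub>R e1 u - h12 l u *\<^sub>R e2 u + t1 u *\<^sub>R l u"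
  "lie E2 l u = - h12 l u *\<^sub>R e1 u - h22 l u *\<^sub>R e2 u + t2 u *\<^sub>R l u"
proof -
  have "mink (lie V l u) (l u) = 0" for V
    using lie_mink_const[OF u smooth_ln(1) smooth_ln(1) mink_ln(1), of V] by simp
  then show "lie E1 l u = - h11 l u *\<^sub>R e1 u - h12 l u *\<^sub>R e2 u + t1 u *\<^sub>R l u"
    "lie E2 l u = - h12 l u *\<^sub>R e1 u - h22 l u *\<^sub>R e2 u + t2 u *\<^sub>R l u"
    using expansion[OF u, of "lie E1 l u"] expansion[OF u, of "lie E2 l u"]
    by (simp_all add: mink_lie_normal[OF smooth_ln(1) normal(1) u] t1_def t2_def)
qed

lemma lie_n:
  "lie E1 n u = - h11 n u *\<^sub>R e1 u - h12 n u *\<^sub>R e2 u + (- t1 u) *\<^sub>R n u"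
  "lie E2 n u = - h12 n u *\<^sub>R e1 u - h22 n u *\<^sub>R e2 u + (- t2 u) *\<^sub>R n u"
proof -
  have "mink (lie V n u) (n u) = 0" "mink (lie V n u) (l u) = - mink (lie V l u) (n u)" for V
    using lie_mink_const[OF u smooth_ln(2) smooth_ln(2) mink_ln(2), of V]
      lie_mink_const[OF u smooth_ln(2) smooth_ln(1) mink_ln(4), of V] by simp_all
  then show "lie E1 n u = - h11 n u *\<^sub>R e1 u - h12 n u *\<^sub>R e2 u + (- t1 u) *\<^sub>R n u"
    "lie E2 n u = - h12 n u *\<^sub>R e1 u - h22 n u *\<^sub>R e2 u + (- t2 u) *\<^sub>R n u"
    using expansion[OF u, of "lie E1 n u"] expansion[OF u, of "lie E2 n u"]
    by (simp_all add: mink_lie_normal[OF smooth_ln(2) normal(2) u] t1_def t2_def)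
qed

end

text \<open>The direction is arbitrary so that the formula serves for \<open>E1\<close> and
  \<open>E2\<close>: \<open>a1\<close>, \<open>a2\<close> and \<open>b1\<close>, \<open>b2\<close>
  are the rows of the shape operators of \<open>l\<close> and \<open>n\<close> in that direction,
  \<open>t\<close> and \<open>w\<close> the normal and tangential connection forms.\<close>

lemma lie_lie_wedge:
  assumes u: "u \<in> U" and V: "smooth_on U V"
    and s: "smooth_on U a1" "smooth_on U a2" "smooth_on U b1" "smooth_on U b2"
    and l: "\<And>z. z \<in> U \<Longrightarrow> lie V l z = - a1 z *\<^sub>R e1 z - a2 z *\<^sub>R e2 z + t z *\<^sub>R l z"
    and n: "\<And>z. z \<in> U \<Longrightarrow> lie V n z = - b1 z *\<^sub>R e1 z - b2 z *\<^sub>R e2 z + (- t z) *\<^sub>R n z"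
    and e1: "\<And>z. z \<in> U \<Longrightarrow> lie V e1 z = w z *\<^sub>R e2 z + b1 z *\<^sub>R l z + a1 z *\<^sub>R n z"
    and e2: "\<And>z. z \<in> U \<Longrightarrow> lie V e2 z = - w z *\<^sub>R e1 z + b2 z *\<^sub>R l z + a2 z *\<^sub>R n z"
  shows "lie V (\<lambda>z. wedge (n z) (l z)) u = (a1 u *\<^sub>R wedge (e1 u) (n u) + a2 u *\<^sub>R wedge (e2 u) (n u))
       - (b1 u *\<^sub>R wedge (e1 u) (l u) + b2 u *\<^sub>R wedge (e2 u) (l u))"
    and "lie V (lie V (\<lambda>z. wedge (n z) (l z))) u =
      (lie V a1 u - a1 u * t u - a2 u * w u) *\<^sub>R wedge (e1 u) (n u)
      + (lie V a2 u - a2 u * t u + a1 u * w u) *\<^sub>R wedge (e2 u) (n u)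
      - (lie V b1 u + b1 u * t u - b2 u * w u) *\<^sub>R wedge (e1 u) (l u)
      - (lie V b2 u + b2 u * t u + b1 u * w u) *\<^sub>R wedge (e2 u) (l u)
      - (2 * (a1 u * b1 u + a2 u * b2 u)) *\<^sub>R wedge (n u) (l u)
      - (2 * (a1 u * b2 u - a2 u * b1 u)) *\<^sub>R wedge (e1 u) (e2 u)"
    (is "_ = ?R")
proof -
  \<comment> \<open>\<open>algebra_simps\<close> produces \<open>2 * W\<close>, the componentwise
    product of matrices; it has to be read as a scalar multiple.\<close>
  have two: "2 * W = 2 *\<^sub>R W" for W :: "real^4^4" by (simp add: vec_eq_iff)
  note bil = wedge.add_left wedge.add_right wedge.diff_left wedge.diff_right wedge.scaleR_left
    wedge.scaleR_right wedge.minus_left wedge.minus_right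
  note comm = wedge_commute[of "n _" "e1 _"] wedge_commute[of "n _" "e2 _"] wedge_commute[of "l _" "e1 _"]
    wedge_commute[of "l _" "e2 _"] wedge_commute[of "e2 _" "e1 _"] wedge_commute[of "l _" "n _"]
  note lw = lie_bilinear[OF _ bounded_bilinear_wedge]
  note sw = smooth_on_wedge[OF open_U smooth_e(1) smooth_ln(2)] smooth_on_wedge[OF open_U smooth_e(2) smooth_ln(2)]
    smooth_on_wedge[OF open_U smooth_e(1) smooth_ln(1)] smooth_on_wedge[OF open_U smooth_e(2) smooth_ln(1)]
  note S = smooth_on_scaleR[OF open_U s(1) sw(1)] smooth_on_scaleR[OF open_U s(2) sw(2)]
    smooth_on_scaleR[OF open_U s(3) sw(3)] smooth_on_scaleR[OF open_U s(4) sw(4)]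
  have 1: "lie V (\<lambda>z. wedge (n z) (l z)) u = (a1 u *\<^sub>R wedge (e1 u) (n u) + a2 u *\<^sub>R wedge (e2 u) (n u))
       - (b1 u *\<^sub>R wedge (e1 u) (l u) + b2 u *\<^sub>R wedge (e2 u) (l u))" if u: "u \<in> U" for u
    unfolding lw[OF u smooth_ln(2,1)] l[OF u] n[OF u] by (simp add: bil comm)
  show "lie V (\<lambda>z. wedge (n z) (l z)) u = (a1 u *\<^sub>R wedge (e1 u) (n u) + a2 u *\<^sub>R wedge (e2 u) (n u))
       - (b1 u *\<^sub>R wedge (e1 u) (l u) + b2 u *\<^sub>R wedge (e2 u) (l u))"
    by (rule 1[OF u])
  have "lie V (lie V (\<lambda>z. wedge (n z) (l z))) u
      = lie V (\<lambda>z. (a1 z *\<^sub>R wedge (e1 z) (n z) + a2 z *\<^sub>R wedge (e2 z) (n z))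
        - (b1 z *\<^sub>R wedge (e1 z) (l z) + b2 z *\<^sub>R wedge (e2 z) (l z))) u"
    by (rule lie_cong[OF open_U u 1])
  also have "\<dots> = (lie V (\<lambda>z. a1 z *\<^sub>R wedge (e1 z) (n z)) u + lie V (\<lambda>z. a2 z *\<^sub>R wedge (e2 z) (n z)) u)
      - (lie V (\<lambda>z. b1 z *\<^sub>R wedge (e1 z) (l z)) u + lie V (\<lambda>z. b2 z *\<^sub>R wedge (e2 z) (l z)) u)"
    unfolding lie_diff[OF u smooth_on_add[OF open_U S(1,2)] smooth_on_add[OF open_U S(3,4)]]
      lie_add[OF u S(1,2)] lie_add[OF u S(3,4)] ..
  also have "\<dots> = (lie V a1 u *\<^sub>R wedge (e1 u) (n u) + a1 u *\<^sub>R (wedge (lie V e1 u) (n u) + wedge (e1 u) (lie V n u))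
      + (lie V a2 u *\<^sub>R wedge (e2 u) (n u) + a2 u *\<^sub>R (wedge (lie V e2 u) (n u) + wedge (e2 u) (lie V n u))))
      - (lie V b1 u *\<^sub>R wedge (e1 u) (l u) + b1 u *\<^sub>R (wedge (lie V e1 u) (l u) + wedge (e1 u) (lie V l u))
      + (lie V b2 u *\<^sub>R wedge (e2 u) (l u) + b2 u *\<^sub>R (wedge (lie V e2 u) (l u) + wedge (e2 u) (lie V l u))))"
    by (simp add: lie_scaleR[OF u s(1) sw(1)] lie_scaleR[OF u s(2) sw(2)] lie_scaleR[OF u s(3) sw(3)]
        lie_scaleR[OF u s(4) sw(4)] lw[OF u smooth_e(1) smooth_ln(2)] lw[OF u smooth_e(2) smooth_ln(2)]
        lw[OF u smooth_e(1) smooth_ln(1)] lw[OF u smooth_e(2) smooth_ln(1)])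
  also have "\<dots> = ?R"
    unfolding l[OF u] n[OF u] e1[OF u] e2[OF u]
    by (simp add: bil comm) (simp add: algebra_simps two)
  finally show "lie V (lie V (\<lambda>z. wedge (n z) (l z))) u = ?R" .
qed


lemma lie_P: "u \<in> U \<Longrightarrow> lie V P u = (lie V (h11 l) u + lie V (h22 l) u) / 2"
proof -
  assume u: "u \<in> U"
  note s = smooth_coeffs(3)[OF smooth_ln(1)] smooth_coeffs(5)[OF smooth_ln(1)]
  have "lie V P u = lie V (\<lambda>z. h11 l z + h22 l z) u / 2"
    unfolding P_def[abs_def]
    by (rule lie_linear[OF u bounded_linear_divide smooth_on_add[OF open_U s]])
  then show ?thesis by (simp add: lie_add[OF u s])
qed

lemma lie_trace_n: "u \<in> U \<Longrightarrow> lie V (h11 n) u + lie V (h22 n) u = 0"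
proof -
  assume u: "u \<in> U"
  note s = smooth_coeffs(3)[OF smooth_ln(2)] smooth_coeffs(5)[OF smooth_ln(2)]
  have "lie V (\<lambda>z. h11 n z + h22 n z) u = lie V (\<lambda>z. 2) u"
    by (rule lie_cong[OF open_U u trace_n])
  then show ?thesis by (simp add: lie_add[OF u s])
qed

text \<open>The off-diagonal entry of the commutator of the shape operators of \<open>l\<close> and
  \<open>n\<close>; by the Ricci equation it is, up to sign, the curvature of the normal
  bundle.\<close>

definition "normal_curvature u = h11 l u * h12 n u - h12 l u * h11 n u + h12 l u * h22 n u - h22 l u * h12 n u"

text \<open>The coefficients of the mixed bivectors contain divergences of shape operators, which
  Codazzi equates with the gradient of the trace plus connection terms. The trace for
  \<open>n\<close> is constantly 2, so next to \<open>l\<close> only \<open>t1\<close>,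
  \<open>t2\<close> survive.\<close>

lemma laplacian_gauss:
  assumes u: "u \<in> U"
  shows "laplacian X (gauss_map X) u =
    (2 * (P u * t1 u - lie E1 P u)) *\<^sub>R wedge (e1 u) (n u) + (2 * (P u * t2 u - lie E2 P u)) *\<^sub>R wedge (e2 u) (n u)
    + (2 * t1 u) *\<^sub>R wedge (e1 u) (l u) + (2 * t2 u) *\<^sub>R wedge (e2 u) (l u)
    + (2 * (h11 l u * h11 n u + 2 * (h12 l u * h12 n u) + h22 l u * h22 n u)) *\<^sub>R wedge (n u) (l u)
    + (2 * normal_curvature u) *\<^sub>R wedge (e1 u) (e2 u)"
    (is "_ = ?R")
proof -
  have two: "2 * W = 2 *\<^sub>R W" for W :: "real^4^4" by (simp add: vec_eq_iff)
  define G where "G z = wedge (n z) (l z)" for z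
  have sG: "smooth_on U G" unfolding G_def[abs_def] by (intro smooth_on_wedge open_U smooth_ln)
  note c = smooth_coeffs(3,4)[OF smooth_ln(1)] smooth_coeffs(3,4)[OF smooth_ln(2)]
  note d = smooth_coeffs(4,5)[OF smooth_ln(1)] smooth_coeffs(4,5)[OF smooth_ln(2)]
  note D1 = lie_lie_wedge[OF u smooth_E(1) c lie_l(1) lie_n(1) lie_e(1) lie_e(3)]
  note D2 = lie_lie_wedge[OF u smooth_E(2) d lie_l(2) lie_n(2) lie_e(2) lie_e(4)]
  note Cl = codazzi[OF smooth_ln(1) normal(1) u lie_l[OF u]]
  note Cn = codazzi[OF smooth_ln(2) normal(2) u lie_n[OF u]]
  have L: "lie E2 (h12 l) u = lie E1 (h22 l) u + 2 * \<omega>1 u * h12 l u + \<omega>2 u * (h22 l u - h11 l u) + t2 u * h12 l u - t1 u * h22 l u"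
    "lie E1 (h12 l) u = lie E2 (h11 l) u - (\<omega>1 u * (h11 l u - h22 l u) + 2 * \<omega>2 u * h12 l u + t2 u * h11 l u - t1 u * h12 l u)"
    using Cl by simp_all
  have N: "lie E2 (h12 n) u = lie E1 (h22 n) u + 2 * \<omega>1 u * h12 n u + \<omega>2 u * (h22 n u - h11 n u) - t2 u * h12 n u + t1 u * h22 n u"
    "lie E1 (h12 n) u = lie E2 (h11 n) u - (\<omega>1 u * (h11 n u - h22 n u) + 2 * \<omega>2 u * h12 n u - t2 u * h11 n u + t1 u * h12 n u)"
    using Cn by simp_all
  have tr: "lie V (h22 n) u = - lie V (h11 n) u" "h22 n u = 2 - h11 n u" for V
    using lie_trace_n[OF u, of V] trace_n[OF u] by linarith+
  have P: "P u = (h11 l u + h22 l u) / 2" by (simp add: P_def)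
  have "laplacian X (gauss_map X) u = laplacian X G u"
    by (rule laplacian_cong[OF open_U u]) (simp add: gauss G_def)
  also have "\<dots> = \<omega>1 u *\<^sub>R lie E2 G u - \<omega>2 u *\<^sub>R lie E1 G u - lie E1 (lie E1 G) u - lie E2 (lie E2 G) u"
    by (rule laplacian_eq_frame[OF u sG])
  also have "\<dots> = (\<omega>1 u * h12 l u - \<omega>2 u * h11 l u - (lie E1 (h11 l) u - h11 l u * t1 u - h12 l u * \<omega>1 u)
        - (lie E2 (h12 l) u - h12 l u * t2 u - h22 l u * \<omega>2 u)) *\<^sub>R wedge (e1 u) (n u)
    + (\<omega>1 u * h22 l u - \<omega>2 u * h12 l u - (lie E1 (h12 l) u - h12 l u * t1 u + h11 l u * \<omega>1 u)
        - (lie E2 (h22 l) u - h22 l u * t2 u + h12 l u * \<omega>2 u)) *\<^sub>R wedge (e2 u) (n u)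
    + (- \<omega>1 u * h12 n u + \<omega>2 u * h11 n u + (lie E1 (h11 n) u + h11 n u * t1 u - h12 n u * \<omega>1 u)
        + (lie E2 (h12 n) u + h12 n u * t2 u - h22 n u * \<omega>2 u)) *\<^sub>R wedge (e1 u) (l u)
    + (- \<omega>1 u * h22 n u + \<omega>2 u * h12 n u + (lie E1 (h12 n) u + h12 n u * t1 u + h11 n u * \<omega>1 u)
        + (lie E2 (h22 n) u + h22 n u * t2 u + h12 n u * \<omega>2 u)) *\<^sub>R wedge (e2 u) (l u)
    + (2 * (h11 l u * h11 n u + h12 l u * h12 n u) + 2 * (h12 l u * h12 n u + h22 l u * h22 n u)) *\<^sub>R wedge (n u) (l u)
    + (2 * (h11 l u * h12 n u - h12 l u * h11 n u) + 2 * (h12 l u * h22 n u - h22 l u * h12 n u)) *\<^sub>R wedge (e1 u) (e2 u)"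
    by (simp only: G_def[abs_def] D1 D2) (simp add: algebra_simps two)
  also have "\<dots> = ?R"
    by (intro arg_cong2[where f="(+)"] arg_cong2[where f="(*\<^sub>R)"] refl)
      (simp_all add: L N tr P lie_P[OF u] normal_curvature_def field_simps)
  finally show ?thesis .
qed

text \<open>Each coefficient is isolated by evaluating on two frame vectors. The coefficients next
  to \<open>l\<close> give \<open>t1 = t2 = 0\<close>; after that those next to \<open>n\<close>
  reduce to the derivatives of \<open>P\<close>.\<close>

lemma gauss_eigen_imp:
  assumes u: "u \<in> U" and eig: "laplacian X (gauss_map X) u = f *\<^sub>R gauss_map X u"
  shows "t1 u = 0" "t2 u = 0" "lie E1 P u = 0" "lie E2 P u = 0" "normal_curvature u = 0"
proof -
  have *: "wedge_eval (laplacian X (gauss_map X) u) v w = wedge_eval (f *\<^sub>R gauss_map X u) v w" for v w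
    using eig by simp
  note sim = laplacian_gauss[OF u] gauss[OF u] wedge_eval_linear wedge_eval_wedge mink_ln[OF u] mink_e[OF u]
  show t: "t1 u = 0" "t2 u = 0" "normal_curvature u = 0"
    using *[of "e1 u" "n u"] *[of "e2 u" "n u"] *[of "e1 u" "e2 u"] by (simp_all add: sim)
  show "lie E1 P u = 0" "lie E2 P u = 0"
    using *[of "e1 u" "l u"] *[of "e2 u" "l u"] by (simp_all add: sim t)
qed

text \<open>The Ricci equation: with \<open>l\<close> parallel the normal bundle is flat, and the
  \<open>n\<close> component of the commutator of derivatives of \<open>l\<close> is the commutator
  of the shape operators.\<close>

lemma normal_curvature_eq_0:
  assumes t: "\<And>z. z \<in> U \<Longrightarrow> t1 z = 0" "\<And>z. z \<in> U \<Longrightarrow> t2 z = 0" and u: "u \<in> U"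
  shows "normal_curvature u = 0"
proof -
  have a: "mink (lie E1 (lie E2 l) u) (n u) = - mink (lie E2 l u) (lie E1 n u)"
    using lie_lie_component[OF u smooth_ln smooth_E(2), of "\<lambda>z. 0" E1] t(2) by (simp add: t2_def)
  have b: "mink (lie E2 (lie E1 l) u) (n u) = - mink (lie E1 l u) (lie E2 n u)"
    using lie_lie_component[OF u smooth_ln smooth_E(1), of "\<lambda>z. 0" E2] t(1) by (simp add: t1_def)
  have "mink (lie E1 (lie E2 l) u) (n u) - mink (lie E2 (lie E1 l) u) (n u)
      = - \<omega>1 u * mink (lie E1 l u) (n u) - \<omega>2 u * mink (lie E2 l u) (n u)"
    using arg_cong[OF commutator[OF u smooth_ln(1)], of "\<lambda>x. mink x (n u)"]
    by (simp add: mink_simps)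
  also have "\<dots> = 0" using t u by (simp add: t1_def t2_def)
  finally show ?thesis
    unfolding a b lie_l[OF u] lie_n[OF u] using t u
    by (simp add: mink_simps mink_e[OF u] mink_ln[OF u] normal_curvature_def algebra_simps)
qed

lemma second_ff_norm2_frame:
  assumes u: "u \<in> U"
  shows "second_ff_norm2 X u = 2 * (h11 l u * h11 n u + 2 * (h12 l u * h12 n u) + h22 l u * h22 n u)"
proof -
  have d: "E1 differentiable at u" "E2 differentiable at u"
    using smooth_E smooth_on_imp_differentiable u by blast+
  have np: "normal_part X u w = mink w (n u) *\<^sub>R l u + mink w (l u) *\<^sub>R n u" for w
  proof -
    have "w = tangential_part X u w + (mink w (n u) *\<^sub>R l u + mink w (l u) *\<^sub>R n u)"
      using expansion[OF u, of w]
      unfolding tangential_part_eq[OF u orthonormal[OF u]] e1_def[symmetric] e2_def[symmetric] by (simp only: add.assoc)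
    then show ?thesis by (simp add: normal_part_def algebra_simps)
  qed
  have h: "hess_normal X u (W u) (V u) = normal_part X u (lie V (\<lambda>z. push X z (W z)) u)"
    if "W differentiable at u" for V W
    using second_ff_eq[OF u that, of V] second_ff_eq_normal_part[OF u, of V W]
    by (simp add: flat_conn_def lie_def)
  have H: "hess_normal X u (E1 u) (E1 u) = h11 n u *\<^sub>R l u + h11 l u *\<^sub>R n u"
    "hess_normal X u (E1 u) (E2 u) = h12 n u *\<^sub>R l u + h12 l u *\<^sub>R n u"
    "hess_normal X u (E2 u) (E1 u) = h12 n u *\<^sub>R l u + h12 l u *\<^sub>R n u"
    "hess_normal X u (E2 u) (E2 u) = h22 n u *\<^sub>R l u + h22 l u *\<^sub>R n u"
    unfolding h[OF d(1)] h[OF d(2)] np e1_def[abs_def, symmetric] e2_def[abs_def, symmetric]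
    by (simp_all add: mink_lie_e[OF smooth_ln(1) normal(1) u] mink_lie_e[OF smooth_ln(2) normal(2) u])
  show ?thesis
    unfolding second_ff_norm2_eq[OF u orthonormal[OF u]] H
    by (simp add: mink_simps mink_ln[OF u] algebra_simps)
qed

lemma gauss_eigen:
  assumes t: "\<And>z. z \<in> U \<Longrightarrow> t1 z = 0" "\<And>z. z \<in> U \<Longrightarrow> t2 z = 0"
    and P: "lie E1 P u = 0" "lie E2 P u = 0" and u: "u \<in> U"
  shows "laplacian X (gauss_map X) u = second_ff_norm2 X u *\<^sub>R gauss_map X u"
  by (simp add: laplacian_gauss[OF u] gauss[OF u] second_ff_norm2_frame[OF u] t u P normal_curvature_eq_0[OF t])

end

section \<open>Parallel mean curvature and level sets\<close>

text \<open>\<open>l0\<close>, \<open>n0\<close> span the null lines of the normal plane. If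
  \<open>Q = \<langle>H, n0\<rangle>\<close> were zero, \<open>H\<close> would be a multiple of the
  null vector \<open>n0\<close>. Scaling by \<open>Q\<close> and \<open>1 / Q\<close> normalizes
  \<open>\<langle>H, n\<rangle> = 1\<close> and preserves both
  \<open>\<langle>l, n\<rangle> = 1\<close> and the bivector \<open>n \<and> l\<close>, hence the
  Gauss map.\<close>

lemma (in spacelike_patch) null_frame_exists:
  assumes H: "\<And>u. u \<in> U \<Longrightarrow> mink (mean_curvature X u) (mean_curvature X u) \<noteq> 0"
  obtains E1 E2 l n where "null_frame U X E1 E2 l n"
proof (rule adapted_frame)
  fix E1 E2 n3 n4 assume E: "smooth_on U E1" "smooth_on U E2" and sn: "smooth_on U n3" "smooth_on U n4"
    and orth: "\<And>u. u \<in> U \<Longrightarrow> orthonormal_at X u (E1 u) (E2 u)"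
    and det: "\<And>u. u \<in> U \<Longrightarrow> det (vector [E1 u, E2 u] :: real^2^2) > 0"
    and unit: "\<And>u. u \<in> U \<Longrightarrow> mink (n3 u) (n3 u) = 1 \<and> mink (n4 u) (n4 u) = -1 \<and> mink (n3 u) (n4 u) = 0"
    and nX: "\<And>u a. u \<in> U \<Longrightarrow> mink (n3 u) (push X u a) = 0 \<and> mink (n4 u) (push X u a) = 0"
    and pos: "\<And>u. u \<in> U \<Longrightarrow> wedge_pairing (wedge (push X u (E1 u)) (push X u (E2 u))) (wedge (n3 u) (n4 u)) > 0"
  interpret orthonormal_patch U X E1 E2
    by unfold_locales (use E orth in auto)
  have unit': "mink (n3 u) (n3 u) = 1" "mink (n4 u) (n4 u) = -1" "mink (n3 u) (n4 u) = 0" "mink (n4 u) (n3 u) = 0"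
    if "u \<in> U" for u using unit[OF that] mink_commute[of "n4 u" "n3 u"] by simp_all
  note g = gauss_map_eq[OF _ orth det unit'(1-3) conjunct1[OF nX] conjunct2[OF nX] pos]
  define l0 n0 where "l0 u = n3 u + n4 u" and "n0 u = (1/2) *\<^sub>R (n3 u - n4 u)" for u
  have s0: "smooth_on U l0" "smooth_on U n0"
    unfolding l0_def[abs_def] n0_def[abs_def]
    by (intro smooth_intros open_U sn)+
  define H where "H = mean_curvature X"
  define Q where "Q u = mink (H u) (n0 u)" for u
  have n0X: "mink (n0 u) (push X u c) = 0" "mink (l0 u) (push X u c) = 0" if "u \<in> U" for u c
    using nX[OF that] by (simp_all add: n0_def l0_def mink_simps)
  have exp0: "w = mink w (e1 u) *\<^sub>R e1 u + mink w (e2 u) *\<^sub>R e2 u + mink w (n0 u) *\<^sub>R l0 u + mink w (l0 u) *\<^sub>R n0 u"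
    if u: "u \<in> U" for u w
  proof -
    have "w = mink w (e1 u) *\<^sub>R e1 u + mink w (e2 u) *\<^sub>R e2 u + mink w (n3 u) *\<^sub>R n3 u - mink w (n4 u) *\<^sub>R n4 u"
      unfolding e1_def e2_def by (rule g(2)[OF u u u u u u u u u])
    moreover have "mink w (n3 u) *\<^sub>R n3 u - mink w (n4 u) *\<^sub>R n4 u
        = mink w (n0 u) *\<^sub>R l0 u + mink w (l0 u) *\<^sub>R n0 u"
      by (simp add: l0_def n0_def mink_simps vec_eq_iff field_simps)
    ultimately show ?thesis unfolding add_diff_eq[symmetric] by (simp only: add.assoc)
  qed
  have sQ: "smooth_on U Q"
  proof -
    have "smooth_on U (\<lambda>u. (h11 n0 u + h22 n0 u) / 2)"
      by (intro smooth_intros smooth_coeffs s0 smooth_on_const open_U) simp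
    then show ?thesis
      by (rule smooth_on_cong[OF open_U, rotated])
        (simp add: Q_def H_def mean_curvature_mink[where \<nu>=n0] n0X)
  qed
  have Q: "Q u \<noteq> 0" if u: "u \<in> U" for u
  proof
    assume "Q u = 0"
    then have "H u = mink (H u) (l0 u) *\<^sub>R n0 u"
      using exp0[OF u, of "H u"] mean_curvature_normal[OF u] by (simp add: Q_def H_def e1_def e2_def)
    then obtain c where c: "H u = c *\<^sub>R n0 u" by blast
    have "mink (H u) (H u) = c * Q u"
      by (subst (2) c) (simp add: Q_def mink.scaleR_right)
    then show False using H[OF u] \<open>Q u = 0\<close> by (simp add: H_def)
  qed
  have "null_frame U X E1 E2 (\<lambda>u. Q u *\<^sub>R l0 u) (\<lambda>u. (1 / Q u) *\<^sub>R n0 u)"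
  proof
    show "smooth_on U (\<lambda>u. Q u *\<^sub>R l0 u)" "smooth_on U (\<lambda>u. (1 / Q u) *\<^sub>R n0 u)"
      by (intro smooth_intros sQ s0 smooth_on_const open_U Q; assumption)+
    fix u assume u: "u \<in> U"
    show "mink (Q u *\<^sub>R l0 u) (push X u c) = 0" "mink ((1 / Q u) *\<^sub>R n0 u) (push X u c) = 0" for c
      using n0X[OF u] by (simp_all add: mink.scaleR_left)
    show "mink (Q u *\<^sub>R l0 u) (Q u *\<^sub>R l0 u) = 0" "mink ((1 / Q u) *\<^sub>R n0 u) ((1 / Q u) *\<^sub>R n0 u) = 0"
      "mink (Q u *\<^sub>R l0 u) ((1 / Q u) *\<^sub>R n0 u) = 1"
      using Q[OF u] unit'[OF u] by (simp_all add: l0_def n0_def mink_simps)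
    show "w = mink w (e1 u) *\<^sub>R e1 u + mink w (e2 u) *\<^sub>R e2 u
      + mink w ((1 / Q u) *\<^sub>R n0 u) *\<^sub>R (Q u *\<^sub>R l0 u) + mink w (Q u *\<^sub>R l0 u) *\<^sub>R ((1 / Q u) *\<^sub>R n0 u)" for w
      using exp0[OF u, of w] Q[OF u] by (simp add: mink.scaleR_right)
    have "wedge ((1 / Q u) *\<^sub>R n0 u) (Q u *\<^sub>R l0 u) = wedge (n3 u) (n4 u)"
      using Q[OF u] by (simp add: wedge.scaleR_left wedge.scaleR_right) (simp add: n0_def l0_def wedge_def vec_eq_iff field_simps)
    then show "gauss_map X u = wedge ((1 / Q u) *\<^sub>R n0 u) (Q u *\<^sub>R l0 u)"
      using g(1)[OF u u u u u u u u u] by simp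
    show "mink (mean_curvature X u) ((1 / Q u) *\<^sub>R n0 u) = 1"
      using Q[OF u] by (simp add: mink.scaleR_right Q_def H_def)
  qed
  then show thesis by (rule that)
qed

section \<open>Level functions on a patch\<close>

context orthonormal_patch
begin

lemma lie_eq_0_imp_constant:
  fixes f :: "real^2 \<Rightarrow> 'b::real_normed_vector"
  assumes f: "smooth_on U f" and V: "open V" "convex V" "V \<subseteq> U"
    and 0: "\<And>z. z \<in> V \<Longrightarrow> lie E1 f z = 0" "\<And>z. z \<in> V \<Longrightarrow> lie E2 f z = 0"
    and z: "z \<in> V" "w \<in> V"
  shows "f z = f w"
proof -
  have "(f has_derivative (\<lambda>v. 0)) (at z within V)" if z: "z \<in> V" for z
  proof -
    have zU: "z \<in> U" using z V(3) by auto
    interpret linear "frechet_derivative f (at z)"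
      by (rule linear_frechet_derivative[OF smooth_on_imp_differentiable[OF f zU]])
    have "frechet_derivative f (at z) v = 0" for v
    proof -
      obtain r s where "v = r *\<^sub>R E1 z + s *\<^sub>R E2 z"
        using orthonormal_expansion[OF zU orthonormal[OF zU]] by metis
      then show ?thesis using 0[OF z] by (simp add: add scale lie_def)
    qed
    then have "frechet_derivative f (at z) = (\<lambda>v. 0)" by auto
    then show ?thesis using smooth_on_imp_has_derivative[OF f zU] has_derivative_at_withinI by metis
  qed
  then obtain c where "\<And>z. z \<in> V \<Longrightarrow> f z = c"
    using has_derivative_zero_constant[OF V(2), of f] by blast
  then show ?thesis using z by simp
qed

lemma lie_X: "lie E1 X = e1" "lie E2 X = e2"
  by (simp_all add: e_eq_lie)

text \<open>The level sets of these functions are the hyperplanes and the pseudo-spheres.\<close>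

definition level_function :: "real \<Rightarrow> real^4 \<Rightarrow> real^2 \<Rightarrow> real" where
  "level_function s \<eta> z = s * mink (X z) (X z) + mink (X z) \<eta>"

lemma smooth_level_function: "smooth_on U (level_function s \<eta>)"
  unfolding level_function_def[abs_def]
  by (intro smooth_intros open_U smooth_X)

lemma lie_level_function:
  assumes u: "u \<in> U"
  shows "lie V (level_function s \<eta>) u = mink (lie V X u) ((2 * s) *\<^sub>R X u + \<eta>)"
proof -
  note sX = smooth_on_mink[OF open_U smooth_X smooth_X] smooth_on_mink[OF open_U smooth_X smooth_on_const]
  have "lie V (level_function s \<eta>) u
    = lie V (\<lambda>z. s * mink (X z) (X z)) u + lie V (\<lambda>z. mink (X z) \<eta>) u"
    unfolding level_function_def[abs_def]
    by (rule lie_add[OF u smooth_on_mult[OF open_U smooth_on_const sX(1)] sX(2)])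
  also have "lie V (\<lambda>z. s * mink (X z) (X z)) u = s * lie V (\<lambda>z. mink (X z) (X z)) u"
    by (rule lie_linear[OF u bounded_linear_mult_right sX(1)])
  finally show ?thesis
    using lie_mink[OF u smooth_X smooth_X, of V] lie_mink[OF u smooth_X smooth_on_const[of U \<eta>], of V]
    by (simp add: mink.add_right mink.scaleR_right mink.zero_right mink_commute[of "X u" "lie V X u"] algebra_simps)
qed

lemma smooth_position: "smooth_on U (\<lambda>z. (2 * s) *\<^sub>R X z + \<eta>)"
  by (intro smooth_intros open_U smooth_X)

lemma lie_position:
  "u \<in> U \<Longrightarrow> lie V (\<lambda>z. (2 * s) *\<^sub>R X z + \<eta>) u = (2 * s) *\<^sub>R lie V X u"
  using lie_add[of u U "\<lambda>z. (2 * s) *\<^sub>R X z" "\<lambda>z. \<eta>" V]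
    lie_linear[OF _ bounded_linear_scaleR_right smooth_X, of u V "2 * s"]
  by (simp add: smooth_on_scaleR open_U smooth_X)

text \<open>For a parallel normal whose trace has zero derivative, the Codazzi equations become the
  system assumed by \<open>unique_continuation\<close>, with \<open>c1\<close> and
  \<open>h12 \<nu>\<close> the entries of the trace-free part.\<close>

lemma traceless_equations:
  assumes \<nu>: "smooth_on U \<nu>" "\<And>z c. z \<in> U \<Longrightarrow> mink (\<nu> z) (push X z c) = 0" and u: "u \<in> U"
    and D1: "lie E1 \<nu> u = - h11 \<nu> u *\<^sub>R e1 u - h12 \<nu> u *\<^sub>R e2 u"
    and D2: "lie E2 \<nu> u = - h12 \<nu> u *\<^sub>R e1 u - h22 \<nu> u *\<^sub>R e2 u"
    and tr: "lie E1 (h11 \<nu>) u + lie E1 (h22 \<nu>) u = 0" "lie E2 (h11 \<nu>) u + lie E2 (h22 \<nu>) u = 0"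
  defines "c1 \<equiv> \<lambda>z. (h11 \<nu> z - h22 \<nu> z) / 2"
  shows "lie E1 c1 u + lie E2 (h12 \<nu>) u = 2 * \<omega>1 u * h12 \<nu> u - 2 * \<omega>2 u * c1 u"
    and "lie E2 c1 u - lie E1 (h12 \<nu>) u = 2 * \<omega>1 u * c1 u + 2 * \<omega>2 u * h12 \<nu> u"
proof -
  note s = smooth_coeffs(3)[OF \<nu>(1)] smooth_coeffs(5)[OF \<nu>(1)]
  have c1: "lie V c1 u = (lie V (h11 \<nu>) u - lie V (h22 \<nu>) u) / 2" for V
  proof -
    have "lie V c1 u = lie V (\<lambda>z. h11 \<nu> z - h22 \<nu> z) u / 2"
      unfolding c1_def by (rule lie_linear[OF u bounded_linear_divide smooth_on_diff[OF open_U s]])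
    then show ?thesis by (simp add: lie_diff[OF u s])
  qed
  note cod = codazzi[OF \<nu> u, of 0 0]
  have cod: "lie E2 (h11 \<nu>) u - lie E1 (h12 \<nu>) u = \<omega>1 u * (h11 \<nu> u - h22 \<nu> u) + 2 * \<omega>2 u * h12 \<nu> u"
    "lie E2 (h12 \<nu>) u - lie E1 (h22 \<nu>) u = 2 * \<omega>1 u * h12 \<nu> u + \<omega>2 u * (h22 \<nu> u - h11 \<nu> u)"
    using cod D1 D2 by simp_all
  have "lie E1 c1 u = - lie E1 (h22 \<nu>) u" "lie E2 c1 u = lie E2 (h11 \<nu>) u"
    using tr by (simp_all add: c1)
  then show "lie E1 c1 u + lie E2 (h12 \<nu>) u = 2 * \<omega>1 u * h12 \<nu> u - 2 * \<omega>2 u * c1 u"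
    "lie E2 c1 u - lie E1 (h12 \<nu>) u = 2 * \<omega>1 u * c1 u + 2 * \<omega>2 u * h12 \<nu> u"
    using cod by (simp_all add: c1_def diff_divide_distrib algebra_simps)
qed

end

section \<open>Normal fields of level sets\<close>

context null_frame
begin

text \<open>\<xi> is the gradient of the level function, hence normal along the surface. Its
  derivative is tangent, so its components along \<open>l\<close> and \<open>n\<close> vary only
  through the normal connection.\<close>

lemma position_frame:
  assumes V: "open V" "V \<subseteq> U" and F: "\<forall>z\<in>V. level_function s \<eta> z = r" and u: "u \<in> V"
  defines "\<xi> \<equiv> \<lambda>z. (2 * s) *\<^sub>R X z + \<eta>"
  shows "mink (\<xi> u) (e1 u) = 0" "mink (\<xi> u) (e2 u) = 0"
    and "\<xi> u = mink (\<xi> u) (n u) *\<^sub>R l u + mink (\<xi> u) (l u) *\<^sub>R n u"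
    and "lie E1 (\<lambda>z. mink (\<xi> z) (n z)) u = - t1 u * mink (\<xi> u) (n u)"
    and "lie E2 (\<lambda>z. mink (\<xi> z) (n z)) u = - t2 u * mink (\<xi> u) (n u)"
    and "lie E1 (\<lambda>z. mink (\<xi> z) (l z)) u = t1 u * mink (\<xi> u) (l u)"
    and "lie E2 (\<lambda>z. mink (\<xi> z) (l z)) u = t2 u * mink (\<xi> u) (l u)"
proof -
  have uU: "u \<in> U" using u V by auto
  have "lie W (level_function s \<eta>) u = lie W (\<lambda>z. r) u" for W
    by (rule lie_cong[OF V(1) u bspec[OF F]])
  then have e: "mink (e1 u) (\<xi> u) = 0" "mink (e2 u) (\<xi> u) = 0"
    using lie_level_function[OF uU, of _ s \<eta>] by (simp_all add: \<xi>_def lie_X[symmetric])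
  then show e': "mink (\<xi> u) (e1 u) = 0" "mink (\<xi> u) (e2 u) = 0" by (simp_all add: mink_commute)
  show \<xi>: "\<xi> u = mink (\<xi> u) (n u) *\<^sub>R l u + mink (\<xi> u) (l u) *\<^sub>R n u"
    using expansion[OF uU, of "\<xi> u"] e' by simp
  have s\<xi>: "smooth_on U \<xi>" unfolding \<xi>_def by (rule smooth_position)
  have D: "lie E1 \<xi> u = (2 * s) *\<^sub>R e1 u" "lie E2 \<xi> u = (2 * s) *\<^sub>R e2 u"
    unfolding \<xi>_def by (simp_all add: lie_position[OF uU] lie_X)
  note sim = lie_mink[OF uU s\<xi>] smooth_ln D lie_l[OF uU] lie_n[OF uU] mink_simps mink_ln[OF uU] e'
  show "lie E1 (\<lambda>z. mink (\<xi> z) (n z)) u = - t1 u * mink (\<xi> u) (n u)"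
    "lie E2 (\<lambda>z. mink (\<xi> z) (n z)) u = - t2 u * mink (\<xi> u) (n u)"
    "lie E1 (\<lambda>z. mink (\<xi> z) (l z)) u = t1 u * mink (\<xi> u) (l u)"
    "lie E2 (\<lambda>z. mink (\<xi> z) (l z)) u = t2 u * mink (\<xi> u) (l u)"
    by (simp_all add: sim)
qed

text \<open>If the normal field \<open>\<alpha> l + \<beta> n\<close> of the level set were not parallel, its two components
  would be forced to balance on an open set, hence to vanish.\<close>

lemma level_function_imp_parallel:
  assumes F: "\<forall>z\<in>U. level_function s \<eta> z = r" and nz: "s \<noteq> 0 \<or> \<eta> \<noteq> 0"
    and P: "\<And>z. z \<in> U \<Longrightarrow> P z \<noteq> 0" "\<And>z. z \<in> U \<Longrightarrow> lie E1 P z = 0" "\<And>z. z \<in> U \<Longrightarrow> lie E2 P z = 0"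
    and u: "u \<in> U"
  shows "t1 u = 0" "t2 u = 0"
proof -
  define \<xi> where "\<xi> z = (2 * s) *\<^sub>R X z + \<eta>" for z
  define \<alpha> where "\<alpha> z = mink (\<xi> z) (n z)" for z
  define \<beta> where "\<beta> z = mink (\<xi> z) (l z)" for z
  note pf = position_frame[OF open_U subset_refl F, folded \<xi>_def, folded \<alpha>_def[abs_def] \<beta>_def[abs_def], folded \<alpha>_def \<beta>_def]
  have s\<xi>: "smooth_on U \<xi>" unfolding \<xi>_def[abs_def] by (rule smooth_position)
  have sab: "smooth_on U \<alpha>" "smooth_on U \<beta>"
    unfolding \<alpha>_def[abs_def] \<beta>_def[abs_def] by (intro smooth_on_mink open_U s\<xi> smooth_ln)+
  \<comment> \<open>The shape operator of \<xi> is \<open>- 2 * s\<close> times the identity, and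
    half of its trace is \<open>\<langle>\<xi>, H\<rangle>\<close>.\<close>
  have bal: "\<alpha> z * P z + \<beta> z = - 2 * s" if z: "z \<in> U" for z
  proof -
    have D: "lie E1 \<xi> z = (2 * s) *\<^sub>R e1 z" "lie E2 \<xi> z = (2 * s) *\<^sub>R e2 z"
      unfolding \<xi>_def[abs_def] by (simp_all add: lie_position[OF z] lie_X)
    have "2 * s = - mink (lie E1 e1 z) (\<xi> z)"
      using lie_mink_const[OF z s\<xi> smooth_e(1) pf(1), of E1] by (simp add: D mink.scaleR_left mink_e[OF z])
    moreover have "2 * s = - mink (lie E2 e2 z) (\<xi> z)"
      using lie_mink_const[OF z s\<xi> smooth_e(2) pf(2), of E2] by (simp add: D mink.scaleR_left mink_e[OF z])
    moreover have "mink w (\<xi> z) = \<alpha> z * mink w (l z) + \<beta> z * mink w (n z)" for w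
      by (subst pf(3)[OF z]) (simp add: mink.add_right mink.scaleR_right)
    ultimately have "2 * s = - (\<alpha> z * h11 l z + \<beta> z * h11 n z)" "2 * s = - (\<alpha> z * h22 l z + \<beta> z * h22 n z)"
      by (simp_all add: h11_def h22_def)
    then have "4 * s = - (\<alpha> z * (h11 l z + h22 l z) + \<beta> z * (h11 n z + h22 n z))"
      by (simp add: algebra_simps)
    then show ?thesis using trace_n[OF z] by (simp add: P_def)
  qed
  have key: "t z = 0"
    if E: "\<And>z. z \<in> U \<Longrightarrow> lie E \<alpha> z = - t z * \<alpha> z" "\<And>z. z \<in> U \<Longrightarrow> lie E \<beta> z = t z * \<beta> z"
      "\<And>z. z \<in> U \<Longrightarrow> lie E P z = 0" and st: "smooth_on U t" and z: "z \<in> U" for E t z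
  proof (rule ccontr)
    assume tz: "t z \<noteq> 0"
    define V where "V = {w \<in> U. t w \<in> - {0}}"
    have V: "open V" "V \<subseteq> U" "z \<in> V"
      using continuous_open_preimage[OF smooth_on_imp_continuous_on[OF st] open_U, of "- {0}"] z tz
      by (auto simp: V_def vimage_def Int_def)
    \<comment> \<open>\<alpha> and \<beta> have opposite relative rates along \<open>E\<close>, so
      differentiating \<open>bal\<close> with \<open>P\<close> constant gives
      \<open>\<beta> = \<alpha> * P\<close>; both then equal \<open>- s\<close>, and \<beta> is
      constant on \<open>V\<close>.\<close>
    have \<beta>V: "\<beta> w = - s" if w: "w \<in> V" for w
    proof -
      have wU: "w \<in> U" and tw: "t w \<noteq> 0" using w by (auto simp: V_def)
      have "lie E (\<lambda>z. \<alpha> z * P z + \<beta> z) w = lie E (\<lambda>z. - 2 * s) w"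
        by (rule lie_cong[OF open_U wU bal])
      then have "lie E (\<lambda>z. \<alpha> z * P z) w + lie E \<beta> w = 0"
        by (simp add: lie_add[OF wU smooth_on_mult[OF open_U sab(1) smooth_P] sab(2)])
      then have "t w * (\<beta> w - \<alpha> w * P w) = 0"
        by (simp add: lie_mult[OF wU sab(1) smooth_P] E[OF wU] algebra_simps)
      then have "\<beta> w = \<alpha> w * P w" using tw by simp
      then show ?thesis using bal[OF wU] by linarith
    qed
    have "lie E \<beta> z = lie E (\<lambda>z. - s) z" by (rule lie_cong[OF V(1,3) \<beta>V])
    then have "\<beta> z = 0" using E(2)[OF z] tz by simp
    then have s0: "s = 0" using \<beta>V[OF V(3)] by simp
    then have "\<alpha> z = 0" using bal[OF z] \<open>\<beta> z = 0\<close> P(1)[OF z] by simp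
    then have "\<xi> z = 0" using pf(3)[OF z] \<open>\<beta> z = 0\<close> by simp
    then show False using nz s0 by (simp add: \<xi>_def)
  qed
  show "t1 u = 0" using key[OF pf(4) pf(6) P(2) smooth_t(1) u] .
  show "t2 u = 0" using key[OF pf(5) pf(7) P(3) smooth_t(2) u] .
qed


section \<open>Umbilic parallel normal fields\<close>

context
  assumes parallel: "\<And>z. z \<in> U \<Longrightarrow> t1 z = 0" "\<And>z. z \<in> U \<Longrightarrow> t2 z = 0"
    "\<And>z. z \<in> U \<Longrightarrow> lie E1 P z = 0" "\<And>z. z \<in> U \<Longrightarrow> lie E2 P z = 0"
begin

context
  fixes \<alpha> \<beta> :: real and \<nu>
  defines "\<nu> \<equiv> \<lambda>z. \<alpha> *\<^sub>R l z + \<beta> *\<^sub>R n z"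
begin

lemma smooth_\<nu>: "smooth_on U \<nu>"
  unfolding \<nu>_def by (intro smooth_intros open_U smooth_ln)

lemma normal_\<nu>: "z \<in> U \<Longrightarrow> mink (\<nu> z) (push X z c) = 0"
  by (simp add: \<nu>_def mink.add_left mink.scaleR_left normal)

lemma h_\<nu>:
  "h11 \<nu> z = \<alpha> * h11 l z + \<beta> * h11 n z" "h12 \<nu> z = \<alpha> * h12 l z + \<beta> * h12 n z"
  "h22 \<nu> z = \<alpha> * h22 l z + \<beta> * h22 n z"
  by (simp_all add: h11_def h12_def h22_def \<nu>_def mink.add_right mink.scaleR_right)

lemma trace_\<nu>: "z \<in> U \<Longrightarrow> h11 \<nu> z + h22 \<nu> z = 2 * (\<alpha> * P z + \<beta>)"
proof -
  assume "z \<in> U"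
  have "h11 \<nu> z + h22 \<nu> z = \<alpha> * (h11 l z + h22 l z) + \<beta> * (h11 n z + h22 n z)"
    by (simp add: h_\<nu> algebra_simps)
  then show ?thesis using trace_n[OF \<open>z \<in> U\<close>] by (simp add: P_def)
qed

lemma lie_trace_\<nu>:
  assumes u: "u \<in> U"
  shows "lie E1 (h11 \<nu>) u + lie E1 (h22 \<nu>) u = 0" "lie E2 (h11 \<nu>) u + lie E2 (h22 \<nu>) u = 0"
proof -
  note s = smooth_coeffs(3)[OF smooth_\<nu>] smooth_coeffs(5)[OF smooth_\<nu>]
  have "lie V (h11 \<nu>) u + lie V (h22 \<nu>) u = 2 * (\<alpha> * lie V P u)" for V
  proof -
    have "lie V (h11 \<nu>) u + lie V (h22 \<nu>) u = lie V (\<lambda>z. h11 \<nu> z + h22 \<nu> z) u"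
      by (rule lie_add[OF u s, symmetric])
    also have "\<dots> = lie V (\<lambda>z. (2 * \<alpha>) * P z + 2 * \<beta>) u"
      by (rule lie_cong[OF open_U u]) (simp add: trace_\<nu>)
    also have "\<dots> = lie V (\<lambda>z. (2 * \<alpha>) * P z) u"
      using lie_add[OF u smooth_on_mult[OF open_U smooth_on_const smooth_P] smooth_on_const] by simp
    also have "\<dots> = (2 * \<alpha>) * lie V P u"
      by (rule lie_linear[OF u bounded_linear_mult_right smooth_P])
    finally show ?thesis by simp
  qed
  then show "lie E1 (h11 \<nu>) u + lie E1 (h22 \<nu>) u = 0" "lie E2 (h11 \<nu>) u + lie E2 (h22 \<nu>) u = 0"
    using parallel u by simp_all
qed

lemma lie_\<nu>:
  assumes u: "u \<in> U"
  shows "lie E1 \<nu> u = - h11 \<nu> u *\<^sub>R e1 u - h12 \<nu> u *\<^sub>R e2 u"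
    "lie E2 \<nu> u = - h12 \<nu> u *\<^sub>R e1 u - h22 \<nu> u *\<^sub>R e2 u"
proof -
  have "lie V \<nu> u = \<alpha> *\<^sub>R lie V l u + \<beta> *\<^sub>R lie V n u" for V
  proof -
    have "lie V \<nu> u = lie V (\<lambda>z. \<alpha> *\<^sub>R l z) u + lie V (\<lambda>z. \<beta> *\<^sub>R n z) u"
      unfolding \<nu>_def by (rule lie_add[OF u]) (intro smooth_intros open_U smooth_ln)+
    then show ?thesis
      using lie_linear[OF u bounded_linear_scaleR_right smooth_ln(1), of V \<alpha>]
        lie_linear[OF u bounded_linear_scaleR_right smooth_ln(2), of V \<beta>] by simp
  qed
  then show "lie E1 \<nu> u = - h11 \<nu> u *\<^sub>R e1 u - h12 \<nu> u *\<^sub>R e2 u"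
    "lie E2 \<nu> u = - h12 \<nu> u *\<^sub>R e1 u - h22 \<nu> u *\<^sub>R e2 u"
    using parallel u by (simp_all add: lie_l lie_n h_\<nu> algebra_simps)
qed

text \<open>The umbilicity factor is half the trace, \<open>\<alpha> * P + \<beta>\<close>, constant
  because \<open>P\<close> is; \<open>s\<close> is minus half of this factor, so that \<nu> and
  \<open>2 s X\<close> have the same derivative.\<close>

lemma umbilic_imp_level_function:
  assumes V: "open V" "convex V" "V \<subseteq> U" "w \<in> V"
    and umb: "\<And>z. z \<in> V \<Longrightarrow> h11 \<nu> z = h22 \<nu> z" "\<And>z. z \<in> V \<Longrightarrow> h12 \<nu> z = 0" and z: "z \<in> V"
  defines "s \<equiv> - (\<alpha> * P w + \<beta>) / 2"
  shows "\<nu> z - (2 * s) *\<^sub>R X z = \<nu> w - (2 * s) *\<^sub>R X w"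
    and "level_function s (\<nu> w - (2 * s) *\<^sub>R X w) z = level_function s (\<nu> w - (2 * s) *\<^sub>R X w) w"
proof -
  define \<eta> where "\<eta> = \<nu> w - (2 * s) *\<^sub>R X w"
  have h: "h11 \<nu> z = - 2 * s" "h22 \<nu> z = - 2 * s" if z: "z \<in> V" for z
  proof -
    have "P z = P w"
      by (rule lie_eq_0_imp_constant[OF smooth_P V(1-3) _ _ z V(4)]) (use parallel V(3) in auto)
    then have "h11 \<nu> z + h22 \<nu> z = - 4 * s"
      using trace_\<nu>[of z] V(3) z by (auto simp: s_def)
    then show "h11 \<nu> z = - 2 * s" "h22 \<nu> z = - 2 * s" using umb(1)[OF z] by simp_all
  qed
  have sm: "smooth_on U (\<lambda>z. \<nu> z - (2 * s) *\<^sub>R X z)"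
    by (intro smooth_intros open_U smooth_\<nu> smooth_X)
  have D: "lie W (\<lambda>z. \<nu> z - (2 * s) *\<^sub>R X z) z = lie W \<nu> z - (2 * s) *\<^sub>R lie W X z" if "z \<in> U" for W z
    using lie_diff[OF that smooth_\<nu> smooth_on_scaleR[OF open_U smooth_on_const smooth_X], of W "2 * s"]
      lie_linear[OF that bounded_linear_scaleR_right smooth_X, of W "2 * s"] by simp
  have const: "\<nu> z - (2 * s) *\<^sub>R X z = \<eta>" if z: "z \<in> V" for z
    unfolding \<eta>_def
  proof (rule lie_eq_0_imp_constant[OF sm V(1-3) _ _ z V(4)])
    fix y assume y: "y \<in> V"
    then have yU: "y \<in> U" using V(3) by auto
    show "lie E1 (\<lambda>z. \<nu> z - (2 * s) *\<^sub>R X z) y = 0" "lie E2 (\<lambda>z. \<nu> z - (2 * s) *\<^sub>R X z) y = 0"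
      by (simp_all add: D[OF yU] lie_\<nu>[OF yU] lie_X h[OF y] umb(2)[OF y])
  qed
  show "\<nu> z - (2 * s) *\<^sub>R X z = \<nu> w - (2 * s) *\<^sub>R X w"
    using const[OF z] by (simp add: \<eta>_def)
  have "level_function s \<eta> z = level_function s \<eta> w"
  proof (rule lie_eq_0_imp_constant[OF smooth_level_function V(1-3) _ _ z V(4)])
    fix y assume y: "y \<in> V"
    then have yU: "y \<in> U" using V(3) by auto
    have *: "(2 * s) *\<^sub>R X y + \<eta> = \<nu> y" using const[OF y] by (simp add: algebra_simps)
    show "lie E1 (level_function s \<eta>) y = 0" "lie E2 (level_function s \<eta>) y = 0"
      unfolding lie_level_function[OF yU] *
      using normal_\<nu>[OF yU] by (simp_all add: lie_X e1_def e2_def mink_commute)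
  qed
  then show "level_function s (\<nu> w - (2 * s) *\<^sub>R X w) z = level_function s (\<nu> w - (2 * s) *\<^sub>R X w) w"
    by (simp add: \<eta>_def)
qed

text \<open>\<nu> is parallel with constant trace, so the trace-free part of its shape operator
  solves the system of \<open>unique_continuation\<close>.\<close>

lemma umbilic_unique_continuation:
  assumes r: "0 < r0" "r0 < r1" "cball z0 r1 \<subseteq> U"
    and umb: "\<And>z. z \<in> ball z0 r0 \<Longrightarrow> h11 \<nu> z = h22 \<nu> z" "\<And>z. z \<in> ball z0 r0 \<Longrightarrow> h12 \<nu> z = 0"
    and z: "z \<in> ball z0 r1"
  shows "h11 \<nu> z = h22 \<nu> z" "h12 \<nu> z = 0"
proof -
  define c1 where "c1 z = (h11 \<nu> z - h22 \<nu> z) / 2" for z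
  have s: "smooth_on U c1" "smooth_on U (h12 \<nu>)"
    unfolding c1_def[abs_def]
    by (intro smooth_intros smooth_coeffs smooth_on_const open_U smooth_\<nu>; simp)+
  have "c1 z = 0 \<and> h12 \<nu> z = 0"
  proof (rule unique_continuation[OF r s _ _ _ z])
    fix u assume u: "u \<in> U"
    note tl = traceless_equations[OF smooth_\<nu> normal_\<nu> u lie_\<nu>[OF u] lie_trace_\<nu>[OF u], folded c1_def[abs_def], folded c1_def]
    show "lie E1 c1 u + lie E2 (h12 \<nu>) u = 2 * \<omega>1 u * h12 \<nu> u - 2 * \<omega>2 u * c1 u"
      "lie E2 c1 u - lie E1 (h12 \<nu>) u = 2 * \<omega>1 u * c1 u + 2 * \<omega>2 u * h12 \<nu> u"
      by (rule tl, assumption)+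
  qed (use umb in \<open>auto simp: c1_def\<close>)
  then show "h11 \<nu> z = h22 \<nu> z" "h12 \<nu> z = 0" by (simp_all add: c1_def)
qed

end

text \<open>Continuation works for trace-free tensors, not for the level function itself: on the
  small ball \<xi> is a parallel umbilic field with constant components, umbilicity extends to the
  large ball, and integrating there recovers the equation.\<close>

lemma level_function_continuation:
  assumes r: "0 < r0" "r0 < r1" "cball z0 r1 \<subseteq> U"
    and F: "\<forall>z\<in>ball z0 r0. level_function s \<eta> z = r" and z: "z \<in> ball z0 r1"
  shows "level_function s \<eta> z = r"
proof -
  define V where "V = ball z0 r0"
  define \<xi> where "\<xi> z = (2 * s) *\<^sub>R X z + \<eta>" for z
  have V: "open V" "convex V" "V \<subseteq> U" "z0 \<in> V" using r by (auto simp: V_def)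
  have s\<xi>: "smooth_on U \<xi>" unfolding \<xi>_def[abs_def] by (rule smooth_position)
  note pf = position_frame[OF V(1,3) F[folded V_def], folded \<xi>_def, folded \<xi>_def[abs_def]]
  define \<alpha> \<beta> where "\<alpha> = mink (\<xi> z0) (n z0)" and "\<beta> = mink (\<xi> z0) (l z0)"
  define \<nu> where "\<nu> = (\<lambda>z. \<alpha> *\<^sub>R l z + \<beta> *\<^sub>R n z)"
  have \<xi>\<nu>: "\<xi> y = \<nu> y" if y: "y \<in> V" for y
  proof -
    have "mink (\<xi> y) (n y) = \<alpha>" unfolding \<alpha>_def
      by (rule lie_eq_0_imp_constant[OF smooth_on_mink[OF open_U s\<xi> smooth_ln(2)] V(1-3) _ _ y V(4)])
        (use pf(4,5) parallel V(3) in auto)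
    moreover have "mink (\<xi> y) (l y) = \<beta>" unfolding \<beta>_def
      by (rule lie_eq_0_imp_constant[OF smooth_on_mink[OF open_U s\<xi> smooth_ln(1)] V(1-3) _ _ y V(4)])
        (use pf(6,7) parallel V(3) in auto)
    ultimately show ?thesis using pf(3)[OF y] by (simp add: \<nu>_def)
  qed
  note lnu = lie_\<nu>[of _ \<alpha> \<beta>, folded \<nu>_def]
  have h: "h11 \<nu> y = - 2 * s" "h22 \<nu> y = - 2 * s" "h12 \<nu> y = 0" if y: "y \<in> V" for y
  proof -
    have yU: "y \<in> U" using y V by auto
    have "lie W \<nu> y = (2 * s) *\<^sub>R lie W X y" for W
    proof -
      have "lie W \<nu> y = lie W \<xi> y" by (rule lie_cong[OF V(1) y]) (simp add: \<xi>\<nu>)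
      then show ?thesis unfolding \<xi>_def[abs_def] by (simp add: lie_position[OF yU])
    qed
    then have D: "- h11 \<nu> y *\<^sub>R e1 y - h12 \<nu> y *\<^sub>R e2 y = (2 * s) *\<^sub>R e1 y"
      "- h12 \<nu> y *\<^sub>R e1 y - h22 \<nu> y *\<^sub>R e2 y = (2 * s) *\<^sub>R e2 y"
      using lnu[OF yU] by (simp_all add: lie_X)
    show "h11 \<nu> y = - 2 * s" "h22 \<nu> y = - 2 * s" "h12 \<nu> y = 0"
      using arg_cong[OF D(1), of "\<lambda>x. mink x (e1 y)"] arg_cong[OF D(2), of "\<lambda>x. mink x (e2 y)"]
        arg_cong[OF D(1), of "\<lambda>x. mink x (e2 y)"]
      by (simp_all add: mink_simps mink_e[OF yU])
  qed
  have ball1: "open (ball z0 r1)" "convex (ball z0 r1)" "ball z0 r1 \<subseteq> U" "z0 \<in> ball z0 r1"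
    using r by auto
  note umb = umbilic_unique_continuation[of r0 r1 z0 \<alpha> \<beta>, folded \<nu>_def, OF r]
  have umb': "h11 \<nu> y = h22 \<nu> y" "h12 \<nu> y = 0" if "y \<in> ball z0 r1" for y
    by (rule umb; use h that V_def in auto)+
  \<comment> \<open>The level function rebuilt from \<nu> has to be the given one: \<open>s\<close>
    is recovered from the trace at \<open>z0\<close>, and \<open>\<eta>\<close> from the value of
    \<nu> there.\<close>
  have s: "- (\<alpha> * P z0 + \<beta>) / 2 = s"
    using trace_\<nu>[of z0 \<alpha> \<beta>, folded \<nu>_def] h[OF V(4)] V by auto
  have \<eta>: "\<nu> z0 - (2 * s) *\<^sub>R X z0 = \<eta>" using \<xi>\<nu>[OF V(4)] by (simp add: \<xi>_def algebra_simps)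
  have "level_function s \<eta> z = level_function s \<eta> z0"
    using umbilic_imp_level_function(2)[of "ball z0 r1" z0 \<alpha> \<beta> z, folded \<nu>_def, OF ball1 umb' z, unfolded s] \<eta>[unfolded \<nu>_def]
    by (simp only:)
  then show ?thesis using F r(1) by simp
qed

end

end

lemma (in orthonormal_patch) orthonormal_patch_subset:
  "open V \<Longrightarrow> V \<subseteq> U \<Longrightarrow> orthonormal_patch V X E1 E2"
  by (intro orthonormal_patch.intro spacelike_patch_subset orthonormal_patch_axioms.intro)
    (auto intro: smooth_on_subset smooth_E orthonormal)

section \<open>Existence of a level set on some ball\<close>

context null_frame
begin

context
  assumes parallel: "\<And>z. z \<in> U \<Longrightarrow> t1 z = 0" "\<And>z. z \<in> U \<Longrightarrow> t2 z = 0"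
    "\<And>z. z \<in> U \<Longrightarrow> lie E1 P z = 0" "\<And>z. z \<in> U \<Longrightarrow> lie E2 P z = 0"
begin

text \<open>The case \<open>s = 0\<close> is a hyperplane with normal \<open>\<eta>\<close>. Then
  \<open>\<beta> = - \<alpha> * P\<close> with \<alpha> non-zero, so
  \<open>mink \<eta> \<eta> = 2 * (\<alpha> * \<beta>)\<close> is non-zero and the hyperplane is not
  degenerate.\<close>

lemma umbilic_ball_imp_level_function:
  assumes ball: "\<rho> > 0" "ball w \<rho> \<subseteq> U" and P: "P w \<noteq> 0" and ab: "\<alpha> \<noteq> 0 \<or> \<beta> \<noteq> 0"
    and umb: "\<And>z. z \<in> ball w \<rho> \<Longrightarrow> \<alpha> * h11 l z + \<beta> * h11 n z = \<alpha> * h22 l z + \<beta> * h22 n z"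
      "\<And>z. z \<in> ball w \<rho> \<Longrightarrow> \<alpha> * h12 l z + \<beta> * h12 n z = 0"
  obtains s \<eta> r where "s \<noteq> 0 \<or> mink \<eta> \<eta> \<noteq> 0" "\<forall>z\<in>ball w \<rho>. level_function s \<eta> z = r"
proof -
  define s where "s = - (\<alpha> * P w + \<beta>) / 2"
  define \<eta> where "\<eta> = \<alpha> *\<^sub>R l w + \<beta> *\<^sub>R n w - (2 * s) *\<^sub>R X w"
  have w: "w \<in> ball w \<rho>" "w \<in> U" using ball by auto
  have "level_function s \<eta> z = level_function s \<eta> w" if z: "z \<in> ball w \<rho>" for z
    unfolding s_def \<eta>_def
    by (rule umbilic_imp_level_function(2)[OF parallel open_ball convex_ball ball(2) w(1) _ _ z])
      (simp_all add: h_\<nu>[OF parallel] umb)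
  moreover have "mink \<eta> \<eta> \<noteq> 0" if "s = 0"
  proof -
    have "\<beta> = - \<alpha> * P w" using that by (simp add: s_def)
    moreover have "\<alpha> \<noteq> 0" using ab calculation by auto
    moreover have "mink \<eta> \<eta> = 2 * (\<alpha> * \<beta>)"
      using that by (simp add: \<eta>_def mink_simps mink_ln[OF w(2)])
    ultimately show ?thesis using P by simp
  qed
  ultimately show thesis using that by blast
qed

text \<open>Both trace-free shape operators are Codazzi tensors and they commute, so where one of them
  does not vanish the other is a multiple of it, with a constant factor.\<close>

lemma level_function_exists:
  assumes z0: "z0 \<in> U" and P: "\<And>z. z \<in> U \<Longrightarrow> P z \<noteq> 0"
  obtains w \<rho> s \<eta> r where "\<rho> > 0" "ball w \<rho> \<subseteq> U" "s \<noteq> 0 \<or> mink \<eta> \<eta> \<noteq> 0"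
    "\<forall>z\<in>ball w \<rho>. level_function s \<eta> z = r"
proof -
  \<comment> \<open>The entries of the trace-free shape operators of \<open>l\<close>
    (\<open>a1\<close>, \<open>a2\<close>) and of \<open>n\<close> (\<open>b1\<close>,
    \<open>b2\<close>).\<close>
  define a1 a2 b1 b2 where "a1 z = (h11 l z - h22 l z) / 2" and "a2 = h12 l"
    and "b1 z = (h11 n z - h22 n z) / 2" and "b2 = h12 n" for z
  note h = smooth_coeffs(3,4,5)[OF smooth_ln(1)] smooth_coeffs(3,4,5)[OF smooth_ln(2)]
  have s: "smooth_on U a1" "smooth_on U a2" "smooth_on U b1" "smooth_on U b2"
    unfolding a1_def[abs_def] a2_def b1_def[abs_def] b2_def
    by (intro smooth_intros open_U h; simp)+
  define q where "q z = b1 z * b1 z + b2 z * b2 z" for z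
  have sq: "smooth_on U q" unfolding q_def[abs_def] by (intro smooth_intros open_U s)
  show thesis
  proof (cases "\<forall>z\<in>U. q z = 0")
    case True
    then have b0: "b1 z = 0 \<and> b2 z = 0" if "z \<in> U" for z
      using that by (simp add: q_def sum_squares_eq_zero_iff)
    obtain \<rho> where \<rho>: "\<rho> > 0" "ball z0 \<rho> \<subseteq> U" using open_U z0 openE by blast
    \<comment> \<open>Here \<open>n\<close> itself is umbilic, whence the coefficients 0 and
      1.\<close>
    show thesis
    proof (rule umbilic_ball_imp_level_function[OF \<rho> P[OF z0], of 0 1])
      fix z assume "z \<in> ball z0 \<rho>"
      then have "b1 z = 0 \<and> b2 z = 0" using b0 \<rho>(2) by blast
      then show "0 * h11 l z + 1 * h11 n z = 0 * h22 l z + 1 * h22 n z" "0 * h12 l z + 1 * h12 n z = 0"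
        by (simp_all add: b1_def b2_def)
    qed (simp, rule that[OF \<rho>])
  next
    case False
    then obtain w where w: "w \<in> U" "q w \<noteq> 0" by blast
    define V' where "V' = {z \<in> U. q z \<in> - {0}}"
    have "open V'" "w \<in> V'"
      using continuous_open_preimage[OF smooth_on_imp_continuous_on[OF sq] open_U, of "- {0}"] w
      by (auto simp: V'_def vimage_def Int_def)
    then obtain \<rho> where \<rho>: "\<rho> > 0" "ball w \<rho> \<subseteq> V'" using openE by blast
    define V where "V = ball w \<rho>"
    have V: "open V" "convex V" "V \<subseteq> U" "w \<in> V" using \<rho> by (auto simp: V_def V'_def)
    have q0: "q z \<noteq> 0" if "z \<in> V" for z using that \<rho> by (auto simp: V_def V'_def)
    \<comment> \<open>The proportionality factor of the two trace-free operators, written as a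
      projection coefficient so that it is smooth wherever \<open>q\<close> is non-zero.\<close>
    define \<kappa> where "\<kappa> z = (a1 z * b1 z + a2 z * b2 z) / q z" for z
    have s\<kappa>: "smooth_on V \<kappa>"
      unfolding \<kappa>_def[abs_def]
      by (intro smooth_intros V(1) q0 s[THEN smooth_on_subset] V(3)
          smooth_on_subset[OF sq])
    have \<kappa>: "a1 z = \<kappa> z * b1 z" "a2 z = \<kappa> z * b2 z" if z: "z \<in> V" for z
    proof -
      have "normal_curvature z = 0" using normal_curvature_eq_0 parallel(1,2) z V(3) by auto
      then have "a1 z * b2 z = a2 z * b1 z"
        by (simp add: normal_curvature_def a1_def a2_def b1_def b2_def field_simps)
      then have "a1 z * q z = (a1 z * b1 z + a2 z * b2 z) * b1 z" "a2 z * q z = (a1 z * b1 z + a2 z * b2 z) * b2 z"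
        unfolding q_def by algebra+
      then show "a1 z = \<kappa> z * b1 z" "a2 z = \<kappa> z * b2 z"
        using q0[OF z] by (simp_all add: \<kappa>_def field_simps)
    qed
    have D\<kappa>: "lie E1 \<kappa> z = 0" "lie E2 \<kappa> z = 0" if z: "z \<in> V" for z
    proof -
      have zU: "z \<in> U" using z V(3) by auto
      have D: "lie W a1 z = lie W \<kappa> z * b1 z + \<kappa> z * lie W b1 z"
        "lie W a2 z = lie W \<kappa> z * b2 z + \<kappa> z * lie W b2 z" for W
      proof -
        have "lie W a1 z = lie W (\<lambda>z. \<kappa> z * b1 z) z" by (rule lie_cong[OF V(1) z \<kappa>(1)])
        then show "lie W a1 z = lie W \<kappa> z * b1 z + \<kappa> z * lie W b1 z"
          by (simp add: lie_mult[OF z s\<kappa> smooth_on_subset[OF s(3) V(3)]])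
        have "lie W a2 z = lie W (\<lambda>z. \<kappa> z * b2 z) z" by (rule lie_cong[OF V(1) z \<kappa>(2)])
        then show "lie W a2 z = lie W \<kappa> z * b2 z + \<kappa> z * lie W b2 z"
          by (simp add: lie_mult[OF z s\<kappa> smooth_on_subset[OF s(4) V(3)]])
      qed
      have "lie W (h11 l) z + lie W (h22 l) z = 0" if "lie W P z = 0" for W
        using that by (simp add: lie_P[OF zU])
      then have tr: "lie E1 (h11 l) z + lie E1 (h22 l) z = 0" "lie E2 (h11 l) z + lie E2 (h22 l) z = 0"
        using parallel zU by auto
      have Dl: "lie E1 l z = - h11 l z *\<^sub>R e1 z - h12 l z *\<^sub>R e2 z"
        "lie E2 l z = - h12 l z *\<^sub>R e1 z - h22 l z *\<^sub>R e2 z"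
        using parallel zU by (simp_all add: lie_l)
      have Dn: "lie E1 n z = - h11 n z *\<^sub>R e1 z - h12 n z *\<^sub>R e2 z"
        "lie E2 n z = - h12 n z *\<^sub>R e1 z - h22 n z *\<^sub>R e2 z"
        using parallel zU by (simp_all add: lie_n)
      note tl = traceless_equations[OF smooth_ln(1) normal(1) zU Dl tr, folded a1_def[abs_def] a2_def, folded a1_def]
      note tn = traceless_equations[OF smooth_ln(2) normal(2) zU Dn lie_trace_n[OF zU] lie_trace_n[OF zU],
          folded b1_def[abs_def] b2_def, folded b1_def]
      have tl: "lie E1 a1 z + lie E2 a2 z = 2 * \<omega>1 z * a2 z - 2 * \<omega>2 z * a1 z"
        "lie E2 a1 z - lie E1 a2 z = 2 * \<omega>1 z * a1 z + 2 * \<omega>2 z * a2 z"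
        by (rule tl, assumption)+
      have tn: "lie E1 b1 z + lie E2 b2 z = 2 * \<omega>1 z * b2 z - 2 * \<omega>2 z * b1 z"
        "lie E2 b1 z - lie E1 b2 z = 2 * \<omega>1 z * b1 z + 2 * \<omega>2 z * b2 z"
        by (rule tn, assumption)+
      \<comment> \<open>Subtracting \<kappa> times the system for \<open>b1\<close>,
        \<open>b2\<close> from the one for \<open>a1\<close>, \<open>a2\<close> leaves a homogeneous
        linear system for the derivatives of \<kappa>, with determinant \<open>q\<close>.\<close>
      define k1 k2 where "k1 = lie E1 \<kappa> z" and "k2 = lie E2 \<kappa> z"
      have "k1 * b1 z + k2 * b2 z + \<kappa> z * (lie E1 b1 z + lie E2 b2 z) = \<kappa> z * (2 * \<omega>1 z * b2 z - 2 * \<omega>2 z * b1 z)"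
        using tl(1) by (simp add: D \<kappa>[OF z] k1_def k2_def algebra_simps)
      then have 1: "k1 * b1 z + k2 * b2 z = 0" unfolding tn by simp
      have "k2 * b1 z - k1 * b2 z + \<kappa> z * (lie E2 b1 z - lie E1 b2 z) = \<kappa> z * (2 * \<omega>1 z * b1 z + 2 * \<omega>2 z * b2 z)"
        using tl(2) by (simp add: D \<kappa>[OF z] k1_def k2_def algebra_simps)
      then have 2: "k2 * b1 z - k1 * b2 z = 0" unfolding tn by simp
      have "k1 * q z = 0" "k2 * q z = 0" using 1 2 unfolding q_def by algebra+
      then show "lie E1 \<kappa> z = 0" "lie E2 \<kappa> z = 0" using q0[OF z] by (simp_all add: k1_def k2_def)
    qed
    interpret V: orthonormal_patch V X E1 E2 by (rule orthonormal_patch_subset[OF V(1,3)])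
    have const: "\<kappa> z = \<kappa> w" if z: "z \<in> V" for z
      by (rule V.lie_eq_0_imp_constant[OF s\<kappa> V(1,2) subset_refl D\<kappa> z V(4)])
    have ball: "ball w \<rho> \<subseteq> U" using V(3) by (simp add: V_def)
    show thesis
    proof (rule umbilic_ball_imp_level_function[OF \<rho>(1) ball P[OF w(1)], of 1 "- \<kappa> w"])
      fix z assume "z \<in> ball w \<rho>"
      then have z: "z \<in> V" by (simp add: V_def)
      have "a1 z - \<kappa> w * b1 z = 0" "a2 z - \<kappa> w * b2 z = 0"
        using \<kappa>[OF z] const[OF z] by simp_all
      then show "1 * h11 l z + - \<kappa> w * h11 n z = 1 * h22 l z + - \<kappa> w * h22 n z" "1 * h12 l z + - \<kappa> w * h12 n z = 0"
        by (simp_all add: a1_def a2_def b1_def b2_def field_simps)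
    qed (simp, rule that[OF \<rho>(1) ball])
  qed
qed

end

end

section \<open>From charts to the surface\<close>

locale spacelike_surface =
  fixes M :: "'m topology" and A :: "'m atlas" and x :: "'m \<Rightarrow> real^4"
  assumes surface: "oriented_surface M A" and immersion: "immersion A x" and space_like: "space_like A x"
begin

context
  fixes U \<phi> assumes chart: "(U, \<phi>) \<in> A"
begin

lemma chart_open: "open U"
  and chart_image_open: "openin M (\<phi> ` U)"
  and chart_homeomorphic: "homeomorphic_map (top_of_set U) (subtopology M (\<phi> ` U)) \<phi>"
  using surface chart by (auto simp: oriented_surface_def)

lemma chart_in_topspace: "u \<in> U \<Longrightarrow> \<phi> u \<in> topspace M"
  using openin_subset[OF chart_image_open] by auto

lemma chart_inj: "inj_on \<phi> U"
  using homeomorphic_imp_injective_map[OF chart_homeomorphic] by simp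

lemma chart_open_map:
  assumes "open W" "W \<subseteq> U" shows "openin M (\<phi> ` W)"
proof -
  have "openin (top_of_set U) W" using assms by (simp add: openin_open_eq chart_open)
  then have "openin (subtopology M (\<phi> ` U)) (\<phi> ` W)"
    using homeomorphic_imp_open_map[OF chart_homeomorphic] by (simp add: open_map_def)
  then show ?thesis using chart_image_open openin_trans_full by blast
qed

lemma chart_preimage_open:
  assumes "openin M S" shows "open {u \<in> U. \<phi> u \<in> S}"
proof -
  have "continuous_map (top_of_set U) M \<phi>"
    using homeomorphic_imp_continuous_map[OF chart_homeomorphic] by (simp add: continuous_map_in_subtopology)
  then have "openin (top_of_set U) {u \<in> U. \<phi> u \<in> S}"
    using openin_continuous_map_preimage[OF _ assms] by fastforce
  then show ?thesis using chart_open openin_open_trans by blast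
qed

lemma chart_patch: "spacelike_patch U (x \<circ> \<phi>)"
proof
  show "open U" by (rule chart_open)
  show "smooth_on U (x \<circ> \<phi>)" using immersion chart by (auto simp: immersion_def smooth_function_def)
  show "inj (push (x \<circ> \<phi>) u)" if "u \<in> U" for u using immersion chart that by (auto simp: immersion_def)
  show "mink v v > 0" if "u \<in> U" "v \<in> tangent_plane (x \<circ> \<phi>) u" "v \<noteq> 0" for u v
    using space_like chart that by (auto simp: space_like_def)
qed

end

lemma chart_at:
  assumes "p \<in> topspace M" obtains U \<phi> u where "(U, \<phi>) \<in> A" "u \<in> U" "\<phi> u = p"
proof -
  have "p \<in> (\<Union>(U, \<phi>)\<in>A. \<phi> ` U)" using surface assms by (simp add: oriented_surface_def)
  then show thesis using that by auto
qed

text \<open>Packages a transition map as a \<open>reparametrization\<close>, through which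
  invariants pass from chart to chart.\<close>

lemma chart_transition:
  assumes c: "(U, \<phi>) \<in> A" "(V, \<psi>) \<in> A" and uv: "u \<in> U" "v \<in> V" "\<phi> u = \<psi> v"
  obtains D \<tau> where "reparametrization U (x \<circ> \<phi>) V (x \<circ> \<psi>) D \<tau>" "u \<in> D" "\<tau> u = v"
proof -
  define D where "D = {u \<in> U. \<phi> u \<in> \<psi> ` V}"
  define \<tau> where "\<tau> u = the_inv_into V \<psi> (\<phi> u)" for u
  have "\<forall>(U, \<phi>)\<in>A. \<forall>(V, \<psi>)\<in>A. smooth_on {u \<in> U. \<phi> u \<in> \<psi> ` V} (\<lambda>u. the_inv_into V \<psi> (\<phi> u))"
    using surface unfolding oriented_surface_def Let_def by (auto 0 3)
  then have "smooth_on D \<tau>"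
    using c unfolding D_def \<tau>_def[abs_def] by blast
  moreover have "open D" unfolding D_def by (rule chart_preimage_open[OF c(1) chart_image_open[OF c(2)]])
  moreover have \<tau>: "\<tau> z \<in> V" "\<psi> (\<tau> z) = \<phi> z" if "z \<in> D" for z
    using that the_inv_into_into[OF chart_inj[OF c(2)], of "\<phi> z" V] f_the_inv_into_f[OF chart_inj[OF c(2)], of "\<phi> z"]
    by (auto simp: D_def \<tau>_def)
  ultimately have "reparametrization U (x \<circ> \<phi>) V (x \<circ> \<psi>) D \<tau>"
    by (intro reparametrization.intro reparametrization_axioms.intro chart_patch c)
      (auto simp: D_def)
  moreover have "u \<in> D" using uv by (auto simp: D_def)
  moreover have "\<tau> u = v" using uv the_inv_into_f_f[OF chart_inj[OF c(2)]] by (simp add: \<tau>_def)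
  ultimately show thesis by (rule that)
qed

lemma chart_independent:
  assumes "(U, \<phi>) \<in> A" "(V, \<psi>) \<in> A" "u \<in> U" "v \<in> V" "\<phi> u = \<psi> v"
  shows "mean_curvature (x \<circ> \<phi>) u = mean_curvature (x \<circ> \<psi>) v"
    and "second_ff_norm2 (x \<circ> \<phi>) u = second_ff_norm2 (x \<circ> \<psi>) v"
proof -
  obtain D \<tau> where r: "reparametrization U (x \<circ> \<phi>) V (x \<circ> \<psi>) D \<tau>" and u: "u \<in> D" "\<tau> u = v"
    using chart_transition[OF assms] .
  show "mean_curvature (x \<circ> \<phi>) u = mean_curvature (x \<circ> \<psi>) v"
    "second_ff_norm2 (x \<circ> \<phi>) u = second_ff_norm2 (x \<circ> \<psi>) v"
    using reparametrization.mean_curvature_reparam[OF r u(1)]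
      reparametrization.second_ff_norm2_reparam[OF r u(1)] u(2) by simp_all
qed

text \<open>The truth set of \<open>Q\<close> is clopen, since near each point \<open>Q\<close> is
  constantly true or constantly false. The neighbourhoods are taken in chart coordinates, where
  balls are at hand.\<close>

lemma connected_induct:
  assumes conn: "connected_space M" and ne: "p0 \<in> topspace M" "Q p0"
    and nbhd: "\<And>U \<phi> u. (U, \<phi>) \<in> A \<Longrightarrow> u \<in> U \<Longrightarrow>
      \<exists>W. open W \<and> u \<in> W \<and> W \<subseteq> U \<and> ((\<forall>w\<in>W. Q (\<phi> w)) \<or> (\<forall>w\<in>W. \<not> Q (\<phi> w)))"
    and p: "p \<in> topspace M"
  shows "Q p"
proof -
  define S where "S = {p \<in> topspace M. Q p}"
  have loc: "\<exists>T. openin M T \<and> p \<in> T \<and> ((\<forall>w\<in>T. Q w) \<or> (\<forall>w\<in>T. \<not> Q w))" if p: "p \<in> topspace M" for p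
  proof -
    obtain U \<phi> u where c: "(U, \<phi>) \<in> A" "u \<in> U" "\<phi> u = p" using chart_at[OF p] .
    obtain W where "open W" "u \<in> W" "W \<subseteq> U" "(\<forall>w\<in>W. Q (\<phi> w)) \<or> (\<forall>w\<in>W. \<not> Q (\<phi> w))"
      using nbhd[OF c(1,2)] by blast
    then show ?thesis using chart_open_map[OF c(1)] c(3) by (intro exI[of _ "\<phi> ` W"]) auto
  qed
  have "openin M S"
  proof (subst openin_subopen, intro ballI)
    fix p assume "p \<in> S"
    then obtain T where "openin M T" "p \<in> T" "(\<forall>w\<in>T. Q w) \<or> (\<forall>w\<in>T. \<not> Q w)" "Q p"
      using loc[of p] by (auto simp: S_def)
    then show "\<exists>T. openin M T \<and> p \<in> T \<and> T \<subseteq> S"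
      using openin_subset[of M T] by (intro exI[of _ T]) (auto simp: S_def)
  qed
  moreover have "openin M (topspace M - S)"
  proof (subst openin_subopen, intro ballI)
    fix p assume "p \<in> topspace M - S"
    then obtain T where "openin M T" "p \<in> T" "(\<forall>w\<in>T. Q w) \<or> (\<forall>w\<in>T. \<not> Q w)" "\<not> Q p"
      using loc[of p] by (auto simp: S_def)
    then show "\<exists>T. openin M T \<and> p \<in> T \<and> T \<subseteq> topspace M - S"
      using openin_subset[of M T] by (intro exI[of _ T]) (auto simp: S_def)
  qed
  ultimately have "openin M S \<and> closedin M S" by (auto simp: closedin_def S_def)
  then have "S = {} \<or> S = topspace M" using conn by (auto simp: connected_space_clopen_in)
  then show ?thesis using ne p by (auto simp: S_def)
qed

end

section \<open>Surfaces\<close>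

definition in_model_space :: "(real^4) set \<Rightarrow> bool" where
  "in_model_space S \<longleftrightarrow> S \<subseteq> light_cone \<or> S \<subseteq> euclidean_hyperplane \<or> S \<subseteq> lorentzian_hyperplane \<or>
     (\<exists>c>0. S \<subseteq> de_sitter c) \<or> (\<exists>c>0. S \<subseteq> hyperbolic_space c)"

text \<open>A reflection takes the normalized normal to plus or minus a basis vector, and a
  translation moves the image hyperplane to the origin. A time-like normal leads to the Euclidean
  hyperplane, a space-like one to the Lorentzian.\<close>

lemma hyperplane_isometry:
  assumes \<eta>: "mink \<eta> \<eta> \<noteq> 0"
  obtains T where "mink_isometry T"
    "(\<forall>v. mink v \<eta> = r \<longrightarrow> T v \<in> euclidean_hyperplane) \<or> (\<forall>v. mink v \<eta> = r \<longrightarrow> T v \<in> lorentzian_hyperplane)"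
proof -
  define e :: "real^4" where "e = (if mink \<eta> \<eta> < 0 then axis 1 1 else axis 4 1)"
  define \<epsilon> where "\<epsilon> = mink e e"
  have \<epsilon>: "\<epsilon> = (if mink \<eta> \<eta> < 0 then -1 else 1)" by (simp add: \<epsilon>_def e_def mink_def axis_def)
  define c where "c = 1 / sqrt \<bar>mink \<eta> \<eta>\<bar>"
  have "c * c * \<bar>mink \<eta> \<eta>\<bar> = 1" using \<eta> by (simp add: c_def)
  then have cc: "mink (c *\<^sub>R \<eta>) (c *\<^sub>R \<eta>) = \<epsilon>"
    using \<eta> unfolding \<epsilon> by (auto simp: mink.scaleR_left mink.scaleR_right mult.assoc abs_if split: if_splits)
  \<comment> \<open>The squared lengths of the two candidates for the mirror vector add up to
    \<open>4 * \<epsilon>\<close>, so at least one candidate is non-null and defines a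
    reflection.\<close>
  obtain \<sigma> :: real where \<sigma>: "\<sigma> = 1 \<or> \<sigma> = -1" "mink (c *\<^sub>R \<eta> - \<sigma> *\<^sub>R e) (c *\<^sub>R \<eta> - \<sigma> *\<^sub>R e) \<noteq> 0"
  proof -
    have "mink (c *\<^sub>R \<eta> - \<sigma> *\<^sub>R e) (c *\<^sub>R \<eta> - \<sigma> *\<^sub>R e) = \<epsilon> + \<sigma> * \<sigma> * \<epsilon> - 2 * \<sigma> * mink (c *\<^sub>R \<eta>) e" for \<sigma>
      by (simp add: cc mink.diff_left mink.diff_right) (simp add: mink.scaleR_left mink.scaleR_right \<epsilon>_def mink_commute[of e \<eta>])
    from this[of 1] this[of "-1"] have "mink (c *\<^sub>R \<eta> - 1 *\<^sub>R e) (c *\<^sub>R \<eta> - 1 *\<^sub>R e)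
        + mink (c *\<^sub>R \<eta> - (-1) *\<^sub>R e) (c *\<^sub>R \<eta> - (-1) *\<^sub>R e) = 4 * \<epsilon>" by linarith
    moreover have "\<epsilon> \<noteq> 0" by (simp add: \<epsilon>)
    ultimately show ?thesis using that[of 1] that[of "-1"] by fastforce
  qed
  define d where "d = c *\<^sub>R \<eta> - \<sigma> *\<^sub>R e"
  have d: "mink d d \<noteq> 0" using \<sigma>(2) by (simp add: d_def)
  define R where "R v = v - (2 * mink v d / mink d d) *\<^sub>R d" for v
  have lin: "linear R"
    by (rule linearI) (simp_all add: R_def mink.add_left mink.scaleR_left add_divide_distrib algebra_simps)
  have R: "mink (R v) (R w) = mink v w" for v w
    using d by (simp add: R_def mink_simps
        mink_commute[of d w] field_simps)
  have R\<eta>: "R (c *\<^sub>R \<eta>) = \<sigma> *\<^sub>R e"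
  proof -
    have "2 * mink (c *\<^sub>R \<eta>) d = mink d d"
    proof -
      have "mink (\<sigma> *\<^sub>R e) (\<sigma> *\<^sub>R e) = \<epsilon>" using \<sigma>(1) by (auto simp: mink.scaleR_left mink.scaleR_right \<epsilon>_def mink.minus_left mink.minus_right)
      then show ?thesis unfolding d_def
        by (simp only: mink.diff_left mink.diff_right cc mink_commute[of "\<sigma> *\<^sub>R e" "c *\<^sub>R \<eta>"]) simp
    qed
    then show ?thesis using d by (simp add: R_def d_def)
  qed
  \<comment> \<open>Reflected points have product \<open>\<sigma> * c * r\<close> with
    \<open>e\<close>; as \<open>mink e e = \<epsilon>\<close> and
    \<open>\<epsilon> * \<epsilon> = 1\<close>, the translation cancels it.\<close>
  define T where "T v = R v + (- (\<epsilon> * \<sigma> * c * r)) *\<^sub>R e" for v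
  have "mink_isometry T" unfolding mink_isometry_def T_def[abs_def] using lin R by blast
  moreover have "mink (T v) e = 0" if "mink v \<eta> = r" for v
  proof -
    have "mink (R v) (\<sigma> *\<^sub>R e) = c * r" using R[of v "c *\<^sub>R \<eta>"] that by (simp add: R\<eta> mink.scaleR_right)
    then have "mink (R v) e = \<sigma> * c * r" using \<sigma>(1) by (auto simp: mink.scaleR_right mink.minus_right)
    moreover have "\<epsilon> * \<epsilon> = 1" by (simp add: \<epsilon>)
    moreover have "mink (T v) e = mink (R v) e - (\<epsilon> * \<epsilon>) * (\<sigma> * c * r)"
      unfolding T_def mink.add_left mink.scaleR_left \<epsilon>_def[symmetric] by simp
    ultimately show ?thesis by simp
  qed
  moreover have "mink w (axis 1 1) = - (w$1)" "mink w (axis 4 1) = w$4" for w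
    by (simp_all add: mink_def axis_def)
  ultimately show thesis
    by (intro that[of T]; cases "mink \<eta> \<eta> < 0")
      (simp_all add: e_def euclidean_hyperplane_def lorentzian_hyperplane_def)
qed

text \<open>The second map is a point reflection, which exchanges the two sheets of a hyperboloid of
  time-like vectors.\<close>

lemma mink_isometry_translation: "mink_isometry (\<lambda>v. v - a)" "mink_isometry (\<lambda>v. a - v)"
proof -
  show "mink_isometry (\<lambda>v. v - a)"
    unfolding mink_isometry_def by (intro exI[of _ "\<lambda>v. v"] exI[of _ "- a"]) (auto intro!: linearI)
  show "mink_isometry (\<lambda>v. a - v)"
    unfolding mink_isometry_def
    by (intro exI[of _ uminus] exI[of _ a]) (auto simp: mink.minus_left mink.minus_right intro!: linearI)
qed

section \<open>Globalization over a connected surface\<close>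

context spacelike_surface
begin

lemma CMC_isometry:
  assumes "mink_isometry T"
  shows "CMC A (T \<circ> x) \<longleftrightarrow> CMC A x"
proof -
  obtain L b where L: "linear L" "\<And>v w. mink (L v) (L w) = mink v w" and T: "T = (\<lambda>x. L x + b)"
    using assms by (auto simp: mink_isometry_def)
  have "mink (mean_curvature (T \<circ> x \<circ> \<phi>) u) (mean_curvature (T \<circ> x \<circ> \<phi>) u)
      = mink (mean_curvature (x \<circ> \<phi>) u) (mean_curvature (x \<circ> \<phi>) u)"
    if "(U, \<phi>) \<in> A" "u \<in> U" for U \<phi> u
  proof -
    interpret spacelike_patch U "x \<circ> \<phi>" by (rule chart_patch[OF that(1)])
    have "T \<circ> x \<circ> \<phi> = (\<lambda>u. L ((x \<circ> \<phi>) u) + b)" by (auto simp: T)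
    then show ?thesis using isometry_image(2)[OF L that(2), of b] L(2) by simp
  qed
  then have "\<forall>(U, \<phi>)\<in>A. \<forall>u\<in>U. mink (mean_curvature (T \<circ> x \<circ> \<phi>) u) (mean_curvature (T \<circ> x \<circ> \<phi>) u)
      = mink (mean_curvature (x \<circ> \<phi>) u) (mean_curvature (x \<circ> \<phi>) u)"
    by blast
  then show ?thesis
    unfolding CMC_def by (intro ex_cong1 ball_cong refl) (auto split: prod.splits)
qed

context
  assumes connected: "connected_space M" and nonempty: "topspace M \<noteq> {}"
    and nonnull_charts: "\<forall>(U, \<phi>)\<in>A. \<forall>u\<in>U.
      mink (mean_curvature (x \<circ> \<phi>) u) (mean_curvature (x \<circ> \<phi>) u) \<noteq> 0"
begin

lemma nonnull:
  "(U, \<phi>) \<in> A \<Longrightarrow> u \<in> U \<Longrightarrow> mink (mean_curvature (x \<circ> \<phi>) u) (mean_curvature (x \<circ> \<phi>) u) \<noteq> 0"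
  using bspec[OF nonnull_charts, of "(U, \<phi>)"] by simp

lemma chart_null_frame:
  assumes "(U, \<phi>) \<in> A" obtains E1 E2 l n where "null_frame U (x \<circ> \<phi>) E1 E2 l n"
  using spacelike_patch.null_frame_exists[OF chart_patch[OF assms] nonnull[OF assms]] by blast

text \<open>The eigenvalue has to be one function on \<open>M\<close>: the squared length of the
  second fundamental form does not depend on the chart, so it descends to \<open>M\<close>. Constant
  \<open>P\<close> and a level set force parallel null normals, so \<open>gauss_eigen\<close>
  applies in each chart.\<close>

lemma level_set_imp_pointwise_1_type:
  assumes F: "\<forall>p\<in>topspace M. s * mink (x p) (x p) + mink (x p) \<eta> = r" and nz: "s \<noteq> 0 \<or> \<eta> \<noteq> 0"
    and CMC: "CMC A x"
  shows "pointwise_1_type_first_kind A x"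
proof -
  define f where "f p = (THE r. \<exists>U \<phi> u. (U, \<phi>) \<in> A \<and> u \<in> U \<and> \<phi> u = p \<and> r = second_ff_norm2 (x \<circ> \<phi>) u)" for p
  have f: "f (\<phi> u) = second_ff_norm2 (x \<circ> \<phi>) u" if c: "(U, \<phi>) \<in> A" "u \<in> U" for U \<phi> u
    unfolding f_def
  proof (rule the_equality)
    fix r' assume "\<exists>V \<psi> v. (V, \<psi>) \<in> A \<and> v \<in> V \<and> \<psi> v = \<phi> u \<and> r' = second_ff_norm2 (x \<circ> \<psi>) v"
    then obtain V \<psi> v where "(V, \<psi>) \<in> A" "v \<in> V" "\<psi> v = \<phi> u" "r' = second_ff_norm2 (x \<circ> \<psi>) v" by blast
    then show "r' = second_ff_norm2 (x \<circ> \<phi>) u" using chart_independent(2)[of V \<psi> U \<phi> v u] c by simp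
  qed (use c in blast)
  obtain k where k: "\<forall>(U, \<phi>)\<in>A. \<forall>u\<in>U. mink (mean_curvature (x \<circ> \<phi>) u) (mean_curvature (x \<circ> \<phi>) u) = k"
    using CMC by (auto simp: CMC_def)
  have main: "smooth_on U (f \<circ> \<phi>) \<and> (\<forall>u\<in>U. laplacian (x \<circ> \<phi>) (gauss_map (x \<circ> \<phi>)) u = f (\<phi> u) *\<^sub>R gauss_map (x \<circ> \<phi>) u)"
    if c: "(U, \<phi>) \<in> A" for U \<phi>
  proof -
    obtain E1 E2 l n where "null_frame U (x \<circ> \<phi>) E1 E2 l n" using chart_null_frame[OF c] .
    then interpret null_frame U "x \<circ> \<phi>" E1 E2 l n .
    have Pk: "P u = k / 2" if "u \<in> U" for u
      using mink_mean_curvature[OF that] k c that by auto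
    have P0: "P u \<noteq> 0" if "u \<in> U" for u
      using mink_mean_curvature[OF that] nonnull[OF c that] by auto
    have lP: "lie V P u = 0" if "u \<in> U" for V u
    proof -
      have "lie V P u = lie V (\<lambda>u. k / 2) u" by (rule lie_cong[OF open_U that Pk])
      then show ?thesis by simp
    qed
    have lev: "\<forall>z\<in>U. level_function s \<eta> z = r"
      using F chart_in_topspace[OF c] by (simp add: level_function_def)
    have t: "t1 u = 0" "t2 u = 0" if "u \<in> U" for u
      using level_function_imp_parallel[OF lev nz P0 lP lP that] by auto
    have "smooth_on U (\<lambda>u. 2 * (h11 l u * h11 n u + 2 * (h12 l u * h12 n u) + h22 l u * h22 n u))"
      by (intro smooth_intros open_U smooth_coeffs smooth_ln)
    then have "smooth_on U (f \<circ> \<phi>)"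
      by (rule smooth_on_cong[OF open_U, rotated]) (simp add: f[OF c] second_ff_norm2_frame)
    then show ?thesis using gauss_eigen[OF t lP lP] f[OF c] by simp
  qed
  then show ?thesis
    unfolding pointwise_1_type_first_kind_def smooth_function_def by (intro exI[of _ f]) auto
qed

context
  assumes pointwise: "pointwise_1_type_first_kind A x"
begin

lemma locally_constant_mean_curvature:
  assumes c: "(U, \<phi>) \<in> A" and W: "open W" "convex W" "W \<subseteq> U" "u \<in> W" "w \<in> W"
  shows "mink (mean_curvature (x \<circ> \<phi>) w) (mean_curvature (x \<circ> \<phi>) w)
    = mink (mean_curvature (x \<circ> \<phi>) u) (mean_curvature (x \<circ> \<phi>) u)"
proof -
  obtain f where f: "\<And>u. u \<in> U \<Longrightarrow> laplacian (x \<circ> \<phi>) (gauss_map (x \<circ> \<phi>)) u = f u *\<^sub>R gauss_map (x \<circ> \<phi>) u"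
    using pointwise c unfolding pointwise_1_type_first_kind_def by fast
  obtain E1 E2 l n where "null_frame U (x \<circ> \<phi>) E1 E2 l n" using chart_null_frame[OF c] .
  then interpret null_frame U "x \<circ> \<phi>" E1 E2 l n .
  note par = gauss_eigen_imp[OF _ f]
  have "P w = P u"
    by (rule lie_eq_0_imp_constant[OF smooth_P W(1-3) _ _ W(5,4)]) (use par W(3) in auto)
  moreover have "u \<in> U" "w \<in> U" using W by auto
  ultimately show ?thesis by (simp add: mink_mean_curvature)
qed

lemma local_level_set:
  assumes c: "(U, \<phi>) \<in> A" and u: "u \<in> U"
  obtains W s \<eta> r where "openin M W" "W \<noteq> {}" "s \<noteq> 0 \<or> mink \<eta> \<eta> \<noteq> 0"
    "\<forall>p\<in>W. s * mink (x p) (x p) + mink (x p) \<eta> = r"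
proof -
  obtain f where f: "\<And>u. u \<in> U \<Longrightarrow> laplacian (x \<circ> \<phi>) (gauss_map (x \<circ> \<phi>)) u = f u *\<^sub>R gauss_map (x \<circ> \<phi>) u"
    using pointwise c unfolding pointwise_1_type_first_kind_def by fast
  obtain E1 E2 l n where "null_frame U (x \<circ> \<phi>) E1 E2 l n" using chart_null_frame[OF c] .
  then interpret null_frame U "x \<circ> \<phi>" E1 E2 l n .
  have par: "t1 z = 0" "t2 z = 0" "lie E1 P z = 0" "lie E2 P z = 0" if "z \<in> U" for z
    using gauss_eigen_imp[OF that f[OF that]] by simp_all
  have P0: "P u \<noteq> 0" if "u \<in> U" for u
    using mink_mean_curvature[OF that] nonnull[OF c that] by auto
  obtain w \<rho> s \<eta> r where *: "\<rho> > 0" "ball w \<rho> \<subseteq> U" "s \<noteq> 0 \<or> mink \<eta> \<eta> \<noteq> 0"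
    "\<forall>z\<in>ball w \<rho>. level_function s \<eta> z = r"
    using level_function_exists[OF par u P0] .
  show thesis
    by (rule that[of "\<phi> ` ball w \<rho>" s \<eta> r])
      (use chart_open_map[OF c open_ball *(2)] *(1,3,4) in \<open>auto simp: level_function_def\<close>)
qed

lemma chart_level_continuation:
  assumes c: "(U, \<phi>) \<in> A" and r: "0 < r0" "r0 < r1" "cball z0 r1 \<subseteq> U"
    and F: "\<forall>z\<in>ball z0 r0. s * mink (x (\<phi> z)) (x (\<phi> z)) + mink (x (\<phi> z)) \<eta> = r" and z: "z \<in> ball z0 r1"
  shows "s * mink (x (\<phi> z)) (x (\<phi> z)) + mink (x (\<phi> z)) \<eta> = r"
proof -
  obtain f where f: "\<And>u. u \<in> U \<Longrightarrow> laplacian (x \<circ> \<phi>) (gauss_map (x \<circ> \<phi>)) u = f u *\<^sub>R gauss_map (x \<circ> \<phi>) u"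
    using pointwise c unfolding pointwise_1_type_first_kind_def by fast
  obtain E1 E2 l n where "null_frame U (x \<circ> \<phi>) E1 E2 l n" using chart_null_frame[OF c] .
  then interpret null_frame U "x \<circ> \<phi>" E1 E2 l n .
  have par: "t1 z = 0" "t2 z = 0" "lie E1 P z = 0" "lie E2 P z = 0" if "z \<in> U" for z
    using gauss_eigen_imp[OF that f[OF that]] by simp_all
  show ?thesis
    using level_function_continuation[OF par r _ z, of s \<eta> r] F by (simp add: level_function_def)
qed

lemma pointwise_1_type_imp_CMC: "CMC A x"
proof -
  obtain p0 where p0: "p0 \<in> topspace M" using nonempty by blast
  obtain U0 \<phi>0 u0 where c0: "(U0, \<phi>0) \<in> A" "u0 \<in> U0" "\<phi>0 u0 = p0" using chart_at[OF p0] .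
  define H2 where "H2 \<phi> u = mink (mean_curvature (x \<circ> \<phi>) u) (mean_curvature (x \<circ> \<phi>) u)" for \<phi> :: "real^2 \<Rightarrow> 'm" and u
  \<comment> \<open>The mean curvature lives in charts, so \<open>Q\<close> quantifies over all
    charts through \<open>p\<close>; chart independence reduces it to any single one.\<close>
  define Q where "Q p \<longleftrightarrow> (\<forall>(U, \<phi>)\<in>A. \<forall>u\<in>U. \<phi> u = p \<longrightarrow> H2 \<phi> u = H2 \<phi>0 u0)" for p
  have Q: "Q (\<phi> u) \<longleftrightarrow> H2 \<phi> u = H2 \<phi>0 u0" if "(U, \<phi>) \<in> A" "u \<in> U" for U \<phi> u
  proof
    show "Q (\<phi> u) \<Longrightarrow> H2 \<phi> u = H2 \<phi>0 u0" using that unfolding Q_def by blast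
    have "H2 \<psi> v = H2 \<phi> u" if "(V, \<psi>) \<in> A" "v \<in> V" "\<psi> v = \<phi> u" for V \<psi> v
      unfolding H2_def using chart_independent(1)[OF that(1) \<open>(U, \<phi>) \<in> A\<close> that(2) \<open>u \<in> U\<close> that(3)] by simp
    then show "H2 \<phi> u = H2 \<phi>0 u0 \<Longrightarrow> Q (\<phi> u)" unfolding Q_def by auto
  qed
  have "Q p" if "p \<in> topspace M" for p
  proof (rule connected_induct[OF connected p0 _ _ that])
    show "Q p0" using Q[OF c0(1,2)] c0(3) by simp
    fix U \<phi> u assume c: "(U, \<phi>) \<in> A" "u \<in> U"
    obtain \<rho> where \<rho>: "\<rho> > 0" "ball u \<rho> \<subseteq> U" using chart_open[OF c(1)] c(2) openE by blast
    have "H2 \<phi> w = H2 \<phi> u" if "w \<in> ball u \<rho>" for w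
      unfolding H2_def
      by (rule locally_constant_mean_curvature[OF c(1) open_ball convex_ball \<rho>(2) _ that]) (use \<rho>(1) in simp)
    then have "Q (\<phi> w) \<longleftrightarrow> H2 \<phi> u = H2 \<phi>0 u0" if "w \<in> ball u \<rho>" for w
      using Q[OF c(1), of w] that \<rho>(2) by (metis subsetD)
    then have "(\<forall>w\<in>ball u \<rho>. Q (\<phi> w)) \<or> (\<forall>w\<in>ball u \<rho>. \<not> Q (\<phi> w))" by blast
    then show "\<exists>W. open W \<and> u \<in> W \<and> W \<subseteq> U \<and> ((\<forall>w\<in>W. Q (\<phi> w)) \<or> (\<forall>w\<in>W. \<not> Q (\<phi> w)))"
      using \<rho> by (intro exI[of _ "ball u \<rho>"]) simp
  qed
  then have "H2 \<phi> u = H2 \<phi>0 u0" if "(U, \<phi>) \<in> A" "u \<in> U" for U \<phi> u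
    using Q[OF that] chart_in_topspace[OF that] by blast
  then show ?thesis unfolding CMC_def H2_def by blast
qed

lemma pointwise_1_type_imp_level_set:
  obtains s \<eta> r where "s \<noteq> 0 \<or> mink \<eta> \<eta> \<noteq> 0"
    "\<forall>p\<in>topspace M. s * mink (x p) (x p) + mink (x p) \<eta> = r"
proof -
  obtain p1 where p1: "p1 \<in> topspace M" using nonempty by blast
  obtain U1 \<phi>1 u1 where c1: "(U1, \<phi>1) \<in> A" "u1 \<in> U1" "\<phi>1 u1 = p1" using chart_at[OF p1] .
  obtain T0 s \<eta> r where T0: "openin M T0" "T0 \<noteq> {}" and nz: "s \<noteq> 0 \<or> mink \<eta> \<eta> \<noteq> 0"
    and F: "\<forall>p\<in>T0. s * mink (x p) (x p) + mink (x p) \<eta> = r"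
    using local_level_set[OF c1(1,2)] .
  \<comment> \<open>The equation is asked for on a whole neighbourhood, since continuation starts
    from an open ball.\<close>
  define Q where "Q p \<longleftrightarrow> (\<exists>T. openin M T \<and> p \<in> T \<and> (\<forall>q\<in>T. s * mink (x q) (x q) + mink (x q) \<eta> = r))" for p
  obtain p0 where p0: "p0 \<in> T0" using T0(2) by blast
  have p0M: "p0 \<in> topspace M" using p0 openin_subset[OF T0(1)] by auto
  have "Q p" if "p \<in> topspace M" for p
  proof (rule connected_induct[OF connected p0M _ _ that])
    show "Q p0" using T0(1) F p0 by (auto simp: Q_def)
    fix U \<phi> u assume c: "(U, \<phi>) \<in> A" "u \<in> U"
    obtain \<rho> where \<rho>: "\<rho> > 0" "ball u \<rho> \<subseteq> U" using chart_open[OF c(1)] c(2) openE by blast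
    \<comment> \<open>With a quarter of the radius, a good point \<open>z0\<close> within \<epsilon>
      of \<open>u\<close> has \<open>u\<close> in its ball of radius \<open>2 * \<epsilon>\<close>,
      whose closure still lies in the chart domain.\<close>
    define \<epsilon> where "\<epsilon> = \<rho> / 4"
    have \<epsilon>: "\<epsilon> > 0" "ball u (4 * \<epsilon>) \<subseteq> U" using \<rho> by (auto simp: \<epsilon>_def)
    show "\<exists>W. open W \<and> u \<in> W \<and> W \<subseteq> U \<and> ((\<forall>w\<in>W. Q (\<phi> w)) \<or> (\<forall>w\<in>W. \<not> Q (\<phi> w)))"
    proof (cases "\<exists>z0\<in>ball u \<epsilon>. Q (\<phi> z0)")
      case False
      have "ball u \<epsilon> \<subseteq> U" using \<epsilon> by (auto simp: subset_iff)
      then show ?thesis using False \<epsilon>(1) by (intro exI[of _ "ball u \<epsilon>"]) auto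
    next
      case True
      then obtain z0 T where z0: "dist u z0 < \<epsilon>" and T: "openin M T" "\<phi> z0 \<in> T"
        "\<forall>q\<in>T. s * mink (x q) (x q) + mink (x q) \<eta> = r"
        by (auto simp: Q_def)
      have cb: "cball z0 (2 * \<epsilon>) \<subseteq> U"
      proof
        fix y assume "y \<in> cball z0 (2 * \<epsilon>)"
        then have "dist u y < 4 * \<epsilon>" using z0 \<epsilon>(1) dist_triangle[of u y z0] by simp
        then show "y \<in> U" using \<epsilon>(2) by auto
      qed
      have "z0 \<in> U" using cb \<epsilon>(1) by auto
      then have "z0 \<in> {z \<in> U. \<phi> z \<in> T}" using T(2) by simp
      then obtain r' where r': "r' > 0" "ball z0 r' \<subseteq> {z \<in> U. \<phi> z \<in> T}"
        using chart_preimage_open[OF c(1) T(1)] openE by blast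
      define r0 where "r0 = min r' \<epsilon>"
      have r0: "0 < r0" "r0 < 2 * \<epsilon>" using r' \<epsilon> by (auto simp: r0_def)
      have "\<forall>z\<in>ball z0 r0. s * mink (x (\<phi> z)) (x (\<phi> z)) + mink (x (\<phi> z)) \<eta> = r"
        using T(3) r'(2) by (auto simp: r0_def subset_iff)
      then have *: "s * mink (x (\<phi> z)) (x (\<phi> z)) + mink (x (\<phi> z)) \<eta> = r" if "z \<in> ball z0 (2 * \<epsilon>)" for z
        using chart_level_continuation[OF c(1) r0 cb _ that] by blast
      have sub: "ball z0 (2 * \<epsilon>) \<subseteq> U" using cb by auto
      have "Q (\<phi> w)" if "w \<in> ball z0 (2 * \<epsilon>)" for w
        unfolding Q_def
        by (intro exI[of _ "\<phi> ` ball z0 (2 * \<epsilon>)"] conjI chart_open_map[OF c(1) open_ball sub]) (use that * in auto)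
      moreover have "u \<in> ball z0 (2 * \<epsilon>)" using z0 \<epsilon>(1) by (simp add: dist_commute)
      ultimately show ?thesis using sub by (intro exI[of _ "ball z0 (2 * \<epsilon>)"]) auto
    qed
  qed
  then have "\<forall>p\<in>topspace M. s * mink (x p) (x p) + mink (x p) \<eta> = r"
    by (auto simp: Q_def)
  then show thesis by (rule that[OF nz])
qed

end

text \<open>A time-like vector has non-zero time component, and the sign of this component is
  constant on a connected surface. This decides on which sheet the surface lies;
  \<open>hyperbolic_space\<close> is only the upper one.\<close>

lemma one_sided:
  assumes neg: "\<And>p. p \<in> topspace M \<Longrightarrow> mink (x p - a) (x p - a) < 0"
  shows "(\<forall>p\<in>topspace M. (x p - a)$1 > 0) \<or> (\<forall>p\<in>topspace M. (x p - a)$1 < 0)"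
proof -
  have nz: "(x p - a)$1 \<noteq> 0" if "p \<in> topspace M" for p
  proof
    assume "(x p - a)$1 = 0"
    then have "mink (x p - a) (x p - a) \<ge> 0" by (simp add: mink_def)
    then show False using neg[OF that] by simp
  qed
  have "(x q - a)$1 > 0" if p: "p \<in> topspace M" "(x p - a)$1 > 0" and q: "q \<in> topspace M" for p q
  proof (rule connected_induct[where Q="\<lambda>q. (x q - a)$1 > 0", OF connected p _ q])
    fix U \<phi> u assume c: "(U, \<phi>) \<in> A" "u \<in> U"
    interpret spacelike_patch U "x \<circ> \<phi>" by (rule chart_patch[OF c(1)])
    define g where "g w = (x (\<phi> w) - a)$1" for w
    have "continuous_on U (\<lambda>w. ((x \<circ> \<phi>) w - a)$1)"
      by (intro continuous_intros smooth_on_imp_continuous_on smooth_X)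
    then have "continuous_on U g" by (simp add: g_def[abs_def])
    then have o: "open (U \<inter> g -` {0<..})" "open (U \<inter> g -` {..<0})"
      by (intro continuous_open_preimage open_U; simp)+
    have "g u \<noteq> 0" using nz[OF chart_in_topspace[OF c]] by (simp add: g_def)
    then consider "g u > 0" | "g u < 0" by linarith
    then show "\<exists>W. open W \<and> u \<in> W \<and> W \<subseteq> U \<and> ((\<forall>w\<in>W. 0 < (x (\<phi> w) - a)$1) \<or> (\<forall>w\<in>W. \<not> 0 < (x (\<phi> w) - a)$1))"
    proof cases
      case 1
      then show ?thesis using o(1) c(2) by (intro exI[of _ "U \<inter> g -` {0<..}"]) (auto simp: g_def)
    next
      case 2
      then show ?thesis using o(2) c(2) by (intro exI[of _ "U \<inter> g -` {..<0}"]) (auto simp: g_def)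
    qed
  qed
  then show ?thesis using nz by (metis linorder_less_linear)
qed

text \<open>For \<open>s \<noteq> 0\<close> completing the square gives a pseudo-sphere centred at
  \<open>a\<close>; the sign of \<open>k\<close> selects light cone, de Sitter space or hyperbolic
  space, with \<open>c = 1 / sqrt \<bar>k\<bar>\<close> in the last two cases.\<close>

lemma level_set_isometry:
  assumes F: "\<forall>p\<in>topspace M. s * mink (x p) (x p) + mink (x p) \<eta> = r"
    and nz: "s \<noteq> 0 \<or> mink \<eta> \<eta> \<noteq> 0"
  shows "\<exists>T. mink_isometry T \<and> in_model_space ((T \<circ> x) ` topspace M)"
proof (cases "s = 0")
  case True
  then obtain T where T: "mink_isometry T"
    "(\<forall>v. mink v \<eta> = r \<longrightarrow> T v \<in> euclidean_hyperplane) \<or> (\<forall>v. mink v \<eta> = r \<longrightarrow> T v \<in> lorentzian_hyperplane)"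
    using hyperplane_isometry[of \<eta> r] nz by auto
  then show ?thesis unfolding in_model_space_def using F True by (intro exI[of _ T]) auto
next
  case False
  define a where "a = (- 1 / (2 * s)) *\<^sub>R \<eta>"
  define k where "k = r / s + mink a a"
  have k: "mink (x p - a) (x p - a) = k" if "p \<in> topspace M" for p
  proof -
    have "mink (x p) (x p) + mink (x p) \<eta> / s = r / s" using bspec[OF F that] False by (simp add: field_simps)
    moreover have "mink (x p) a = - (mink (x p) \<eta> / s) / 2" by (simp add: a_def mink.scaleR_right mink.minus_right)
    ultimately show ?thesis
      by (simp add: k_def mink.diff_left mink.diff_right mink_commute[of a "x p"])
  qed
  note tr = mink_isometry_translation(1)[of a]
  consider "k = 0" | "k > 0" | "k < 0" by linarith
  then show ?thesis
  proof cases
    case 1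
    then show ?thesis unfolding in_model_space_def using k tr by (intro exI[of _ "\<lambda>v. v - a"]) (auto simp: light_cone_def)
  next
    case 2
    then have "(1::real) / (1 / sqrt k)\<^sup>2 = k" "1 / sqrt k > 0" by (simp_all add: power_divide)
    then show ?thesis unfolding in_model_space_def using k tr
      by (intro exI[of _ "\<lambda>v. v - a"]) (auto simp: de_sitter_def intro!: exI[of _ "1 / sqrt k"])
  next
    case 3
    have c: "- (1 / (1 / sqrt (- k))\<^sup>2) = k" "1 / sqrt (- k) > 0" using 3 by (simp_all add: power_divide)
    have "(\<forall>p\<in>topspace M. (x p - a)$1 > 0) \<or> (\<forall>p\<in>topspace M. (x p - a)$1 < 0)"
      by (rule one_sided) (use k 3 in simp)
    then show ?thesis
    proof
      assume "\<forall>p\<in>topspace M. (x p - a)$1 > 0"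
      then have "((\<lambda>v. v - a) \<circ> x) ` topspace M \<subseteq> hyperbolic_space (1 / sqrt (- k))"
        using k c(1) by (auto simp: hyperbolic_space_def)
      then show ?thesis unfolding in_model_space_def using tr c(2) by blast
    next
      assume neg: "\<forall>p\<in>topspace M. (x p - a)$1 < 0"
      have "mink (a - x p) (a - x p) = k" if "p \<in> topspace M" for p
        using k[OF that] by (simp add: mink.diff_left mink.diff_right)
      then have "((\<lambda>v. a - v) \<circ> x) ` topspace M \<subseteq> hyperbolic_space (1 / sqrt (- k))"
        using neg c(1) by (auto simp: hyperbolic_space_def)
      then show ?thesis unfolding in_model_space_def using mink_isometry_translation(2)[of a] c(2) by blast
    qed
  qed
qed

text \<open>Points of a model space satisfy \<open>mink v v = k\<close> or
  \<open>mink v e = 0\<close>. As \<open>L\<close> is onto, the translation \<open>b\<close> and the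
  normal \<open>e\<close> are images under \<open>L\<close>, and the equation pulls back along
  \<open>T\<close>.\<close>

lemma isometry_level_set:
  assumes T: "mink_isometry T"
    and img: "in_model_space ((T \<circ> x) ` topspace M)"
  obtains s \<eta> r where "s \<noteq> 0 \<or> \<eta> \<noteq> 0"
    "\<forall>p\<in>topspace M. s * mink (x p) (x p) + mink (x p) \<eta> = r"
proof -
  note level = that
  obtain L b where L: "linear L" "\<And>v w. mink (L v) (L w) = mink v w" and Tb: "T = (\<lambda>x. L x + b)"
    using T by (auto simp: mink_isometry_def)
  have "inj L"
  proof (rule linear_injective_0[THEN iffD2, OF L(1), rule_format])
    fix v assume "L v = 0"
    then have "mink v w = 0" for w using L(2)[of v w] by (simp add: mink.zero_left)
    then show "v = 0" by (rule mink_nondegenerate)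
  qed
  then have surj: "surj L" by (intro linear_injective_imp_surjective[OF L(1)]) simp_all
  have quad: thesis if "\<And>p. p \<in> topspace M \<Longrightarrow> mink (T (x p)) (T (x p)) = k" for k
  proof -
    obtain b' where b': "b = L b'" using surj by (metis surjD)
    have "1 * mink (x p) (x p) + mink (x p) (2 *\<^sub>R b') = k - mink b' b'" if "p \<in> topspace M" for p
    proof -
      have "mink (T (x p)) (T (x p)) = mink (x p + b') (x p + b')"
        unfolding Tb b' linear_add[OF L(1), symmetric] by (rule L(2))
      then show ?thesis using \<open>\<And>p. p \<in> topspace M \<Longrightarrow> mink (T (x p)) (T (x p)) = k\<close>[OF that]
        by (simp add: mink_simps mink_commute[of b' "x p"])
    qed
    then show thesis by (intro level[of 1 "2 *\<^sub>R b'" "k - mink b' b'"]) simp_all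
  qed
  have lin: thesis if e: "e \<noteq> 0" and *: "\<And>p. p \<in> topspace M \<Longrightarrow> mink (T (x p)) e = 0" for e
  proof -
    obtain e' where e': "e = L e'" using surj by (metis surjD)
    have "e' \<noteq> 0" using e e' linear_0[OF L(1)] by auto
    moreover have "0 * mink (x p) (x p) + mink (x p) e' = - mink b e" if "p \<in> topspace M" for p
      using *[OF that] L(2)[of "x p" e'] by (simp add: Tb mink.add_left e')
    ultimately show thesis by (intro level[of 0 e' "- mink b e"]) simp_all
  qed
  have ax: "mink w (axis 1 1) = - (w$1)" "mink w (axis 4 1) = w$4" "axis 1 1 \<noteq> (0::real^4)" "axis 4 1 \<noteq> (0::real^4)" for w
    by (simp_all add: mink_def axis_def vec_eq_iff)
  from img[unfolded in_model_space_def] show thesis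
  proof (elim disjE exE conjE)
    assume "(T \<circ> x) ` topspace M \<subseteq> light_cone"
    then show thesis by (intro quad[of 0]) (auto simp: light_cone_def)
  next
    assume "(T \<circ> x) ` topspace M \<subseteq> euclidean_hyperplane"
    then show thesis using ax by (intro lin[of "axis 1 1"]) (auto simp: euclidean_hyperplane_def)
  next
    assume "(T \<circ> x) ` topspace M \<subseteq> lorentzian_hyperplane"
    then show thesis using ax by (intro lin[of "axis 4 1"]) (auto simp: lorentzian_hyperplane_def)
  next
    fix c assume "(T \<circ> x) ` topspace M \<subseteq> de_sitter c"
    then show thesis by (intro quad[of "1 / c\<^sup>2"]) (auto simp: de_sitter_def)
  next
    fix c assume "(T \<circ> x) ` topspace M \<subseteq> hyperbolic_space c"
    then show thesis by (intro quad[of "- (1 / c\<^sup>2)"]) (auto simp: hyperbolic_space_def)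
  qed
qed

end

end

theorem theorem4p6:
  fixes M :: "'m topology" and A :: "'m atlas" and x :: "'m \<Rightarrow> real^4"
  assumes "oriented_surface M A" and "connected_space M"
    and "immersion A x" and "space_like A x"
    and "\<not> maximal A x"
    and "space_like_mean_curvature A x \<or> time_like_mean_curvature A x"
  shows "pointwise_1_type_first_kind A x \<longleftrightarrow>
    (\<exists>T. mink_isometry T \<and> CMC A (T \<circ> x) \<and>
       ((T \<circ> x) ` topspace M \<subseteq> light_cone \<or>
        (T \<circ> x) ` topspace M \<subseteq> euclidean_hyperplane \<or>
        (T \<circ> x) ` topspace M \<subseteq> lorentzian_hyperplane \<or>
        (\<exists>c>0. (T \<circ> x) ` topspace M \<subseteq> de_sitter c) \<or>
        (\<exists>c>0. (T \<circ> x) ` topspace M \<subseteq> hyperbolic_space c)))"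
proof -
  interpret spacelike_surface M A x by unfold_locales (fact assms)+
  \<comment> \<open>On a surface without points \<open>maximal\<close> would hold vacuously.\<close>
  have ne: "topspace M \<noteq> {}"
    using assms(5) chart_in_topspace unfolding maximal_def by blast
  have nn: "\<forall>(U, \<phi>)\<in>A. \<forall>u\<in>U. mink (mean_curvature (x \<circ> \<phi>) u) (mean_curvature (x \<circ> \<phi>) u) \<noteq> 0"
    using assms(6) unfolding space_like_mean_curvature_def time_like_mean_curvature_def
    by (elim disjE; intro ballI; elim ballE) (auto split: prod.splits dest: less_imp_neq)
  note ctx = assms(2) ne nn
  show ?thesis
    unfolding in_model_space_def[symmetric]
  proof
    assume pw: "pointwise_1_type_first_kind A x"
    obtain s \<eta> r where "s \<noteq> 0 \<or> mink \<eta> \<eta> \<noteq> 0"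
      "\<forall>p\<in>topspace M. s * mink (x p) (x p) + mink (x p) \<eta> = r"
      by (rule pointwise_1_type_imp_level_set[OF ctx pw])
    from level_set_isometry[OF ctx this(2,1)] obtain T where T: "mink_isometry T" "in_model_space ((T \<circ> x) ` topspace M)"
      by blast
    moreover have "CMC A (T \<circ> x)"
      using CMC_isometry[OF T(1)] pointwise_1_type_imp_CMC[OF ctx pw] by simp
    ultimately show "\<exists>T. mink_isometry T \<and> CMC A (T \<circ> x) \<and> in_model_space ((T \<circ> x) ` topspace M)" by blast
  next
    assume "\<exists>T. mink_isometry T \<and> CMC A (T \<circ> x) \<and> in_model_space ((T \<circ> x) ` topspace M)"
    then obtain T where T: "mink_isometry T" "CMC A (T \<circ> x)"
       "in_model_space ((T \<circ> x) ` topspace M)" by blast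
    obtain s \<eta> r where "s \<noteq> 0 \<or> \<eta> \<noteq> 0"
      "\<forall>p\<in>topspace M. s * mink (x p) (x p) + mink (x p) \<eta> = r"
      by (rule isometry_level_set[OF ctx T(1,3)])
    then show "pointwise_1_type_first_kind A x"
      using level_set_imp_pointwise_1_type[OF ctx] CMC_isometry[OF T(1)] T(2) by blast
  qed
qed

end
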